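(* Suppose that the following five conditions hold, with a value of $m$ in (A1) and (A2) such that $(n\epsilon_n^2)^{-m/2}=\mathcal{O}(\epsilon_n^2)$. (A1) For $n$ large enough and for some $m\ge 2$, $K(p_0^{(n)},p_{0j_n}^{(n)})\le n\epsilon_n^2$ and $V_{m,0}(p_0^{(n)},p_{0j_n}^{(n)})\le (n\epsilon_n^2)^{m/2}$. (A2) With the same $m$, there exists $H_1>0$ such that $\mathcal{A}_n(H_1)\subset\widetilde{\mathcal{B}}_n(m)$. (A3) There exist three non-negative constants $D_0,D_1,D_2$ such that, for any two $\boldsymbol\theta,\boldsymbol\theta'\in\Theta_{k_n}(Q)$, $d_n(\boldsymbol\theta,\boldsymbol\theta')\le D_0k_n^{D_1}\|\boldsymbol\theta-\boldsymbol\theta'\|_{2,k_n}^{D_2}$. (A4) There exist two positive constants $c_1$ and $\zeta<1$ such that, for every $\boldsymbol\theta_1\in\Theta_{k_n}(Q)$, there exists a test $\phi_n(\boldsymbol\theta_1)\in[0,1]$ which satisfies $$\mathbb{E}_0^{(n)}(\phi_n(\boldsymbol\theta_1))\le e^{-c_1nd_n^2(\boldsymbol\theta_0,\boldsymbol\theta_1)}\quad\text{and}\quad \sup_{d_n(\boldsymbol\theta,\boldsymbol\theta_1)<\zeta d_n(\boldsymbol\theta_0,\boldsymbol\theta_1)}\mathbb{E}_{\boldsymbol\theta}^{(n)}(1-\phi_n(\boldsymbol\theta_1))\le e^{-c_1nd_n^2(\boldsymbol\theta_0,\boldsymbol\theta_1)}.$$ (A5) There exist positive constants $a,b,G_1,G_2,G_3,G_4,H_2,\alpha,\tau_0$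 and a constant $C$ such that $e^{-akL(k)}\le\pi(k)\le e^{-bkL(k)}$ for all $k=1,2,\ldots$; $G_1e^{-G_2|\theta|^\alpha}\le g(\theta)\le G_3e^{-G_4|\theta|^\alpha}$ for all $\theta\in\mathbb{R}$; $\max_{j\ge1}\tau_j\le\tau_0$; $\min_{j\le k_n}\tau_j\ge n^{-H_2}$; and $\sum_{j=1}^{j_n}|\theta_{0j}|^\alpha/\tau_j^\alpha\le Cj_n\log n$. Suppose moreover that $d_n$ is bounded on $\Theta$, i.e. there is a constant $D$ with $d_n(\boldsymbol\theta,\boldsymbol\theta')\le D$ for all $\boldsymbol\theta,\boldsymbol\theta'\in\Theta$. Then the expected posterior risk given $\boldsymbol\theta_0$ and $\Pi$ converges at least at the same rate $\epsilon_n$, in the sense that $$\mathcal{R}_n^{d_n}=\mathbb{E}_0^{(n)}\,\Pi\big(d_n^2(\boldsymbol\theta,\boldsymbol\theta_0)\,\big|\,X^n\big)=\mathcal{O}\Big(\frac{\log n}{L(n)}\epsilon_n^2\Big).$$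
   Context: Model. For each $n\ge1$, $(\mathcal{X}^{(n)},A^{(n)},P_{\boldsymbol\theta}^{(n)}:\boldsymbol\theta\in\Theta)$ is a statistical model with $\Theta\subseteq\mathbb{R}^{\mathbb{N}}$ (sequences $\boldsymbol\theta=(\theta_j)_{j\ge1}$, with a $\sigma$-field), dominated by a reference measure $\mu$, with densities $p_{\boldsymbol\theta}^{(n)}$; the observations are $X^n$. The true parameter is $\boldsymbol\theta_0\in\Theta$; $p_0^{(n)}=p_{\boldsymbol\theta_0}^{(n)}$, and $\mathbb{E}_0^{(n)},\mathbb{E}_{\boldsymbol\theta}^{(n)}$ are expectations under $P_{\boldsymbol\theta_0}^{(n)},P_{\boldsymbol\theta}^{(n)}$. $d_n$ is a semimetric on $\Theta$. Sieves. $\Theta_k=\mathbb{R}^k$ is identified with the set of sequences whose entries vanish beyond index $k$. $\boldsymbol\theta_{0k}$ is the projection of $\boldsymbol\theta_0$ on its first $k$ coordinates, $p_{0k}^{(n)}$ is the density of the observations at $\boldsymbol\theta_{0k}$, and $\|\cdot\|_{2,k}$ is the $l^2$ norm restricted to the first $k$ coordinates. Rates. $(\epsilon_n)_{n\ge1}$ is a sequence of positive numbers with $\epsilon_n\to0$ and $n\epsilon_n^2/\log n\to\infty$. For $j_0>0$ and $M_0>1$, $j_n=\lfloor j_0n\epsilon_n^2/\log n\rfloor$ and $k_n=\lfloor M_0j_n\log(n)/L(n)\rfloor$, where $L$ is a slowly varying function such that $L\le\log$ (hence $j_n\le k_n$). For $Q>0$, $\Theta_{k_n}(Q)=\{\boldsymbol\theta\in\Theta_{k_n}:\|\boldsymbol\theta\|_{2,k_n}\le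 n^Q\}$. Divergences. $K(f,g)=\int f\log(f/g)\,d\mu$; for $m\ge2$, $V_{m,0}(f,g)=\int f|\log(f/g)-K(f,g)|^m d\mu$; $\widetilde K(f,g)=\int p_0^{(n)}|\log(f/g)|\,d\mu$; $\widetilde V_{m,0}(f,g)=\int p_0^{(n)}|\log(f/g)-K(f,g)|^md\mu$. Neighbourhoods. $\widetilde{\mathcal{B}}_n(m)=\{\boldsymbol\theta\in\Theta_{j_n}:\widetilde K(p_{0j_n}^{(n)},p_{\boldsymbol\theta}^{(n)})\le n\epsilon_n^2,\ \widetilde V_{m,0}(p_{0j_n}^{(n)},p_{\boldsymbol\theta}^{(n)})\le(n\epsilon_n^2)^{m/2}\}$ and, for $H_1>0$, $\mathcal{A}_n(H_1)=\{\boldsymbol\theta\in\Theta_{j_n}:\|\boldsymbol\theta_{0j_n}-\boldsymbol\theta\|_{2,j_n}\le n^{-H_1}\}$. Sieve prior. $\Pi=\sum_{k\ge1}\pi(k)\Pi_k$ with $\pi(k)\ge0$, $\sum_k\pi(k)=1$, where $\Pi_k$ has mass only on $\Theta_k$, with Lebesgue density $\prod_{j=1}^k\tau_j^{-1}g(\theta_j/\tau_j)$ on $\mathbb{R}^k$, for a probability density $g$ on $\mathbb{R}$ and positive scales $\boldsymbol\tau=(\tau_j)_{j\ge1}$ ($\Pi,\Pi_k,\pi,g,\boldsymbol\tau$ may depend on $n$). The case of the prior truncated to an $l^1$ ball of radius $r_1>0$, $\Pi_k(\boldsymbol\theta_k)\propto\prod_{j=1}^k\tau_j^{-1}g(\theta_j/\tau_j)\,\mathbb{I}(\sum_{j=1}^k|\theta_j|\le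 r_1)$, is also considered. Posterior. For measurable $B\subseteq\Theta$, $\Pi(B|X^n)=\int_Bp_{\boldsymbol\theta}^{(n)}(X^n)d\Pi(\boldsymbol\theta)/\int_\Theta p_{\boldsymbol\theta}^{(n)}(X^n)d\Pi(\boldsymbol\theta)$; the same notation $\Pi(\cdot\,|X^n)$ is used for the posterior expectation of a function of $\boldsymbol\theta$.
   Formalization: M_0 and Q must be large, above thresholds depending only on j_0, m, Λ and the constants in (A2), (A5); L(n) ≤ Λ L(k_n) for large n is assumed; D_2 > 0 in (A3); for the truncated prior the l^1 norm of θ_0 is at most r_1; L ≤ log is needed only for large arguments. *)

theory Defs
  imports "HOL-Probability.Probability" "HOL-Library.Landau_Symbols"
begin

section \<open>Sequences and sieves\<close>

text \<open>
  Parameters are sequences indexed from \<open>0\<close>: the entry of \<open>\<theta>\<close> at \<open>i\<close> is the coordinate written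
  \<open>\<theta>\<^sub>j\<close> with \<open>j = i + 1\<close> on paper, so that "the first \<open>k\<close> coordinates" are those in \<open>{..<k}\<close>. The
  same holds for the scales \<open>\<tau>\<close>.
\<close>

definition trunc :: "nat \<Rightarrow> (nat \<Rightarrow> real) \<Rightarrow> nat \<Rightarrow> real" where
  "trunc k \<theta> = (\<lambda>i. if i < k then \<theta> i else 0)"

definition sieve :: "nat \<Rightarrow> (nat \<Rightarrow> real) set" where
  "sieve k = {\<theta>. \<forall>i\<ge>k. \<theta> i = 0}"

definition sieve_ball :: "nat \<Rightarrow> real \<Rightarrow> (nat \<Rightarrow> real) set" where
  "sieve_ball k r = {\<theta> \<in> sieve k. L2_set \<theta> {..<k} \<le> r}"

text \<open>
  The parameter set is \<open>space S\<close>, equipped with the \<open>\<sigma>\<close>-field \<open>sets S\<close> (no measure carried by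
  \<open>S\<close> is used). Applied to the points of the product space over \<open>{..<k}\<close>, \<open>trunc k\<close> is the
  identification of \<open>\<real>\<^sup>k\<close> with \<open>sieve k\<close>. Its measurability says that the sieves are contained in the
  parameter set and that a distribution on \<open>\<real>\<^sup>k\<close> is a distribution on the parameter set.
\<close>

definition parameter_space :: "(nat \<Rightarrow> real) measure \<Rightarrow> bool" where
  "parameter_space S \<longleftrightarrow> (\<forall>k. trunc k \<in> (\<Pi>\<^sub>M i\<in>{..<k}. borel) \<rightarrow>\<^sub>M S)"

text \<open>
  Neither the triangle inequality nor separation of points is required, so that this covers both
  usual meanings of "semimetric".
\<close>

definition semimetric_on :: "'a set \<Rightarrow> ('a \<Rightarrow> 'a \<Rightarrow> real) \<Rightarrow> bool" where
  "semimetric_on T d \<longleftrightarrow>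
     (\<forall>x\<in>T. d x x = 0) \<and> (\<forall>x\<in>T. \<forall>y\<in>T. 0 \<le> d x y \<and> d x y = d y x)"

section \<open>Rates\<close>

definition slowly_varying :: "(real \<Rightarrow> real) \<Rightarrow> bool" where
  "slowly_varying L \<longleftrightarrow>
     L \<in> borel_measurable borel \<and> (\<forall>\<^sub>F x in at_top. 0 < L x) \<and>
     (\<forall>c>0. ((\<lambda>x. L (c * x) / L x) \<longlongrightarrow> 1) at_top)"

definition rate :: "(nat \<Rightarrow> real) \<Rightarrow> bool" where
  "rate \<epsilon> \<longleftrightarrow>
     (\<forall>n. 0 < \<epsilon> n) \<and> \<epsilon> \<longlonglongrightarrow> 0 \<and>
     filterlim (\<lambda>n. real n * (\<epsilon> n)\<^sup>2 / ln (real n)) at_top sequentially"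

definition jn :: "real \<Rightarrow> (nat \<Rightarrow> real) \<Rightarrow> nat \<Rightarrow> nat" where
  "jn j0 \<epsilon> n = nat \<lfloor>j0 * real n * (\<epsilon> n)\<^sup>2 / ln (real n)\<rfloor>"

text \<open>
  Slow variation alone does not bound \<open>L n\<close> by a multiple of \<open>L (kn M0 j0 L \<epsilon> n)\<close>, even when
  \<open>kn M0 j0 L \<epsilon> n\<close> is at least a power of \<open>n\<close> (take \<open>L (exp t)\<close> growing from \<open>1\<close> to \<open>t\<close> on
  some intervals \<open>[t/2, t]\<close>). Where this bound is needed, it is a separate hypothesis.
\<close>

definition kn :: "real \<Rightarrow> real \<Rightarrow> (real \<Rightarrow> real) \<Rightarrow> (nat \<Rightarrow> real) \<Rightarrow> nat \<Rightarrow> nat" where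
  "kn M0 j0 L \<epsilon> n = nat \<lfloor>M0 * real (jn j0 \<epsilon> n) * ln (real n) / L (real n)\<rfloor>"

section \<open>Statistical models and divergences\<close>

definition statistical_model ::
    "(nat \<Rightarrow> real) measure \<Rightarrow> 'x measure \<Rightarrow> ((nat \<Rightarrow> real) \<Rightarrow> 'x \<Rightarrow> real) \<Rightarrow> bool" where
  "statistical_model S \<mu> p \<longleftrightarrow>
     sigma_finite_measure \<mu> \<and>
     (\<lambda>(\<theta>, x). p \<theta> x) \<in> borel_measurable (S \<Otimes>\<^sub>M \<mu>) \<and>
     (\<forall>\<theta>\<in>space S. (\<forall>x\<in>space \<mu>. 0 \<le> p \<theta> x) \<and> (\<integral>\<^sup>+x. ennreal (p \<theta> x) \<partial>\<mu>) = 1)"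

definition law :: "'x measure \<Rightarrow> ('t \<Rightarrow> 'x \<Rightarrow> real) \<Rightarrow> 't \<Rightarrow> 'x measure" where
  "law \<mu> p \<theta> = density \<mu> (\<lambda>x. ennreal (p \<theta> x))"

text \<open>
  \<open>log_ratio u v\<close> is \<open>ln (u / v)\<close> for \<open>u, v \<ge> 0\<close>, with its infinite values. The value at
  \<open>u = v = 0\<close> is a convention. It is multiplied by \<open>u = 0\<close> in \<open>KL\<close> and \<open>V\<close>; in \<open>K_tilde\<close> and
  \<open>V_tilde\<close> below it can only matter where \<open>f0 > 0 = f\<close>, a null set as soon as \<open>KL \<mu> f0 f < \<infinity>\<close>.
\<close>

definition log_ratio :: "real \<Rightarrow> real \<Rightarrow> ereal" where
  "log_ratio u v =
     (if 0 < u \<and> 0 < v then ereal (ln (u / v))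
      else if 0 < u then \<infinity> else if 0 < v then -\<infinity> else 0)"

text \<open>Positive minus negative part, because \<open>f ln (f / g)\<close> need not be integrable.\<close>

definition KL :: "'x measure \<Rightarrow> ('x \<Rightarrow> real) \<Rightarrow> ('x \<Rightarrow> real) \<Rightarrow> ereal" where
  "KL \<mu> f g =
     enn2ereal (\<integral>\<^sup>+x. ennreal (f x) * e2ennreal (log_ratio (f x) (g x)) \<partial>\<mu>) -
     enn2ereal (\<integral>\<^sup>+x. ennreal (f x) * e2ennreal (- log_ratio (f x) (g x)) \<partial>\<mu>)"

definition abs_pow :: "real \<Rightarrow> ereal \<Rightarrow> ennreal" where
  "abs_pow m x = (if \<bar>x\<bar> = \<infinity> then \<infinity> else ennreal (\<bar>real_of_ereal x\<bar> powr m))"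

definition V :: "real \<Rightarrow> 'x measure \<Rightarrow> ('x \<Rightarrow> real) \<Rightarrow> ('x \<Rightarrow> real) \<Rightarrow> ennreal" where
  "V m \<mu> f g = (\<integral>\<^sup>+x. ennreal (f x) * abs_pow m (log_ratio (f x) (g x) - KL \<mu> f g) \<partial>\<mu>)"

text \<open>
  In the next two, the density \<open>f0\<close> of the truth replaces \<open>f\<close> as the integrating density, but
  the centring in \<open>V_tilde\<close> is still \<open>KL \<mu> f g\<close>.
\<close>

definition K_tilde ::
    "'x measure \<Rightarrow> ('x \<Rightarrow> real) \<Rightarrow> ('x \<Rightarrow> real) \<Rightarrow> ('x \<Rightarrow> real) \<Rightarrow> ennreal" where
  "K_tilde \<mu> f0 f g = (\<integral>\<^sup>+x. ennreal (f0 x) * e2ennreal \<bar>log_ratio (f x) (g x)\<bar> \<partial>\<mu>)"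

definition V_tilde ::
    "real \<Rightarrow> 'x measure \<Rightarrow> ('x \<Rightarrow> real) \<Rightarrow> ('x \<Rightarrow> real) \<Rightarrow> ('x \<Rightarrow> real) \<Rightarrow> ennreal" where
  "V_tilde m \<mu> f0 f g =
     (\<integral>\<^sup>+x. ennreal (f0 x) * abs_pow m (log_ratio (f x) (g x) - KL \<mu> f g) \<partial>\<mu>)"

text \<open>In the two neighbourhoods, \<open>j\<close> is the sieve dimension and \<open>s\<close> stands for \<open>n \<epsilon>\<^sub>n\<^sup>2\<close>.\<close>

definition kl_nbhd ::
    "'x measure \<Rightarrow> ((nat \<Rightarrow> real) \<Rightarrow> 'x \<Rightarrow> real) \<Rightarrow> (nat \<Rightarrow> real) \<Rightarrow> real \<Rightarrow> nat \<Rightarrow> real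
      \<Rightarrow> (nat \<Rightarrow> real) set" where
  "kl_nbhd \<mu> p \<theta>0 m j s =
     {\<theta> \<in> sieve j. K_tilde \<mu> (p \<theta>0) (p (trunc j \<theta>0)) (p \<theta>) \<le> ennreal s \<and>
                    V_tilde m \<mu> (p \<theta>0) (p (trunc j \<theta>0)) (p \<theta>) \<le> ennreal (s powr (m / 2))}"

definition l2_nbhd :: "(nat \<Rightarrow> real) \<Rightarrow> nat \<Rightarrow> real \<Rightarrow> (nat \<Rightarrow> real) set" where
  "l2_nbhd \<theta>0 j r = {\<theta> \<in> sieve j. L2_set (\<lambda>i. trunc j \<theta>0 i - \<theta> i) {..<j} \<le> r}"

section \<open>Sieve prior and posterior\<close>

definition prob_density :: "(real \<Rightarrow> real) \<Rightarrow> bool" where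
  "prob_density g \<longleftrightarrow>
     g \<in> borel_measurable borel \<and> (\<forall>x. 0 \<le> g x) \<and> (\<integral>\<^sup>+x. ennreal (g x) \<partial>lborel) = 1"

definition coord_prior :: "(real \<Rightarrow> real) \<Rightarrow> (nat \<Rightarrow> real) \<Rightarrow> nat \<Rightarrow> (nat \<Rightarrow> real) measure" where
  "coord_prior g \<tau> k =
     density (\<Pi>\<^sub>M i\<in>{..<k}. lborel) (\<lambda>\<theta>. ennreal (\<Prod>i<k. g (\<theta> i / \<tau> i) / \<tau> i))"

definition component ::
    "(nat \<Rightarrow> real) measure \<Rightarrow> (real \<Rightarrow> real) \<Rightarrow> (nat \<Rightarrow> real) \<Rightarrow> nat \<Rightarrow> (nat \<Rightarrow> real) measure" where
  "component S g \<tau> k = distr (coord_prior g \<tau> k) S (trunc k)"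

text \<open>
  \<open>uniform_measure M A\<close> is \<open>M\<close> conditioned on \<open>A\<close>, so this has Lebesgue density proportional to
  that of \<open>coord_prior g \<tau> k\<close> times the indicator of the \<open>l\<^sup>1\<close> ball.
\<close>

definition truncated_component ::
    "real \<Rightarrow> (nat \<Rightarrow> real) measure \<Rightarrow> (real \<Rightarrow> real) \<Rightarrow> (nat \<Rightarrow> real) \<Rightarrow> nat
      \<Rightarrow> (nat \<Rightarrow> real) measure" where
  "truncated_component r S g \<tau> k =
     distr (uniform_measure (coord_prior g \<tau> k)
              {\<theta> \<in> space (\<Pi>\<^sub>M i\<in>{..<k}. lborel). (\<Sum>i<k. \<bar>\<theta> i\<bar>) \<le> r}) S (trunc k)"

text \<open>The mixture of the components \<open>K k\<close> with weights \<open>pmf w k\<close>; see \<open>emeasure_mixture\<close> below.\<close>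

definition mixture :: "nat pmf \<Rightarrow> (nat \<Rightarrow> 't measure) \<Rightarrow> 't measure" where
  "mixture w K = measure_pmf w \<bind> K"

definition posterior :: "'t measure \<Rightarrow> ('t \<Rightarrow> 'x \<Rightarrow> real) \<Rightarrow> 'x \<Rightarrow> 't measure" where
  "posterior prior p x =
     density prior (\<lambda>\<theta>. ennreal (p \<theta> x) / (\<integral>\<^sup>+\<theta>'. ennreal (p \<theta>' x) \<partial>prior))"

definition posterior_risk ::
    "'x measure \<Rightarrow> ('t \<Rightarrow> 'x \<Rightarrow> real) \<Rightarrow> 't measure \<Rightarrow> ('t \<Rightarrow> 't \<Rightarrow> real) \<Rightarrow> 't \<Rightarrow> real" where
  "posterior_risk \<mu> p prior d \<theta>0 =
     (\<integral>x. (\<integral>\<theta>. (d \<theta> \<theta>0)\<^sup>2 \<partial>posterior prior p x) \<partial>law \<mu> p \<theta>0)"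

section \<open>Conditions\<close>

definition approximation_condition where
  "approximation_condition \<mu> p \<theta>0 \<epsilon> j0 m \<longleftrightarrow>
     (\<forall>\<^sub>F n in sequentially.
        KL (\<mu> n) (p n \<theta>0) (p n (trunc (jn j0 \<epsilon> n) \<theta>0)) \<le> ereal (real n * (\<epsilon> n)\<^sup>2) \<and>
        V m (\<mu> n) (p n \<theta>0) (p n (trunc (jn j0 \<epsilon> n) \<theta>0))
          \<le> ennreal ((real n * (\<epsilon> n)\<^sup>2) powr (m / 2)))"

definition neighbourhood_condition where
  "neighbourhood_condition \<mu> p \<theta>0 \<epsilon> j0 m H1 \<longleftrightarrow>
     (\<forall>\<^sub>F n in sequentially.
        l2_nbhd \<theta>0 (jn j0 \<epsilon> n) (real n powr (- H1))
          \<subseteq> kl_nbhd (\<mu> n) (p n) \<theta>0 m (jn j0 \<epsilon> n) (real n * (\<epsilon> n)\<^sup>2))"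

text \<open>
  In the next two, \<open>k n\<close> is the dimension \<open>k\<^sub>n\<close> of the large sieve. The exponent \<open>D2\<close> must not
  vanish: otherwise every bounded \<open>d\<close> would satisfy the condition, and it would give no control of
  the entropy of the sieve.
\<close>

definition metric_condition where
  "metric_condition d k Q \<longleftrightarrow>
     (\<exists>D0 D1 D2 :: real. 0 \<le> D0 \<and> 0 \<le> D1 \<and> 0 < D2 \<and>
       (\<forall>\<^sub>F n in sequentially.
          \<forall>\<theta> \<in> sieve_ball (k n) (real n powr Q). \<forall>\<theta>' \<in> sieve_ball (k n) (real n powr Q).
            d n \<theta> \<theta>' \<le> D0 * real (k n) powr D1 * L2_set (\<lambda>i. \<theta> i - \<theta>' i) {..<k n} powr D2))"

definition test_condition where
  "test_condition S \<mu> p \<theta>0 d k Q \<longleftrightarrow>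
     (\<exists>c1 \<zeta> :: real. 0 < c1 \<and> 0 < \<zeta> \<and> \<zeta> < 1 \<and>
       (\<forall>\<^sub>F n in sequentially.
          \<forall>\<theta>1 \<in> sieve_ball (k n) (real n powr Q).
            \<exists>\<phi> \<in> borel_measurable (\<mu> n). (\<forall>x\<in>space (\<mu> n). 0 \<le> \<phi> x \<and> \<phi> x \<le> 1) \<and>
              (\<integral>x. \<phi> x \<partial>law (\<mu> n) (p n) \<theta>0) \<le> exp (- c1 * real n * (d n \<theta>0 \<theta>1)\<^sup>2) \<and>
              (\<forall>\<theta> \<in> space S. d n \<theta> \<theta>1 < \<zeta> * d n \<theta>0 \<theta>1 \<longrightarrow>
                 (\<integral>x. 1 - \<phi> x \<partial>law (\<mu> n) (p n) \<theta>) \<le> exp (- c1 * real n * (d n \<theta>0 \<theta>1)\<^sup>2))))"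

definition weight_condition where
  "weight_condition w L a b \<longleftrightarrow>
     (\<forall>\<^sub>F n in sequentially. \<forall>k\<ge>1.
        exp (- a * real k * L (real k)) \<le> pmf (w n) k \<and>
        pmf (w n) k \<le> exp (- b * real k * L (real k)))"

definition tail_condition where
  "tail_condition g G1 G2 G3 G4 \<alpha> \<longleftrightarrow>
     (\<forall>\<^sub>F n in sequentially. \<forall>t.
        G1 * exp (- G2 * \<bar>t\<bar> powr \<alpha>) \<le> g n t \<and> g n t \<le> G3 * exp (- G4 * \<bar>t\<bar> powr \<alpha>))"

definition scale_condition where
  "scale_condition \<tau> \<theta>0 j k \<alpha> \<tau>0 H2 C \<longleftrightarrow>
     (\<forall>\<^sub>F n in sequentially.
        (\<forall>i. \<tau> n i \<le> \<tau>0) \<and> (\<forall>i<k n. real n powr (- H2) \<le> \<tau> n i) \<and>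
        (\<Sum>i<j n. \<bar>\<theta>0 i\<bar> powr \<alpha> / \<tau> n i powr \<alpha>) \<le> C * real (j n) * ln (real n))"

section \<open>The prior as a weighted sum\<close>

lemma prob_space_coord_prior:
  assumes g: "prob_density g" and \<tau>: "\<And>i. 0 < \<tau> i"
  shows "prob_space (coord_prior g \<tau> k)"
proof -
  have [measurable]: "g \<in> borel_measurable borel" and g0: "\<And>x. 0 \<le> g x"
    and g1: "(\<integral>\<^sup>+x. ennreal (g x) \<partial>lborel) = 1"
    using g by (auto simp: prob_density_def)
  interpret product_sigma_finite "\<lambda>_::nat. lborel :: real measure"
    by standard
  have one: "(\<integral>\<^sup>+x. ennreal (g (x / \<tau> i) / \<tau> i) \<partial>lborel) = 1" for i
  proof -
    have "1 = ennreal \<bar>1 / \<tau> i\<bar> * (\<integral>\<^sup>+x. ennreal (g (0 + 1 / \<tau> i * x)) \<partial>lborel)"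
      using \<tau>[of i] by (subst g1[symmetric], subst nn_integral_real_affine[where c = "1 / \<tau> i" and t = 0]) auto
    also have "\<dots> = (\<integral>\<^sup>+x. ennreal \<bar>1 / \<tau> i\<bar> * ennreal (g (0 + 1 / \<tau> i * x)) \<partial>lborel)"
      by (rule nn_integral_cmult[symmetric]) simp
    also have "\<dots> = (\<integral>\<^sup>+x. ennreal (g (x / \<tau> i) / \<tau> i) \<partial>lborel)"
      using \<tau>[of i] g0 by (intro nn_integral_cong) (simp add: ennreal_mult[symmetric])
    finally show ?thesis by simp
  qed
  have "emeasure (coord_prior g \<tau> k) (space (coord_prior g \<tau> k)) =
      (\<integral>\<^sup>+\<theta>. (\<Prod>i<k. ennreal (g (\<theta> i / \<tau> i) / \<tau> i)) \<partial>(\<Pi>\<^sub>M i\<in>{..<k}. lborel))"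
    unfolding coord_prior_def using g0 \<tau>
    by (subst emeasure_density)
       (auto intro!: nn_integral_cong prod_ennreal[symmetric] simp: less_imp_le
             simp del: PiM_cong)
  also have "\<dots> = (\<Prod>i<k. \<integral>\<^sup>+x. ennreal (g (x / \<tau> i) / \<tau> i) \<partial>lborel)"
    by (rule product_nn_integral_prod) auto
  finally show ?thesis
    by (intro prob_spaceI) (simp add: one)
qed

lemma measurable_trunc:
  assumes "parameter_space S"
  shows "trunc k \<in> coord_prior g \<tau> k \<rightarrow>\<^sub>M S"
proof -
  have "sets (coord_prior g \<tau> k) = sets (\<Pi>\<^sub>M i\<in>{..<k}. (borel :: real measure))"
    unfolding coord_prior_def sets_density by (rule sets_PiM_cong) simp_all
  with assms show ?thesis
    unfolding parameter_space_def by (simp cong: measurable_cong_sets)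
qed

lemma component_in_subprob_algebra:
  assumes "parameter_space S" "prob_density g" "\<And>i. 0 < \<tau> i"
  shows "component S g \<tau> k \<in> space (subprob_algebra S)"
  using prob_space.prob_space_distr[OF prob_space_coord_prior[OF assms(2,3)] measurable_trunc[OF assms(1)]]
  by (auto simp: component_def space_subprob_algebra intro: prob_space_imp_subprob_space)

lemma truncated_component_in_subprob_algebra:
  assumes "parameter_space S" "prob_density g" "\<And>i. 0 < \<tau> i"
  shows "truncated_component r S g \<tau> k \<in> space (subprob_algebra S)"
proof -
  let ?P = "coord_prior g \<tau> k"
  let ?B = "{\<theta> \<in> space (\<Pi>\<^sub>M i\<in>{..<k}. (lborel :: real measure)). (\<Sum>i<k. \<bar>\<theta> i\<bar>) \<le> r}"
  interpret P: prob_space ?P by (rule prob_space_coord_prior[OF assms(2,3)])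
  have "(\<lambda>\<theta>. \<Sum>i<k. \<bar>\<theta> i\<bar>) \<in> borel_measurable (\<Pi>\<^sub>M i\<in>{..<k}. (lborel :: real measure))"
    by (intro borel_measurable_sum borel_measurable_abs) (simp add: measurable_component_singleton)
  then have B: "?B \<in> sets ?P"
    by (simp add: coord_prior_def)
  have ne: "space S \<noteq> {}"
    using measurable_space[OF measurable_trunc[OF assms(1)]] P.not_empty by blast
  have t: "trunc k \<in> uniform_measure ?P ?B \<rightarrow>\<^sub>M S"
    using measurable_trunc[OF assms(1), of k g \<tau>] by (simp cong: measurable_cong_sets)
  have "emeasure (uniform_measure ?P ?B) (space ?P) \<le> 1"
  proof -
    have "e / e \<le> 1" if "e < top" for e :: ennreal
      using that by (cases "e = 0") (simp_all add: ennreal_divide_self)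
    moreover have "emeasure ?P ?B < top"
      by (simp add: less_top[symmetric])
    moreover have "?B \<inter> space ?P = ?B"
      using sets.sets_into_space[OF B] by blast
    ultimately show ?thesis
      by (simp only: emeasure_uniform_measure[OF B sets.top])
  qed
  then have "subprob_space (uniform_measure ?P ?B)"
    using P.not_empty by (intro subprob_spaceI) simp_all
  then have "subprob_space (distr (uniform_measure ?P ?B) S (trunc k))"
    using t ne by (rule subprob_space.subprob_space_distr)
  then show ?thesis
    by (simp add: truncated_component_def space_subprob_algebra)
qed

lemma emeasure_mixture:
  assumes "\<And>k. K k \<in> space (subprob_algebra S)" and "A \<in> sets S"
  shows "emeasure (mixture w K) A = (\<Sum>k. ennreal (pmf w k) * emeasure (K k) A)"
proof -
  have "emeasure (mixture w K) A = (\<integral>\<^sup>+k. emeasure (K k) A \<partial>measure_pmf w)"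
    unfolding mixture_def using assms by (intro emeasure_bind[where N = S]) auto
  also have "\<dots> = (\<integral>\<^sup>+k. ennreal (pmf w k) * emeasure (K k) A \<partial>count_space UNIV)"
    by (rule nn_integral_measure_pmf)
  finally show ?thesis
    by (simp add: nn_integral_count_space_nat)
qed

end

theory Submission
  imports Defs
begin

text \<open>
  Write \<open>s = n \<epsilon>\<^sub>n\<^sup>2\<close>, \<open>r\<^sup>2 = (ln n / L n) \<epsilon>\<^sub>n\<^sup>2\<close>, and \<open>j \<le> k\<close> for the two sieve dimensions. Since \<open>d\<close> is
  bounded by some \<open>D\<close>, the risk is at most \<open>R\<^sup>2 + D\<^sup>2 q\<close>, where \<open>q\<close> is the expected posterior mass of
  \<open>{d > R}\<close> (\<open>posterior_risk_le\<close>). With \<open>R\<^sup>2 = M r\<^sup>2\<close> and \<open>M\<close> large it suffices that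
  \<open>q = O(s powr (- m / 2))\<close>, because \<open>s powr (- m / 2) = O(\<epsilon>\<^sub>n\<^sup>2)\<close> by hypothesis and
  \<open>\<epsilon>\<^sub>n\<^sup>2 \<le> r\<^sup>2\<close> by \<open>L \<le> ln\<close>.

  The posterior mass is a quotient of integrals over the prior, and the two integrals are treated
  separately.

  \<^item> Denominator (\<open>evidence_lower_bound\<close>). Two applications of the Markov inequality to log-likelihood
    ratios (\<open>log_ratio_deviation\<close>) show that, up to an event of probability \<open>3 s powr (- m / 2)\<close>,
    \<open>p\<^sub>\<theta> \<ge> exp (- 6 s) p\<^sub>0\<close> holds on a set of prior mass at least \<open>\<beta> / 2\<close>, where \<open>\<beta>\<close> is a lower
    bound on the prior mass around the truncated truth, so that the integral is at least
    \<open>exp (- 6 s) (\<beta> / 2) p\<^sub>0\<close>. This event carries the only error that is not exponentially small.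

  \<^item> Numerator (\<open>posterior_mass_bound\<close>). On the sieve ball of dimension \<open>k\<close>, a test that combines the
    local tests over a finite net has both errors exponentially small in \<open>n R\<^sup>2\<close>
    (\<open>global_test\<close>): the net has \<open>exp (O(k ln n))\<close> points, and \<open>k ln n = O(n r\<^sup>2)\<close>, which
    a large \<open>M\<close> absorbs. Outside the sieve ball the prior mass itself is small.

  It remains to compare prior masses with \<open>exp (- s)\<close>. A box near the truncated truth whose sides
  are a power of \<open>n\<close> has mass at least \<open>exp (- O(j ln n))\<close> under the component of dimension \<open>j\<close>, the
  weight of that component is at least \<open>exp (- a j ln n)\<close>, and \<open>j ln n \<le> j0 s\<close>; hence
  \<open>\<beta> \<ge> exp (- c s)\<close> with \<open>c\<close> depending on the fixed constants only. The weights beyond \<open>k\<close> add up to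
  \<open>O(exp (- (c + 8) s))\<close> as soon as \<open>M0\<close> is large; here \<open>k L(k)\<close> has to be bounded below for all
  large \<open>k\<close>, not only along \<open>k\<^sub>n\<close>, which is the lower Potter bound for slowly varying functions
  (\<open>slowly_varying_Potter_lower\<close>). The norms exceeding \<open>n powr Q\<close> are negligible
  because \<open>g\<close> has stretched exponential tails and \<open>Q \<ge> 2 + 2 / \<alpha>\<close>.

  The neighbourhood and the sieve ball may fail to be measurable in the parameter space. Their prior
  masses are therefore expressed through the measurable sets that contain the former, or
  are disjoint from the latter.
\<close>

section \<open>Slowly varying functions\<close>

text \<open>
  The uniform convergence theorem for slowly varying functions, in additive form. If it failed along
  \<open>x n\<close>, \<open>u n\<close>, then for large \<open>n\<close> most points \<open>y\<close> of an interval would have \<open>f (x n + y)\<close> close to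
  \<open>f (x n)\<close>, and most would have it close to \<open>f (x n + u n)\<close>; a common point contradicts the
  distance of these two values. Measurability of \<open>f\<close> is essential.
\<close>
lemma uniform_slow_increments:
  fixes f :: "real \<Rightarrow> real"
  assumes [measurable]: "f \<in> borel_measurable borel"
    and lim: "\<And>u. ((\<lambda>x. f (x + u) - f x) \<longlongrightarrow> 0) at_top"
    and e: "0 < e"
  shows "\<exists>X. \<forall>x\<ge>X. \<forall>u\<in>{0..1}. \<bar>f (x + u) - f x\<bar> < e"
proof (rule ccontr)
  assume "\<not> ?thesis"
  then have "\<forall>n::nat. \<exists>x u. x \<ge> real n \<and> u \<in> {0..1} \<and> e \<le> \<bar>f (x + u) - f x\<bar>"
    by (meson not_less)
  then obtain x u where x: "\<And>n. real n \<le> x n" and u: "\<And>n. u n \<in> {0..1}"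
    and big: "\<And>n. e \<le> \<bar>f (x n + u n) - f (x n)\<bar>"
    by metis
  have x_top: "filterlim x at_top sequentially"
    using x by (intro filterlim_at_top_mono[OF filterlim_real_sequentially]) auto
  define G where "G z n = {y \<in> {0..2}. \<forall>m\<ge>n. \<bar>f (z m + y) - f (z m)\<bar> < e / 2}"
    for z :: "nat \<Rightarrow> real" and n :: nat
  have G_sets [measurable]: "G z n \<in> sets borel" for z n
    unfolding G_def by measurable
  have G_large: "\<forall>\<^sub>F n in sequentially. ennreal (3 / 2) < emeasure lborel (G z n)"
    if z: "filterlim z at_top sequentially" for z
  proof -
    have "incseq (G z)"
      unfolding incseq_def G_def by auto
    then have "(\<lambda>n. emeasure lborel (G z n)) \<longlonglongrightarrow> emeasure lborel (\<Union>n. G z n)"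
      by (intro Lim_emeasure_incseq) auto
    moreover have "(\<Union>n. G z n) = {0..2}"
    proof -
      have "\<exists>n. y \<in> G z n" if "y \<in> {0..2}" for y
      proof -
        have "((\<lambda>m. f (z m + y) - f (z m)) \<longlonglongrightarrow> 0)"
          using filterlim_compose[OF lim z] by simp
        then have "\<forall>\<^sub>F m in sequentially. \<bar>f (z m + y) - f (z m)\<bar> < e / 2"
          using e by (auto simp: tendsto_iff dist_real_def dest: spec[of _ "e / 2"])
        with that show ?thesis
          by (auto simp: G_def eventually_sequentially)
      qed
      then show ?thesis by (auto simp: G_def)
    qed
    ultimately have "(\<lambda>n. emeasure lborel (G z n)) \<longlonglongrightarrow> ennreal 2"
      by simp
    moreover have "ennreal (3 / 2) < ennreal 2"
      by (simp add: ennreal_lessI)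
    ultimately show ?thesis
      by (rule order_tendstoD)
  qed
  have "filterlim (\<lambda>n. x n + u n) at_top sequentially"
    using u by (intro filterlim_at_top_mono[OF x_top]) auto
  then have "\<forall>\<^sub>F n in sequentially. ennreal (3 / 2) < emeasure lborel (G x n) \<and>
      ennreal (3 / 2) < emeasure lborel (G (\<lambda>n. x n + u n) n)"
    using G_large[OF x_top] G_large by (auto intro: eventually_conj)
  then obtain N where N: "ennreal (3 / 2) < emeasure lborel (G x N)"
      "ennreal (3 / 2) < emeasure lborel (G (\<lambda>n. x n + u n) N)"
    by (auto simp: eventually_sequentially)
  (* The translate makes the base points of the two increments comparable. *)
  define W where "W = (+) (- u N) -` G (\<lambda>n. x n + u n) N"
  have W_sets [measurable]: "W \<in> sets borel"
    unfolding W_def using measurable_sets_borel[of "(+) (- u N)" borel, OF _ G_sets] by simp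
  have "emeasure lborel W = emeasure (distr lborel borel ((+) (- u N))) (G (\<lambda>n. x n + u n) N)"
    unfolding W_def by (subst emeasure_distr) auto
  also have "\<dots> = emeasure lborel (G (\<lambda>n. x n + u n) N)"
    by (simp add: lborel_distr_plus)
  finally have W: "ennreal (3 / 2) < emeasure lborel W"
    using N by simp
  (* Both sets have measure above 3/2 and lie in an interval of length 3. *)
  have "G x N \<inter> W \<noteq> {}"
  proof
    assume disj: "G x N \<inter> W = {}"
    have "ennreal 3 = ennreal (3 / 2) + ennreal (3 / 2)"
      by (subst ennreal_plus[symmetric]) auto
    also have "\<dots> < emeasure lborel (G x N) + emeasure lborel W"
      using N(1) W by (intro add_strict_mono)
    also have "\<dots> = emeasure lborel (G x N \<union> W)"
      using disj by (intro plus_emeasure) auto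
    also have "\<dots> \<le> emeasure lborel {0..3::real}"
      using u[of N] by (intro emeasure_mono) (auto simp: G_def W_def)
    finally show False by simp
  qed
  then obtain y where "y \<in> G x N" "y \<in> W" by auto
  then have "\<bar>f (x N + y) - f (x N)\<bar> < e / 2"
    and "\<bar>f (x N + u N + (- u N + y)) - f (x N + u N)\<bar> < e / 2"
    unfolding G_def W_def by blast+
  moreover have "x N + u N + (- u N + y) = x N + y" by simp
  ultimately have "\<bar>f (x N + y) - f (x N)\<bar> < e / 2" "\<bar>f (x N + y) - f (x N + u N)\<bar> < e / 2"
    by simp_all
  with big[of N] show False by linarith
qed

text \<open>
  In logarithmic coordinates \<open>f x = ln (L (exp x))\<close>, an increment over a unit interval is eventually
  above \<open>- 1 / 2\<close>, so that \<open>f\<close> decreases at most at slope \<open>1 / 2\<close> up to the additive constant \<open>1 / 2\<close>.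
  This makes the lower bound uniform in \<open>y\<close>, with constants that do not depend on \<open>L\<close>.
\<close>
lemma slowly_varying_Potter_lower:
  assumes "slowly_varying L"
  shows "\<exists>X>0. \<forall>x\<ge>X. 0 < L x \<and> (\<forall>y\<ge>x. exp (- 1 / 2) * sqrt (x / y) * L x \<le> L y)"
proof -
  have [measurable]: "L \<in> borel_measurable borel" and pos: "\<forall>\<^sub>F x in at_top. 0 < L x"
    and sv: "\<And>c. c > 0 \<Longrightarrow> ((\<lambda>x. L (c * x) / L x) \<longlongrightarrow> 1) at_top"
    using assms by (auto simp: slowly_varying_def)
  define f where "f x = ln (L (exp x))" for x
  have pos': "\<forall>\<^sub>F x in at_top. 0 < L (exp x)"
    using eventually_compose_filterlim[OF pos exp_at_top] .
  have "((\<lambda>x. f (x + u) - f x) \<longlongrightarrow> 0) at_top" for u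
  proof -
    have "((\<lambda>x. ln (L (exp u * exp x) / L (exp x))) \<longlongrightarrow> ln 1) at_top"
      by (intro tendsto_ln filterlim_compose[OF sv exp_at_top]) auto
    moreover have "\<forall>\<^sub>F x in at_top. ln (L (exp u * exp x) / L (exp x)) = f (x + u) - f x"
    proof -
      have "\<forall>\<^sub>F x in at_top. 0 < L (exp (x + u))"
        by (rule eventually_compose_filterlim[OF pos'])
           (use filterlim_tendsto_add_at_top[OF tendsto_const filterlim_ident, of u] in
             \<open>simp add: add.commute\<close>)
      with pos' show ?thesis
        by eventually_elim (simp add: f_def exp_add mult.commute ln_div)
    qed
    ultimately show ?thesis
      by (simp add: tendsto_cong)
  qed
  moreover have "f \<in> borel_measurable borel"
    unfolding f_def by measurable
  ultimately have "\<exists>X. \<forall>x\<ge>X. \<forall>u\<in>{0..1}. \<bar>f (x + u) - f x\<bar> < 1 / 2"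
    by (intro uniform_slow_increments) simp_all
  then obtain X0 where X0: "\<And>x u. x \<ge> X0 \<Longrightarrow> u \<in> {0..1} \<Longrightarrow> \<bar>f (x + u) - f x\<bar> < 1 / 2"
    by blast
  obtain X1 where X1: "\<And>x. x \<ge> X1 \<Longrightarrow> 0 < L x"
    using pos by (auto simp: eventually_at_top_linorder)
  have step: "f x - real n / 2 \<le> f (x + real n)" if "x \<ge> X0" for x n
  proof (induction n)
    case (Suc n)
    have "\<bar>f (x + real n + 1) - f (x + real n)\<bar> < 1 / 2"
      using that by (intro X0) auto
    then have "f (x + real n) - 1 / 2 < f (x + real n + 1)" by linarith
    then have "f x - real n / 2 - 1 / 2 \<le> f (x + real n + 1)"
      using Suc by argo
    then show ?case
      by (simp add: add_divide_distrib diff_diff_eq ac_simps)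
  qed simp
  have grow: "f x - v / 2 - 1 / 2 \<le> f (x + v)" if "x \<ge> X0" "v \<ge> 0" for x v
  proof -
    define n where "n = nat \<lfloor>v\<rfloor>"
    have n: "real n \<le> v" "v \<le> real n + 1"
      using that by (simp_all add: n_def)
    have "\<bar>f (x + real n + (v - real n)) - f (x + real n)\<bar> < 1 / 2"
      using that n by (intro X0) auto
    moreover have "x + real n + (v - real n) = x + v" by simp
    ultimately have "\<bar>f (x + v) - f (x + real n)\<bar> < 1 / 2" by (simp only:)
    then have "f (x + real n) - 1 / 2 < f (x + v)" by linarith
    with step[OF that(1), of n] n show ?thesis by linarith
  qed
  define X where "X = Max {exp X0, X1, 1}"
  have X: "X > 0" "X \<ge> X1" "X \<ge> exp X0" by (auto simp: X_def)
  show ?thesis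
  proof (intro exI[of _ X] conjI allI impI)
    fix x y assume xy: "x \<ge> X" "y \<ge> x"
    then have p: "x > 0" "y > 0" "L x > 0" "L y > 0" using X X1[of x] X1[of y] by auto
    have "ln x \<ge> X0"
      using xy X p by (simp add: ln_ge_iff)
    then have "f (ln x) - (ln y - ln x) / 2 - 1 / 2 \<le> f (ln x + (ln y - ln x))"
      using xy p by (intro grow) auto
    then have "ln (L x) - (ln y - ln x) / 2 - 1 / 2 \<le> ln (L y)"
      using p by (simp add: f_def)
    moreover have "ln (exp (- 1 / 2) * sqrt (x / y) * L x) = ln (L x) - (ln y - ln x) / 2 - 1 / 2"
      using p by (simp add: ln_mult ln_sqrt ln_div field_simps)
    ultimately have "ln (exp (- 1 / 2) * sqrt (x / y) * L x) \<le> ln (L y)" by simp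
    then show "exp (- 1 / 2) * sqrt (x / y) * L x \<le> L y"
      using p by (subst (asm) ln_le_cancel_iff) auto
  qed (use X X1 in auto)
qed

section \<open>Deviations of log-likelihood ratios\<close>

lemma borel_measurable_log_ratio [measurable]:
  assumes [measurable]: "f \<in> borel_measurable M" "g \<in> borel_measurable M"
  shows "(\<lambda>x. log_ratio (f x) (g x)) \<in> borel_measurable M"
  unfolding log_ratio_def by measurable

lemma borel_measurable_abs_pow [measurable]:
  assumes [measurable]: "f \<in> borel_measurable M"
  shows "(\<lambda>x. abs_pow m (f x)) \<in> borel_measurable M"
  unfolding abs_pow_def by measurable

text \<open>
  Markov's inequality of order \<open>m\<close> for the log-likelihood ratio. The bound on the centring \<open>\<kappa>\<close> may be
  one-sided: infinite values of \<open>\<kappa>\<close> or of the ratio make the integrand infinite, which only helps.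
\<close>
lemma log_ratio_deviation:
  assumes [measurable]: "f0 \<in> borel_measurable \<mu>" "f \<in> borel_measurable \<mu>" "g \<in> borel_measurable \<mu>"
    and nonneg: "\<And>x. x \<in> space \<mu> \<Longrightarrow> 0 \<le> g x"
    and s: "0 < s" and m: "0 < m"
    and \<kappa>: "\<kappa> \<le> ereal t"
    and V: "(\<integral>\<^sup>+x. ennreal (f0 x) * abs_pow m (log_ratio (f x) (g x) - \<kappa>) \<partial>\<mu>) \<le> ennreal (s powr (m / 2))"
  shows "(\<integral>\<^sup>+x. ennreal (f0 x) * indicator {x. exp (t + s) * g x < f x} x \<partial>\<mu>)
    \<le> ennreal (s powr (- m / 2))"
proof -
  let ?I = "\<integral>\<^sup>+x. ennreal (f0 x) * indicator {x. exp (t + s) * g x < f x} x \<partial>\<mu>"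
  have "ennreal (s powr m) * (ennreal (f0 x) * indicator {x. exp (t + s) * g x < f x} x)
      \<le> ennreal (f0 x) * abs_pow m (log_ratio (f x) (g x) - \<kappa>)" if x: "x \<in> space \<mu>" for x
  proof (cases "exp (t + s) * g x < f x")
    case True
    have "0 \<le> exp (t + s) * g x"
      using nonneg[OF x] by simp
    with True have fx: "0 < f x" by linarith
    have "ennreal (s powr m) \<le> abs_pow m (log_ratio (f x) (g x) - \<kappa>)"
    proof (cases "\<bar>log_ratio (f x) (g x) - \<kappa>\<bar> = \<infinity>")
      case False
      then have gx: "0 < g x"
        using nonneg[OF x] fx \<kappa> by (cases \<kappa>) (auto simp: log_ratio_def split: if_splits)
      have lr: "log_ratio (f x) (g x) = ereal (ln (f x / g x))"
        using fx gx by (simp add: log_ratio_def)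
      with False \<kappa> obtain k where k: "\<kappa> = ereal k" "k \<le> t"
        by (cases \<kappa>) auto
      have "exp (t + s) < f x / g x"
        using True gx by (simp add: field_simps)
      then have "t + s < ln (f x / g x)"
        using fx gx by (metis divide_pos_pos exp_less_cancel_iff exp_ln)
      then have "s \<le> ln (f x / g x) - k" using k by simp
      then have "s powr m \<le> \<bar>ln (f x / g x) - k\<bar> powr m"
        using s m by (intro powr_mono2) auto
      then show ?thesis
        by (simp add: abs_pow_def lr k ennreal_leI)
    qed (simp add: abs_pow_def)
    with True show ?thesis
      by (simp add: mult.commute[of "ennreal (s powr m)"] mult_left_mono)
  qed simp
  then have "(\<integral>\<^sup>+x. ennreal (s powr m) * (ennreal (f0 x) * indicator {x. exp (t + s) * g x < f x} x) \<partial>\<mu>)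
      \<le> ennreal (s powr (m / 2))"
    by (intro order_trans[OF nn_integral_mono V])
  then have "ennreal (s powr m) * ?I \<le> ennreal (s powr (m / 2))"
    by (subst (asm) nn_integral_cmult) measurable
  then have "ennreal (s powr (- m)) * (ennreal (s powr m) * ?I)
      \<le> ennreal (s powr (- m)) * ennreal (s powr (m / 2))"
    by (rule mult_left_mono) simp
  moreover have "ennreal (s powr (- m)) * (ennreal (s powr m) * ?I) = ?I"
    using s by (simp add: mult.assoc[symmetric] ennreal_mult[symmetric] powr_add[symmetric])
  moreover have "ennreal (s powr (- m)) * ennreal (s powr (m / 2)) = ennreal (s powr (- m / 2))"
    using s by (simp add: ennreal_mult[symmetric] powr_add[symmetric])
  ultimately show ?thesis by simp
qed

text \<open>
  In \<open>V_tilde\<close> the log ratio is integrated under the truth but centred at a divergence with respect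
  to another density. The two moment conditions force this centring to be of the order of \<open>s\<close>
  nevertheless, because the ratio is close to it on average and has itself a small absolute mean.
\<close>
lemma centring_bound:
  assumes [measurable]: "f0 \<in> borel_measurable \<mu>" "f \<in> borel_measurable \<mu>" "g \<in> borel_measurable \<mu>"
    and one: "(\<integral>\<^sup>+x. ennreal (f0 x) \<partial>\<mu>) = 1"
    and s: "1 \<le> s" and m: "2 \<le> m"
    and K: "(\<integral>\<^sup>+x. ennreal (f0 x) * e2ennreal \<bar>log_ratio (f x) (g x)\<bar> \<partial>\<mu>) \<le> ennreal s"
    and V: "(\<integral>\<^sup>+x. ennreal (f0 x) * abs_pow m (log_ratio (f x) (g x) - \<kappa>) \<partial>\<mu>) \<le> ennreal (s powr (m / 2))"
  shows "\<kappa> \<le> ereal (3 * s)"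
proof -
  (* The triangle inequality, and \<open>y \<le> s + y powr m * s powr (1 - m)\<close> for \<open>y \<ge> 0\<close>: the second
    term dominates when \<open>y > s\<close>. If \<open>X\<close> or \<open>\<kappa>\<close> is infinite, so is the last term. *)
  have pw: "e2ennreal \<kappa> \<le> e2ennreal \<bar>X\<bar> + ennreal s + abs_pow m (X - \<kappa>) * ennreal (s powr (1 - m))" for X
  proof (cases "\<bar>X - \<kappa>\<bar> = \<infinity>")
    case True
    then show ?thesis using s by (simp add: abs_pow_def ennreal_top_mult)
  next
    case False
    then obtain k x where k: "\<kappa> = ereal k" and x: "X = ereal x"
      by (cases X; cases \<kappa>) auto
    define y where "y = \<bar>x - k\<bar>"
    have "y \<le> s + y powr m * s powr (1 - m)"
    proof (cases "y \<le> s")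
      case False
      then have y: "s < y" by simp
      have "y = y powr m * y powr (1 - m)"
        using y s by (simp add: powr_add[symmetric])
      also have "\<dots> \<le> y powr m * s powr (1 - m)"
        using y s m by (intro mult_left_mono powr_mono2') auto
      finally show ?thesis using s by linarith
    qed (simp add: add_increasing2)
    then have "k \<le> \<bar>x\<bar> + s + y powr m * s powr (1 - m)"
      by (simp add: y_def)
    then have "ennreal k \<le> ennreal (\<bar>x\<bar> + s + y powr m * s powr (1 - m))"
      by (rule ennreal_leI)
    also have "\<dots> = ennreal \<bar>x\<bar> + ennreal s + ennreal (y powr m) * ennreal (s powr (1 - m))"
      using s by (simp add: ennreal_mult)
    finally show ?thesis
      using k x by (simp add: abs_pow_def y_def e2ennreal_ereal)
  qed
  have "e2ennreal \<kappa> = (\<integral>\<^sup>+x. e2ennreal \<kappa> * ennreal (f0 x) \<partial>\<mu>)"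
    by (subst nn_integral_cmult) (auto simp: one)
  also have "\<dots> \<le> (\<integral>\<^sup>+x. ennreal (f0 x) * e2ennreal \<bar>log_ratio (f x) (g x)\<bar> + ennreal s * ennreal (f0 x)
      + ennreal (s powr (1 - m)) * (ennreal (f0 x) * abs_pow m (log_ratio (f x) (g x) - \<kappa>)) \<partial>\<mu>)"
  proof (intro nn_integral_mono)
    fix x
    show "e2ennreal \<kappa> * ennreal (f0 x) \<le> ennreal (f0 x) * e2ennreal \<bar>log_ratio (f x) (g x)\<bar>
        + ennreal s * ennreal (f0 x)
        + ennreal (s powr (1 - m)) * (ennreal (f0 x) * abs_pow m (log_ratio (f x) (g x) - \<kappa>))"
      using mult_right_mono[OF pw[of "log_ratio (f x) (g x)"], of "ennreal (f0 x)"]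
      by (simp add: distrib_right distrib_left ac_simps)
  qed
  also have "\<dots> = (\<integral>\<^sup>+x. ennreal (f0 x) * e2ennreal \<bar>log_ratio (f x) (g x)\<bar> \<partial>\<mu>) + ennreal s
      + ennreal (s powr (1 - m)) * (\<integral>\<^sup>+x. ennreal (f0 x) * abs_pow m (log_ratio (f x) (g x) - \<kappa>) \<partial>\<mu>)"
    by (simp add: nn_integral_add nn_integral_cmult one)
  also have "\<dots> \<le> ennreal s + ennreal s + ennreal (s powr (1 - m)) * ennreal (s powr (m / 2))"
    using K V by (intro add_mono mult_left_mono) auto
  also have "\<dots> = ennreal (2 * s + s powr (1 - m / 2))"
    using s by (simp add: ennreal_mult[symmetric] powr_add[symmetric] ennreal_plus[symmetric] del: ennreal_plus)
  also have "\<dots> \<le> ennreal (3 * s)"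
  proof (rule ennreal_leI)
    have "s powr (1 - m / 2) \<le> s powr 1"
      using s m by (intro powr_mono) auto
    then show "2 * s + s powr (1 - m / 2) \<le> 3 * s"
      using s by simp
  qed
  finally have "e2ennreal \<kappa> \<le> e2ennreal (ereal (3 * s))"
    by (simp add: e2ennreal_ereal)
  then show ?thesis
    using s by (cases \<kappa>) (auto simp: e2ennreal_ereal ennreal_le_iff top_unique e2ennreal_infty)
qed

section \<open>Evidence, posterior mass and risk\<close>

lemma statistical_modelD:
  assumes "statistical_model S \<mu> p"
  shows "sigma_finite_measure \<mu>"
    and "(\<lambda>(\<theta>, x). p \<theta> x) \<in> borel_measurable (S \<Otimes>\<^sub>M \<mu>)"
    and "\<And>\<theta>. \<theta> \<in> space S \<Longrightarrow> p \<theta> \<in> borel_measurable \<mu>"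
    and "\<And>\<theta> x. \<theta> \<in> space S \<Longrightarrow> x \<in> space \<mu> \<Longrightarrow> 0 \<le> p \<theta> x"
    and "\<And>\<theta>. \<theta> \<in> space S \<Longrightarrow> (\<integral>\<^sup>+x. ennreal (p \<theta> x) \<partial>\<mu>) = 1"
    and "\<And>x. x \<in> space \<mu> \<Longrightarrow> (\<lambda>\<theta>. p \<theta> x) \<in> borel_measurable S"
proof -
  show m: "(\<lambda>(\<theta>, x). p \<theta> x) \<in> borel_measurable (S \<Otimes>\<^sub>M \<mu>)"
    using assms by (simp add: statistical_model_def)
  show "p \<theta> \<in> borel_measurable \<mu>" if "\<theta> \<in> space S" for \<theta>
    using measurable_compose[OF measurable_Pair1'[OF that] m] by simp
  show "(\<lambda>\<theta>. p \<theta> x) \<in> borel_measurable S" if "x \<in> space \<mu>" for x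
    using measurable_compose[OF measurable_Pair2'[OF that] m] by simp
qed (use assms in \<open>auto simp: statistical_model_def\<close>)

text \<open>
  The marginal density of the observation, the denominator of the posterior.
\<close>
definition evidence :: "'t measure \<Rightarrow> ('t \<Rightarrow> 'x \<Rightarrow> real) \<Rightarrow> 'x \<Rightarrow> ennreal" where
  "evidence prior p x = (\<integral>\<^sup>+\<theta>. ennreal (p \<theta> x) \<partial>prior)"

text \<open>
  Let \<open>\<theta>1\<close> approximate \<open>\<theta>0\<close>, and let \<open>U\<close> be a set of parameters close to \<open>\<theta>1\<close>. For each \<open>\<theta>\<close> in \<open>U\<close>
  the event that \<open>p \<theta>\<close> falls far below \<open>p \<theta>1\<close> is rare, hence by Fubini's theorem the
  expected prior mass of the parameters with this defect is small, and by Markov's inequality it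
  rarely exceeds half of the mass of \<open>U\<close>. Otherwise the remaining half bounds the evidence below.
  The set \<open>U\<close> may fail to be measurable: it enters through its measurable supersets, and
  the proof uses the one given by the defining inequality.
\<close>
lemma evidence_lower_bound:
  assumes model: "statistical_model S \<mu> p" and prior: "sets prior = sets S" "finite_measure prior"
    and \<theta>0: "\<theta>0 \<in> space S" and \<theta>1: "\<theta>1 \<in> space S"
    and near: "(\<integral>\<^sup>+x. ennreal (p \<theta>0 x) * indicator {x. exp u * p \<theta>1 x < p \<theta>0 x} x \<partial>\<mu>) \<le> \<eta>"
    and nbhd: "U \<subseteq> space S"
      "\<And>\<theta>. \<theta> \<in> U \<Longrightarrow> (\<integral>\<^sup>+x. ennreal (p \<theta>0 x) * indicator {x. exp v * p \<theta> x < p \<theta>1 x} x \<partial>\<mu>) \<le> \<eta>"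
    and mass: "\<And>A. A \<in> sets S \<Longrightarrow> U \<subseteq> A \<Longrightarrow> ennreal \<beta> \<le> emeasure prior A" and \<beta>: "0 < \<beta>"
  shows "(\<integral>\<^sup>+x. ennreal (p \<theta>0 x) *
      indicator {x. evidence prior p x < ennreal (exp (- (u + v)) * (\<beta> / 2) * p \<theta>0 x)} x \<partial>\<mu>) \<le> 3 * \<eta>"
proof -
  note mod = statistical_modelD[OF model]
  interpret prior: finite_measure prior by fact
  interpret \<mu>: sigma_finite_measure \<mu> by (rule mod(1))
  interpret pair_sigma_finite prior \<mu> ..
  note [measurable_cong] = prior(1)
  have [measurable]: "(\<lambda>(\<theta>, x). p \<theta> x) \<in> borel_measurable (S \<Otimes>\<^sub>M \<mu>)" by (rule mod(2))
  have [measurable]: "p \<theta>0 \<in> borel_measurable \<mu>" "p \<theta>1 \<in> borel_measurable \<mu>"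
    using mod(3) \<theta>0 \<theta>1 by auto
  define F where "F \<theta> x = ennreal (p \<theta>0 x) * indicator {x. exp v * p \<theta> x < p \<theta>1 x} x" for \<theta> x
  have F_alt: "F \<theta> x = (if exp v * p \<theta> x < p \<theta>1 x then ennreal (p \<theta>0 x) else 0)" for \<theta> x
    by (simp add: F_def)
  have F_meas [measurable]: "(\<lambda>(\<theta>, x). F \<theta> x) \<in> borel_measurable (prior \<Otimes>\<^sub>M \<mu>)"
    unfolding F_alt by measurable
  (* A measurable superset of \<open>U\<close> on which the same bound holds. *)
  define A where "A = {\<theta> \<in> space S. (\<integral>\<^sup>+x. F \<theta> x \<partial>\<mu>) \<le> \<eta>}"
  have A_sets [measurable]: "A \<in> sets S"
  proof -
    have "(\<lambda>\<theta>. \<integral>\<^sup>+x. F \<theta> x \<partial>\<mu>) \<in> borel_measurable prior"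
      by measurable
    then have "(\<lambda>\<theta>. \<integral>\<^sup>+x. F \<theta> x \<partial>\<mu>) \<in> borel_measurable S"
      by (simp cong: measurable_cong_sets add: prior(1))
    then show ?thesis
      unfolding A_def by measurable
  qed
  have "U \<subseteq> A" using nbhd by (auto simp: A_def F_def)
  define \<alpha> where "\<alpha> = measure prior A"
  have em_A: "emeasure prior A = ennreal \<alpha>"
    by (simp add: \<alpha>_def prior.emeasure_eq_measure)
  have \<alpha>: "\<beta> \<le> \<alpha>"
    using mass[OF A_sets \<open>U \<subseteq> A\<close>] \<beta> by (simp add: em_A ennreal_le_iff2)
  then have \<alpha>_pos: "0 < \<alpha>" using \<beta> by simp
  define W where "W x = {\<theta> \<in> A. exp v * p \<theta> x < p \<theta>1 x}" for x
  have p_meas: "(\<lambda>\<theta>. p \<theta> x) \<in> borel_measurable S" if "x \<in> space \<mu>" for x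
    by (rule mod(6)[OF that])
  have W_sets: "W x \<in> sets S" if x: "x \<in> space \<mu>" for x
  proof -
    note [measurable] = p_meas[OF x]
    have "W x = A \<inter> {\<theta> \<in> space S. exp v * p \<theta> x < p \<theta>1 x}"
      using sets.sets_into_space[OF A_sets] by (auto simp: W_def)
    also have "\<dots> \<in> sets S" by measurable
    finally show ?thesis .
  qed
  define G where "G x = (\<integral>\<^sup>+\<theta>. F \<theta> x * indicator A \<theta> \<partial>prior)" for x
  have G_eq: "G x = ennreal (p \<theta>0 x) * emeasure prior (W x)" if x: "x \<in> space \<mu>" for x
  proof -
    have "G x = (\<integral>\<^sup>+\<theta>. ennreal (p \<theta>0 x) * indicator (W x) \<theta> \<partial>prior)"
      unfolding G_def by (intro nn_integral_cong) (auto simp: F_def W_def indicator_def)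
    then show ?thesis
      using W_sets[OF x] by (simp add: nn_integral_cmult_indicator prior(1))
  qed
  have G_meas [measurable]: "G \<in> borel_measurable \<mu>"
    unfolding G_def by measurable
  have G_int: "(\<integral>\<^sup>+x. G x \<partial>\<mu>) \<le> \<eta> * ennreal \<alpha>"
  proof -
    have "(\<integral>\<^sup>+x. G x \<partial>\<mu>) = (\<integral>\<^sup>+\<theta>. (\<integral>\<^sup>+x. F \<theta> x * indicator A \<theta> \<partial>\<mu>) \<partial>prior)"
      unfolding G_def by (rule Fubini') measurable
    also have "\<dots> = (\<integral>\<^sup>+\<theta>. (\<integral>\<^sup>+x. F \<theta> x \<partial>\<mu>) * indicator A \<theta> \<partial>prior)"
    proof (intro nn_integral_cong)
      fix \<theta> assume "\<theta> \<in> space prior"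
      then have "F \<theta> \<in> borel_measurable \<mu>"
        using measurable_compose[OF measurable_Pair1' F_meas] by simp
      then show "(\<integral>\<^sup>+x. F \<theta> x * indicator A \<theta> \<partial>\<mu>) = (\<integral>\<^sup>+x. F \<theta> x \<partial>\<mu>) * indicator A \<theta>"
        by (rule nn_integral_multc)
    qed
    also have "\<dots> \<le> (\<integral>\<^sup>+\<theta>. \<eta> * indicator A \<theta> \<partial>prior)"
      by (intro nn_integral_mono) (auto simp: A_def indicator_def)
    also have "\<dots> = \<eta> * ennreal \<alpha>"
      by (simp add: nn_integral_cmult_indicator em_A)
    finally show ?thesis .
  qed
  have pointwise: "ennreal (p \<theta>0 x) *
      indicator {x. evidence prior p x < ennreal (exp (- (u + v)) * (\<beta> / 2) * p \<theta>0 x)} x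
      \<le> ennreal (p \<theta>0 x) * indicator {x. exp u * p \<theta>1 x < p \<theta>0 x} x + ennreal (2 / \<alpha>) * G x"
    if x: "x \<in> space \<mu>" for x
  proof (cases "exp u * p \<theta>1 x < p \<theta>0 x \<or> ennreal (\<alpha> / 2) \<le> emeasure prior (W x)")
    case True
    then show ?thesis
    proof
      assume *: "ennreal (\<alpha> / 2) \<le> emeasure prior (W x)"
      have "ennreal (p \<theta>0 x) = ennreal (p \<theta>0 x) * (ennreal (2 / \<alpha>) * ennreal (\<alpha> / 2))"
        using \<alpha>_pos by (simp add: ennreal_mult[symmetric])
      also have "\<dots> \<le> ennreal (p \<theta>0 x) * (ennreal (2 / \<alpha>) * emeasure prior (W x))"
        using * by (intro mult_left_mono) auto
      also have "\<dots> = ennreal (2 / \<alpha>) * G x"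
        by (simp add: G_eq[OF x] ac_simps)
      finally show ?thesis
        by (auto simp: indicator_def intro: add_increasing)
    qed (auto simp: indicator_def)
  next
    case False
    note [measurable] = p_meas[OF x] W_sets[OF x]
    have "measure prior (W x) < \<alpha> / 2"
      using False \<alpha>_pos by (simp add: prior.emeasure_eq_measure not_le ennreal_less_iff)
    moreover have "measure prior (A - W x) = \<alpha> - measure prior (W x)"
      unfolding \<alpha>_def by (rule prior.finite_measure_Diff) (auto simp: W_def prior(1) W_sets[OF x])
    ultimately have mAW: "\<beta> / 2 \<le> measure prior (A - W x)" using \<alpha> by simp
    have "exp (- v) * p \<theta>1 x \<le> p \<theta> x" if "\<theta> \<in> A - W x" for \<theta>
      using that by (simp add: W_def not_less exp_minus field_simps)
    then have "(\<integral>\<^sup>+\<theta>. ennreal (exp (- v) * p \<theta>1 x) * indicator (A - W x) \<theta> \<partial>prior) \<le> evidence prior p x"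
      unfolding evidence_def by (intro nn_integral_mono) (auto simp: indicator_def ennreal_leI)
    then have "ennreal (exp (- v) * p \<theta>1 x) * ennreal (measure prior (A - W x)) \<le> evidence prior p x"
      by (simp add: nn_integral_cmult_indicator prior.emeasure_eq_measure)
    moreover have "ennreal (exp (- (u + v)) * (\<beta> / 2) * p \<theta>0 x)
        \<le> ennreal (exp (- v) * p \<theta>1 x) * ennreal (measure prior (A - W x))"
    proof -
      have "p \<theta>0 x \<le> exp u * p \<theta>1 x" using False by simp
      then have "exp (- (u + v)) * p \<theta>0 x \<le> exp (- (u + v)) * (exp u * p \<theta>1 x)"
        by (intro mult_left_mono) auto
      also have "\<dots> = exp (- v) * p \<theta>1 x"
        by (simp add: mult.assoc[symmetric] exp_add[symmetric])
      finally have "exp (- (u + v)) * p \<theta>0 x * (\<beta> / 2) \<le> exp (- v) * p \<theta>1 x * measure prior (A - W x)"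
        using mAW \<beta> mod(4)[OF \<theta>1 x] by (intro mult_mono[of "exp (- (u + v)) * p \<theta>0 x"]) auto
      then show ?thesis
        using mod(4)[OF \<theta>1 x] by (simp add: ennreal_mult[symmetric] ennreal_leI ac_simps)
    qed
    ultimately show ?thesis by (auto simp: indicator_def)
  qed
  have "(\<integral>\<^sup>+x. ennreal (p \<theta>0 x) *
      indicator {x. evidence prior p x < ennreal (exp (- (u + v)) * (\<beta> / 2) * p \<theta>0 x)} x \<partial>\<mu>)
    \<le> (\<integral>\<^sup>+x. ennreal (p \<theta>0 x) * indicator {x. exp u * p \<theta>1 x < p \<theta>0 x} x + ennreal (2 / \<alpha>) * G x \<partial>\<mu>)"
    by (intro nn_integral_mono pointwise)
  also have "\<dots> = (\<integral>\<^sup>+x. ennreal (p \<theta>0 x) * indicator {x. exp u * p \<theta>1 x < p \<theta>0 x} x \<partial>\<mu>)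
      + ennreal (2 / \<alpha>) * (\<integral>\<^sup>+x. G x \<partial>\<mu>)"
    by (subst nn_integral_add) (auto simp: nn_integral_cmult)
  also have "\<dots> \<le> \<eta> + ennreal (2 / \<alpha>) * (\<eta> * ennreal \<alpha>)"
    using near G_int by (intro add_mono mult_left_mono) auto
  also have "ennreal (2 / \<alpha>) * (\<eta> * ennreal \<alpha>) = \<eta> * ennreal (2 / \<alpha> * \<alpha>)"
    using \<alpha>_pos by (subst ennreal_mult) (simp_all add: ac_simps del: times_divide_eq_left)
  also have "\<eta> + \<eta> * ennreal (2 / \<alpha> * \<alpha>) = 3 * \<eta>"
    using \<alpha>_pos by (simp add: mult.commute[of _ "2::ennreal"])
       (metis distrib_right mult_1 numeral_One one_plus_numeral semiring_norm(3))
  finally show ?thesis .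
qed

text \<open>
  The usual decomposition: where the test \<open>\<phi>\<close> rejects or the evidence is small, the posterior mass is
  bounded by \<open>1\<close>; elsewhere the denominator is replaced by its lower bound \<open>\<gamma> p\<^sub>0\<close>, so that
  \<open>p\<^sub>0\<close> cancels and the expectation becomes an integral over the prior of the errors of the second
  kind. These are at most \<open>e2\<close> on \<open>G\<close>, and the prior gives little mass to sets that avoid \<open>G\<close>.
\<close>
lemma posterior_mass_bound:
  assumes model: "statistical_model S \<mu> p"
    and prior: "sets prior = sets S" "emeasure prior (space prior) \<le> 1"
    and \<theta>0: "\<theta>0 \<in> space S" and B [measurable]: "B \<in> sets S"
    and [measurable]: "\<phi> \<in> borel_measurable \<mu>" and \<phi>01: "\<And>x. x \<in> space \<mu> \<Longrightarrow> 0 \<le> \<phi> x \<and> \<phi> x \<le> 1"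
    and type1: "(\<integral>\<^sup>+x. ennreal (\<phi> x) * ennreal (p \<theta>0 x) \<partial>\<mu>) \<le> e1"
    and type2: "\<And>\<theta>. \<theta> \<in> B \<Longrightarrow> \<theta> \<in> G \<Longrightarrow> (\<integral>\<^sup>+x. ennreal (1 - \<phi> x) * ennreal (p \<theta> x) \<partial>\<mu>) \<le> e2"
    and rem: "\<And>A. A \<in> sets S \<Longrightarrow> A \<inter> G = {} \<Longrightarrow> emeasure prior A \<le> \<delta>"
    and ev: "(\<integral>\<^sup>+x. ennreal (p \<theta>0 x) * indicator {x. evidence prior p x < ennreal (\<gamma> * p \<theta>0 x)} x \<partial>\<mu>) \<le> e3"
    and \<gamma>: "0 < \<gamma>"
  shows "(\<integral>\<^sup>+x. ennreal (p \<theta>0 x) * emeasure (posterior prior p x) B \<partial>\<mu>)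
    \<le> e1 + e3 + ennreal (1 / \<gamma>) * (e2 + \<delta>)"
proof -
  note mod = statistical_modelD[OF model]
  have "finite_measure prior"
    using prior(2) by (intro finite_measureI) (auto simp: top_unique)
  then interpret prior: finite_measure prior .
  interpret \<mu>: sigma_finite_measure \<mu> by (rule mod(1))
  interpret pair_sigma_finite prior \<mu> ..
  note [measurable_cong] = prior(1)
  have sp: "space prior = space S" using prior(1) by (rule sets_eq_imp_space_eq)
  have p_meas2 [measurable]: "(\<lambda>(\<theta>, x). p \<theta> x) \<in> borel_measurable (S \<Otimes>\<^sub>M \<mu>)" by (rule mod(2))
  have [measurable]: "p \<theta>0 \<in> borel_measurable \<mu>" using mod(3) \<theta>0 by auto
  have ev_meas [measurable]: "(\<lambda>x. evidence prior p x) \<in> borel_measurable \<mu>"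
    unfolding evidence_def by measurable
  define N where "N x = (\<integral>\<^sup>+\<theta>. ennreal (p \<theta> x) * indicator B \<theta> \<partial>prior)" for x
  have N_meas [measurable]: "N \<in> borel_measurable \<mu>"
    unfolding N_def by measurable
  have post: "emeasure (posterior prior p x) B = N x / evidence prior p x" if x: "x \<in> space \<mu>" for x
  proof -
    note [measurable] = mod(6)[OF x]
    have "emeasure (posterior prior p x) B
        = (\<integral>\<^sup>+\<theta>. ennreal (p \<theta> x) / evidence prior p x * indicator B \<theta> \<partial>prior)"
      unfolding posterior_def evidence_def using mod(6)[OF x]
      by (intro emeasure_density) (auto simp: prior(1) cong: measurable_cong_sets)
    also have "\<dots> = (\<integral>\<^sup>+\<theta>. ennreal (p \<theta> x) * indicator B \<theta> / evidence prior p x \<partial>prior)"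
      by (intro nn_integral_cong) (simp add: divide_ennreal_def ac_simps)
    also have "\<dots> = N x / evidence prior p x"
      unfolding N_def by (rule nn_integral_divide) measurable
    finally show ?thesis .
  qed
  have N_le: "N x \<le> evidence prior p x" for x
    unfolding N_def evidence_def by (intro nn_integral_mono) (auto simp: indicator_def)
  have ratio: "N x / evidence prior p x \<le> 1" for x
  proof -
    have "N x / evidence prior p x \<le> evidence prior p x / evidence prior p x"
      by (rule divide_right_mono_ennreal[OF N_le])
    also have "\<dots> \<le> 1"
      by (cases "evidence prior p x = 0 \<or> evidence prior p x = top")
         (auto simp: ennreal_divide_self less_top)
    finally show ?thesis .
  qed
  have pointwise: "ennreal (p \<theta>0 x) * emeasure (posterior prior p x) B
      \<le> ennreal (\<phi> x) * ennreal (p \<theta>0 x)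
        + ennreal (p \<theta>0 x) * indicator {x. evidence prior p x < ennreal (\<gamma> * p \<theta>0 x)} x
        + ennreal (1 / \<gamma>) * (ennreal (1 - \<phi> x) * N x)" if x: "x \<in> space \<mu>" for x
  proof -
    let ?r = "N x / evidence prior p x"
    have one: "1 = ennreal (\<phi> x) + ennreal (1 - \<phi> x)"
      using \<phi>01[OF x] by (subst ennreal_plus[symmetric]) auto
    have le: "ennreal (p \<theta>0 x) * ?r
        \<le> ennreal (p \<theta>0 x) * indicator {x. evidence prior p x < ennreal (\<gamma> * p \<theta>0 x)} x
          + ennreal (1 / \<gamma>) * N x"
    proof (cases "evidence prior p x < ennreal (\<gamma> * p \<theta>0 x)")
      case True
      have "ennreal (p \<theta>0 x) * ?r \<le> ennreal (p \<theta>0 x) * 1"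
        by (intro mult_left_mono ratio) simp
      then show ?thesis
        using True by (simp add: add_increasing2)
    next
      case False
      show ?thesis
      proof (cases "evidence prior p x = 0 \<or> evidence prior p x = top")
        case True
        then have "ennreal (p \<theta>0 x) * ?r = 0"
          using N_le[of x] by (auto simp: ennreal_divide_top)
        then show ?thesis by (simp only: zero_le)
      next
        case fin: False
        have "ennreal (p \<theta>0 x) = ennreal (1 / \<gamma>) * ennreal (\<gamma> * p \<theta>0 x)"
          using \<gamma> mod(4)[OF \<theta>0 x] by (simp add: ennreal_mult[symmetric])
        also have "\<dots> \<le> ennreal (1 / \<gamma>) * evidence prior p x"
          using False by (intro mult_left_mono) auto
        finally have "ennreal (p \<theta>0 x) * ?r \<le> ennreal (1 / \<gamma>) * evidence prior p x * ?r"
          by (intro mult_right_mono) auto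
        also have "\<dots> = ennreal (1 / \<gamma>) * N x"
        proof -
          have "evidence prior p x * ?r = N x"
            using fin by (simp add: ennreal_times_divide mult.commute[of "evidence prior p x"] ennreal_mult_divide_eq)
          then show ?thesis by (simp only: mult.assoc)
        qed
        finally show ?thesis by (simp add: add_increasing)
      qed
    qed
    have "ennreal (p \<theta>0 x) * ?r = ennreal (\<phi> x) * (ennreal (p \<theta>0 x) * ?r) + ennreal (1 - \<phi> x) * (ennreal (p \<theta>0 x) * ?r)"
      by (subst distrib_right[symmetric]) (simp add: one[symmetric])
    also have "\<dots> \<le> ennreal (\<phi> x) * (ennreal (p \<theta>0 x) * 1)
        + ennreal (1 - \<phi> x) * (ennreal (p \<theta>0 x) * indicator {x. evidence prior p x < ennreal (\<gamma> * p \<theta>0 x)} x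
          + ennreal (1 / \<gamma>) * N x)"
      by (intro add_mono mult_left_mono ratio le) auto
    also have "\<dots> \<le> ennreal (\<phi> x) * ennreal (p \<theta>0 x)
        + (1 * (ennreal (p \<theta>0 x) * indicator {x. evidence prior p x < ennreal (\<gamma> * p \<theta>0 x)} x)
          + ennreal (1 - \<phi> x) * (ennreal (1 / \<gamma>) * N x))"
      unfolding distrib_left using \<phi>01[OF x]
      by (intro add_mono mult_right_mono) auto
    finally show ?thesis
      by (simp add: post[OF x] ac_simps)
  qed
  (* The error of the second kind at \<open>\<theta>\<close>; it exceeds \<open>e2\<close> on \<open>B\<close> only outside \<open>G\<close>. *)
  define h where "h \<theta> = (\<integral>\<^sup>+x. ennreal (1 - \<phi> x) * ennreal (p \<theta> x) \<partial>\<mu>)" for \<theta>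
  have h_meas: "h \<in> borel_measurable prior"
    unfolding h_def by measurable
  then have h_meas' [measurable]: "h \<in> borel_measurable S"
    by (simp cong: measurable_cong_sets add: prior(1))
  have h1: "h \<theta> \<le> 1" if "\<theta> \<in> space S" for \<theta>
  proof -
    have "h \<theta> \<le> (\<integral>\<^sup>+x. 1 * ennreal (p \<theta> x) \<partial>\<mu>)"
      unfolding h_def using \<phi>01 by (intro nn_integral_mono mult_right_mono) auto
    with mod(5)[OF that] show ?thesis by simp
  qed
  have "(\<integral>\<^sup>+x. ennreal (1 - \<phi> x) * N x \<partial>\<mu>)
      = (\<integral>\<^sup>+x. (\<integral>\<^sup>+\<theta>. ennreal (1 - \<phi> x) * (ennreal (p \<theta> x) * indicator B \<theta>) \<partial>prior) \<partial>\<mu>)"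
  proof (intro nn_integral_cong)
    fix x assume x: "x \<in> space \<mu>"
    note [measurable] = mod(6)[OF x]
    show "ennreal (1 - \<phi> x) * N x = (\<integral>\<^sup>+\<theta>. ennreal (1 - \<phi> x) * (ennreal (p \<theta> x) * indicator B \<theta>) \<partial>prior)"
      unfolding N_def by (rule nn_integral_cmult[symmetric]) measurable
  qed
  also have "\<dots> = (\<integral>\<^sup>+\<theta>. (\<integral>\<^sup>+x. ennreal (1 - \<phi> x) * (ennreal (p \<theta> x) * indicator B \<theta>) \<partial>\<mu>) \<partial>prior)"
    by (rule Fubini') measurable
  also have "\<dots> = (\<integral>\<^sup>+\<theta>. h \<theta> * indicator B \<theta> \<partial>prior)"
  proof (intro nn_integral_cong)
    fix \<theta> assume "\<theta> \<in> space prior"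
    then have [measurable]: "p \<theta> \<in> borel_measurable \<mu>" using mod(3) sp by auto
    show "(\<integral>\<^sup>+x. ennreal (1 - \<phi> x) * (ennreal (p \<theta> x) * indicator B \<theta>) \<partial>\<mu>) = h \<theta> * indicator B \<theta>"
      unfolding h_def mult.assoc[symmetric] by (rule nn_integral_multc) measurable
  qed
  also have "\<dots> \<le> (\<integral>\<^sup>+\<theta>. e2 + indicator {\<theta> \<in> B. e2 < h \<theta>} \<theta> \<partial>prior)"
  proof (intro nn_integral_mono)
    fix \<theta> assume "\<theta> \<in> space prior"
    then have "h \<theta> \<le> 1" using h1 sp by auto
    then show "h \<theta> * indicator B \<theta> \<le> e2 + indicator {\<theta> \<in> B. e2 < h \<theta>} \<theta>"
      by (auto simp: indicator_def not_less intro: add_increasing)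
  qed
  also have "\<dots> = e2 * emeasure prior (space prior) + emeasure prior {\<theta> \<in> B. e2 < h \<theta>}"
  proof -
    have "{\<theta> \<in> B. e2 < h \<theta>} = B \<inter> {\<theta> \<in> space S. e2 < h \<theta>}"
      using sets.sets_into_space[OF B] by auto
    then have "{\<theta> \<in> B. e2 < h \<theta>} \<in> sets S" by simp
    then show ?thesis
      by (subst nn_integral_add) (auto simp: prior(1))
  qed
  also have "\<dots> \<le> e2 * 1 + \<delta>"
  proof (intro add_mono mult_left_mono rem)
    have "{\<theta> \<in> B. e2 < h \<theta>} = B \<inter> {\<theta> \<in> space S. e2 < h \<theta>}"
      using sets.sets_into_space[OF B] by auto
    then show "{\<theta> \<in> B. e2 < h \<theta>} \<in> sets S" by simp
    show "{\<theta> \<in> B. e2 < h \<theta>} \<inter> G = {}"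
      using type2 by (force simp: h_def)
  qed (use prior in auto)
  finally have num: "(\<integral>\<^sup>+x. ennreal (1 - \<phi> x) * N x \<partial>\<mu>) \<le> e2 + \<delta>" by simp
  have "(\<integral>\<^sup>+x. ennreal (p \<theta>0 x) * emeasure (posterior prior p x) B \<partial>\<mu>)
    \<le> (\<integral>\<^sup>+x. ennreal (\<phi> x) * ennreal (p \<theta>0 x)
        + ennreal (p \<theta>0 x) * indicator {x. evidence prior p x < ennreal (\<gamma> * p \<theta>0 x)} x
        + ennreal (1 / \<gamma>) * (ennreal (1 - \<phi> x) * N x) \<partial>\<mu>)"
    by (intro nn_integral_mono pointwise)
  also have "\<dots> = (\<integral>\<^sup>+x. ennreal (\<phi> x) * ennreal (p \<theta>0 x) \<partial>\<mu>)
        + (\<integral>\<^sup>+x. ennreal (p \<theta>0 x) * indicator {x. evidence prior p x < ennreal (\<gamma> * p \<theta>0 x)} x \<partial>\<mu>)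
        + ennreal (1 / \<gamma>) * (\<integral>\<^sup>+x. ennreal (1 - \<phi> x) * N x \<partial>\<mu>)"
    by (simp add: nn_integral_add nn_integral_cmult)
  also have "\<dots> \<le> e1 + e3 + ennreal (1 / \<gamma>) * (e2 + \<delta>)"
    using type1 ev num by (intro add_mono mult_left_mono) auto
  finally show ?thesis .
qed

text \<open>
  The squared distance is at most \<open>R\<^sup>2\<close> or, on \<open>{d > R}\<close>, at most \<open>D\<^sup>2\<close>. Wherever the evidence
  vanishes or is infinite, the posterior is the null measure, so that its total mass never exceeds \<open>1\<close>.
\<close>
lemma posterior_risk_le:
  assumes model: "statistical_model S \<mu> p"
    and prior: "sets prior = sets S" "emeasure prior (space prior) \<le> 1"
    and \<theta>0: "\<theta>0 \<in> space S"
    and d_meas [measurable]: "(\<lambda>\<theta>. d \<theta> \<theta>0) \<in> borel_measurable S"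
    and d_bound: "\<And>\<theta>. \<theta> \<in> space S \<Longrightarrow> 0 \<le> d \<theta> \<theta>0 \<and> d \<theta> \<theta>0 \<le> D"
    and R: "0 \<le> R" and q: "0 \<le> q"
    and mass: "(\<integral>\<^sup>+x. ennreal (p \<theta>0 x) * emeasure (posterior prior p x) {\<theta> \<in> space S. R < d \<theta> \<theta>0} \<partial>\<mu>) \<le> ennreal q"
  shows "posterior_risk \<mu> p prior d \<theta>0 \<le> R\<^sup>2 + D\<^sup>2 * q"
proof -
  note mod = statistical_modelD[OF model]
  note [measurable_cong] = prior(1)
  have [measurable]: "p \<theta>0 \<in> borel_measurable \<mu>" using mod(3) \<theta>0 by auto
  have B: "{\<theta> \<in> space S. R < d \<theta> \<theta>0} \<in> sets S" by measurable
  let ?B = "{\<theta> \<in> space S. R < d \<theta> \<theta>0}"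
  have inner: "ennreal (\<integral>\<theta>. (d \<theta> \<theta>0)\<^sup>2 \<partial>posterior prior p x)
      \<le> ennreal (R\<^sup>2) + ennreal (D\<^sup>2) * emeasure (posterior prior p x) ?B" if x: "x \<in> space \<mu>" for x
  proof -
    let ?P = "posterior prior p x"
    note [measurable] = mod(6)[OF x]
    have sets_P [measurable_cong]: "sets ?P = sets S" by (simp add: posterior_def prior(1))
    have sp_P: "space ?P = space S" using sets_P by (rule sets_eq_imp_space_eq)
    have total: "emeasure ?P (space ?P) \<le> 1"
    proof -
      have "emeasure ?P (space ?P) = (\<integral>\<^sup>+\<theta>. ennreal (p \<theta> x) / evidence prior p x * indicator (space prior) \<theta> \<partial>prior)"
        unfolding posterior_def evidence_def by (subst emeasure_density) simp_all
      also have "\<dots> = (\<integral>\<^sup>+\<theta>. ennreal (p \<theta> x) / evidence prior p x \<partial>prior)"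
        by (intro nn_integral_cong) simp
      also have "\<dots> = evidence prior p x / evidence prior p x"
        unfolding evidence_def by (rule nn_integral_divide) measurable
      also have "\<dots> \<le> 1"
        by (cases "evidence prior p x = 0 \<or> evidence prior p x = top")
           (auto simp: ennreal_divide_self less_top)
      finally show ?thesis .
    qed
    have "ennreal (\<integral>\<theta>. (d \<theta> \<theta>0)\<^sup>2 \<partial>?P) \<le> (\<integral>\<^sup>+\<theta>. ennreal ((d \<theta> \<theta>0)\<^sup>2) \<partial>?P)"
    proof (cases "(\<integral>\<^sup>+\<theta>. ennreal ((d \<theta> \<theta>0)\<^sup>2) \<partial>?P) = top")
      case False
      then obtain r where r: "0 \<le> r" "(\<integral>\<^sup>+\<theta>. ennreal ((d \<theta> \<theta>0)\<^sup>2) \<partial>?P) = ennreal r"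
        by (cases "\<integral>\<^sup>+\<theta>. ennreal ((d \<theta> \<theta>0)\<^sup>2) \<partial>?P") auto
      then have "(\<integral>\<theta>. (d \<theta> \<theta>0)\<^sup>2 \<partial>?P) \<le> r"
        by (intro integral_real_bounded) auto
      then show ?thesis using r by (simp add: ennreal_leI)
    qed simp
    also have "\<dots> \<le> (\<integral>\<^sup>+\<theta>. ennreal (R\<^sup>2) + ennreal (D\<^sup>2) * indicator ?B \<theta> \<partial>?P)"
    proof (intro nn_integral_mono)
      fix \<theta> assume "\<theta> \<in> space ?P"
      then have \<theta>: "\<theta> \<in> space S" using sp_P by simp
      show "ennreal ((d \<theta> \<theta>0)\<^sup>2) \<le> ennreal (R\<^sup>2) + ennreal (D\<^sup>2) * indicator ?B \<theta>"
      proof (cases "R < d \<theta> \<theta>0")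
        case True
        have "(d \<theta> \<theta>0)\<^sup>2 \<le> D\<^sup>2" using d_bound[OF \<theta>] by (intro power_mono) auto
        then show ?thesis using True \<theta> by (auto intro: add_increasing ennreal_leI)
      next
        case False
        then have "(d \<theta> \<theta>0)\<^sup>2 \<le> R\<^sup>2" using d_bound[OF \<theta>] by (intro power_mono) auto
        then show ?thesis using False by (auto intro: ennreal_leI)
      qed
    qed
    also have "\<dots> = ennreal (R\<^sup>2) * emeasure ?P (space ?P) + ennreal (D\<^sup>2) * emeasure ?P ?B"
      using B by (subst nn_integral_add) (auto simp: nn_integral_cmult_indicator sets_P)
    also have "\<dots> \<le> ennreal (R\<^sup>2) * 1 + ennreal (D\<^sup>2) * emeasure ?P ?B"
      by (intro add_mono mult_left_mono total) auto
    finally show ?thesis by simp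
  qed
  have "(\<integral>\<^sup>+x. ennreal (\<integral>\<theta>. (d \<theta> \<theta>0)\<^sup>2 \<partial>posterior prior p x) \<partial>law \<mu> p \<theta>0)
      \<le> (\<integral>\<^sup>+x. ennreal (R\<^sup>2) + ennreal (D\<^sup>2) * emeasure (posterior prior p x) ?B \<partial>law \<mu> p \<theta>0)"
    by (intro nn_integral_mono inner) (simp add: law_def)
  also have "\<dots> \<le> ennreal (R\<^sup>2 + D\<^sup>2 * q)"
  proof -
    have "finite_measure prior"
      using prior(2) by (intro finite_measureI) (auto simp: top_unique)
    then interpret prior: finite_measure prior .
    have [measurable]: "(\<lambda>(\<theta>, x). p \<theta> x) \<in> borel_measurable (S \<Otimes>\<^sub>M \<mu>)" by (rule mod(2))
    have "(\<lambda>x. \<integral>\<^sup>+\<theta>. ennreal (p \<theta> x) / (\<integral>\<^sup>+\<theta>'. ennreal (p \<theta>' x) \<partial>prior) * indicator ?B \<theta> \<partial>prior)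
        \<in> borel_measurable \<mu>"
      using B by measurable
    then have post_meas [measurable]: "(\<lambda>x. emeasure (posterior prior p x) ?B) \<in> borel_measurable \<mu>"
    proof (rule measurable_cong[THEN iffD1, rotated])
      fix x assume x: "x \<in> space \<mu>"
      note [measurable] = mod(6)[OF x]
      show "(\<integral>\<^sup>+\<theta>. ennreal (p \<theta> x) / (\<integral>\<^sup>+\<theta>'. ennreal (p \<theta>' x) \<partial>prior) * indicator ?B \<theta> \<partial>prior)
          = emeasure (posterior prior p x) ?B"
        unfolding posterior_def using B by (subst emeasure_density) (auto simp: prior(1))
    qed
    have "(\<integral>\<^sup>+x. ennreal (R\<^sup>2) + ennreal (D\<^sup>2) * emeasure (posterior prior p x) ?B \<partial>law \<mu> p \<theta>0)
      = (\<integral>\<^sup>+x. ennreal (p \<theta>0 x) * (ennreal (R\<^sup>2) + ennreal (D\<^sup>2) * emeasure (posterior prior p x) ?B) \<partial>\<mu>)"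
      unfolding law_def by (subst nn_integral_density) simp_all
    also have "\<dots> = (\<integral>\<^sup>+x. ennreal (R\<^sup>2) * ennreal (p \<theta>0 x)
        + ennreal (D\<^sup>2) * (ennreal (p \<theta>0 x) * emeasure (posterior prior p x) ?B) \<partial>\<mu>)"
      by (intro nn_integral_cong) (simp add: distrib_left ac_simps)
    also have "\<dots> = ennreal (R\<^sup>2) + ennreal (D\<^sup>2) * (\<integral>\<^sup>+x. ennreal (p \<theta>0 x) * emeasure (posterior prior p x) ?B \<partial>\<mu>)"
      by (simp add: nn_integral_add nn_integral_cmult mod(5)[OF \<theta>0])
    also have "\<dots> \<le> ennreal (R\<^sup>2) + ennreal (D\<^sup>2) * ennreal q"
      using mass by (intro add_mono mult_left_mono) auto
    also have "\<dots> = ennreal (R\<^sup>2 + D\<^sup>2 * q)"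
      using q by (simp add: ennreal_mult)
    finally show ?thesis .
  qed
  finally show ?thesis
    unfolding posterior_risk_def using q by (intro integral_real_bounded) auto
qed

section \<open>Tests over a finite net\<close>

text \<open>
  One representative is kept from each cell of side \<open>\<eta>\<close> that meets \<open>U\<close>. The representatives belong to
  \<open>U\<close> itself, so that they are as far from the truth as the points that they represent.
\<close>
lemma finite_grid_net:
  fixes U :: "(nat \<Rightarrow> real) set"
  assumes bound: "\<And>\<theta> i. \<theta> \<in> U \<Longrightarrow> i < k \<Longrightarrow> \<bar>\<theta> i\<bar> \<le> r" and r: "0 \<le> r" and \<eta>: "0 < \<eta>"
  shows "\<exists>F\<subseteq>U. finite F \<and> real (card F) \<le> (2 * r / \<eta> + 2) ^ k \<and>
    (\<forall>\<theta>\<in>U. \<exists>\<theta>1\<in>F. \<forall>i<k. \<bar>\<theta> i - \<theta>1 i\<bar> \<le> \<eta>)"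
proof -
  define cell where "cell \<theta> = restrict (\<lambda>i. \<lfloor>\<theta> i / \<eta>\<rfloor>) {..<k}" for \<theta> :: "nat \<Rightarrow> real"
  define pick where "pick c = (SOME \<theta>. \<theta> \<in> U \<and> cell \<theta> = c)" for c
  have pick: "pick (cell \<theta>) \<in> U \<and> cell (pick (cell \<theta>)) = cell \<theta>" if "\<theta> \<in> U" for \<theta>
    unfolding pick_def by (rule someI[of _ \<theta>]) (use that in auto)
  define I where "I = {\<lfloor>- r / \<eta>\<rfloor>..\<lfloor>r / \<eta>\<rfloor>}"
  have cells: "cell ` U \<subseteq> (\<Pi>\<^sub>E i\<in>{..<k}. I)"
  proof -
    have "\<lfloor>\<theta> i / \<eta>\<rfloor> \<in> I" if "\<theta> \<in> U" "i < k" for \<theta> i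
    proof -
      have "- r / \<eta> \<le> \<theta> i / \<eta>" "\<theta> i / \<eta> \<le> r / \<eta>"
        using bound[OF that] \<eta> by (intro divide_right_mono; auto)+
      then show ?thesis by (auto simp: I_def intro: floor_mono)
    qed
    then show ?thesis by (auto simp: cell_def PiE_def extensional_def)
  qed
  have fin: "finite (\<Pi>\<^sub>E i\<in>{..<k}. I)" by (intro finite_PiE) (auto simp: I_def)
  then have fin': "finite (cell ` U)" using cells finite_subset by blast
  have "card (pick ` cell ` U) \<le> card (cell ` U)" by (rule card_image_le[OF fin'])
  also have "\<dots> \<le> card (\<Pi>\<^sub>E i\<in>{..<k}. I)" by (rule card_mono[OF fin cells])
  also have "\<dots> = card I ^ k" by (simp add: card_PiE)
  finally have "real (card (pick ` cell ` U)) \<le> real (card I) ^ k"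
    by (metis of_nat_le_iff of_nat_power)
  also have "\<dots> \<le> (2 * r / \<eta> + 2) ^ k"
  proof (rule power_mono)
    have "0 \<le> r / \<eta>" using r \<eta> by simp
    then have "\<lfloor>- r / \<eta>\<rfloor> \<le> \<lfloor>r / \<eta>\<rfloor>" by (intro floor_mono) (simp add: r \<eta>)
    then have "real (card I) = of_int \<lfloor>r / \<eta>\<rfloor> - of_int \<lfloor>- r / \<eta>\<rfloor> + 1"
      by (simp add: I_def)
    also have "\<dots> \<le> 2 * (r / \<eta>) + 2"
    proof -
      have "of_int \<lfloor>r / \<eta>\<rfloor> \<le> r / \<eta>" "- r / \<eta> - 1 < of_int \<lfloor>- r / \<eta>\<rfloor>"
        using floor_correct[of "r / \<eta>"] floor_correct[of "- r / \<eta>"] by auto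
      moreover have "- r / \<eta> = - (r / \<eta>)" by simp
      ultimately show ?thesis by linarith
    qed
    finally show "real (card I) \<le> 2 * r / \<eta> + 2" by simp
  qed simp
  finally have card: "real (card (pick ` cell ` U)) \<le> (2 * r / \<eta> + 2) ^ k" .
  have "\<bar>\<theta> i - pick (cell \<theta>) i\<bar> \<le> \<eta>" if "\<theta> \<in> U" "i < k" for \<theta> i
  proof -
    have "\<lfloor>pick (cell \<theta>) i / \<eta>\<rfloor> = \<lfloor>\<theta> i / \<eta>\<rfloor>"
      using pick[OF that(1)] that(2) unfolding cell_def by (auto simp: restrict_def fun_eq_iff split: if_splits)
    then have "\<bar>\<theta> i / \<eta> - pick (cell \<theta>) i / \<eta>\<bar> \<le> 1"
      using floor_correct[of "\<theta> i / \<eta>"] floor_correct[of "pick (cell \<theta>) i / \<eta>"]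
      unfolding abs_le_iff by linarith
    then have "\<bar>\<theta> i - pick (cell \<theta>) i\<bar> / \<eta> \<le> 1"
      using \<eta> by (simp add: diff_divide_distrib[symmetric])
    then show ?thesis using \<eta> by (simp add: field_simps)
  qed
  then show ?thesis
    using card pick fin' by (intro exI[of _ "pick ` cell ` U"]) auto
qed

text \<open>
  Error probabilities of tests are Bochner integrals in \<open>test_condition\<close>; the Fubini arguments
  need them as nonnegative integrals against the dominating measure.
\<close>
lemma nn_integral_law:
  assumes model: "statistical_model S \<mu> p" and \<theta>: "\<theta> \<in> space S"
    and [measurable]: "\<phi> \<in> borel_measurable \<mu>" and \<phi>: "\<And>x. x \<in> space \<mu> \<Longrightarrow> 0 \<le> \<phi> x \<and> \<phi> x \<le> 1"
  shows "(\<integral>\<^sup>+x. ennreal (\<phi> x) * ennreal (p \<theta> x) \<partial>\<mu>) = ennreal (\<integral>x. \<phi> x \<partial>law \<mu> p \<theta>)"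
proof -
  have [measurable]: "p \<theta> \<in> borel_measurable \<mu>"
    by (rule statistical_modelD(3)[OF model \<theta>])
  interpret prob_space "law \<mu> p \<theta>"
    by (rule prob_spaceI)
       (simp add: law_def emeasure_density nn_integral_set_ennreal[symmetric] statistical_modelD(5)[OF model \<theta>] cong: nn_integral_cong)
  have "integrable (law \<mu> p \<theta>) \<phi>"
    by (rule integrable_const_bound[where B = 1]) (use \<phi> in \<open>auto simp: law_def\<close>)
  then have "ennreal (\<integral>x. \<phi> x \<partial>law \<mu> p \<theta>) = (\<integral>\<^sup>+x. ennreal (\<phi> x) \<partial>law \<mu> p \<theta>)"
    by (intro nn_integral_eq_integral[symmetric]) (use \<phi> in \<open>auto simp: law_def\<close>)
  also have "\<dots> = (\<integral>\<^sup>+x. ennreal (p \<theta> x) * ennreal (\<phi> x) \<partial>\<mu>)"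
    unfolding law_def by (subst nn_integral_density) auto
  finally show ?thesis by (simp add: mult.commute)
qed

text \<open>
  The sum of the local tests over a net, capped at \<open>1\<close>: its error of the first kind grows by the
  cardinality of the net, and its error of the second kind at \<open>\<theta>\<close> is at most that of
  the local test at the nearest point of the net.
\<close>
lemma global_test:
  assumes model: "statistical_model S \<mu> p" and \<theta>0: "\<theta>0 \<in> space S"
    and sieve: "sieve_ball k r \<subseteq> space S" and r: "0 \<le> r" and \<eta>: "0 < \<eta>"
    and c: "0 \<le> c" and R: "0 \<le> R"
    and local_test: "\<And>\<theta>1. \<theta>1 \<in> sieve_ball k r \<Longrightarrow>
      \<exists>\<phi> \<in> borel_measurable \<mu>. (\<forall>x\<in>space \<mu>. 0 \<le> \<phi> x \<and> \<phi> x \<le> 1) \<and>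
        (\<integral>x. \<phi> x \<partial>law \<mu> p \<theta>0) \<le> exp (- c * (d \<theta>0 \<theta>1)\<^sup>2) \<and>
        (\<forall>\<theta> \<in> space S. d \<theta> \<theta>1 < \<zeta> * d \<theta>0 \<theta>1 \<longrightarrow>
          (\<integral>x. 1 - \<phi> x \<partial>law \<mu> p \<theta>) \<le> exp (- c * (d \<theta>0 \<theta>1)\<^sup>2))"
    and close: "\<And>\<theta> \<theta>1. \<theta> \<in> sieve_ball k r \<Longrightarrow> \<theta>1 \<in> sieve_ball k r \<Longrightarrow>
      (\<forall>i<k. \<bar>\<theta> i - \<theta>1 i\<bar> \<le> \<eta>) \<Longrightarrow> d \<theta> \<theta>1 < \<zeta> * R" and \<zeta>: "0 \<le> \<zeta>"
  shows "\<exists>\<phi> \<in> borel_measurable \<mu>. (\<forall>x\<in>space \<mu>. 0 \<le> \<phi> x \<and> \<phi> x \<le> 1) \<and>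
    (\<integral>\<^sup>+x. ennreal (\<phi> x) * ennreal (p \<theta>0 x) \<partial>\<mu>) \<le> ennreal ((2 * r / \<eta> + 2) ^ k * exp (- c * R\<^sup>2)) \<and>
    (\<forall>\<theta>\<in>sieve_ball k r. R < d \<theta>0 \<theta> \<longrightarrow>
      (\<integral>\<^sup>+x. ennreal (1 - \<phi> x) * ennreal (p \<theta> x) \<partial>\<mu>) \<le> ennreal (exp (- c * R\<^sup>2)))"
proof -
  define U where "U = {\<theta> \<in> sieve_ball k r. R < d \<theta>0 \<theta>}"
  have "\<bar>\<theta> i\<bar> \<le> r" if "\<theta> \<in> U" "i < k" for \<theta> i
  proof -
    have "\<bar>\<theta> i\<bar> \<le> L2_set \<theta> {..<k}"
      using member_le_L2_set[of "{..<k}" i "\<lambda>i. \<bar>\<theta> i\<bar>"] that(2) by (simp add: L2_set_def)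
    also have "\<dots> \<le> r" using that(1) by (simp add: U_def sieve_ball_def)
    finally show ?thesis .
  qed
  then have "\<exists>F\<subseteq>U. finite F \<and> real (card F) \<le> (2 * r / \<eta> + 2) ^ k \<and>
      (\<forall>\<theta>\<in>U. \<exists>\<theta>1\<in>F. \<forall>i<k. \<bar>\<theta> i - \<theta>1 i\<bar> \<le> \<eta>)"
    using r \<eta> by (intro finite_grid_net) auto
  then obtain F where F: "F \<subseteq> U" "finite F"
      "real (card F) \<le> (2 * r / \<eta> + 2) ^ k" "\<And>\<theta>. \<theta> \<in> U \<Longrightarrow> \<exists>\<theta>1\<in>F. \<forall>i<k. \<bar>\<theta> i - \<theta>1 i\<bar> \<le> \<eta>"
    by metis
  have "\<forall>\<theta>1\<in>F. \<exists>\<phi>. \<phi> \<in> borel_measurable \<mu> \<and> (\<forall>x\<in>space \<mu>. 0 \<le> \<phi> x \<and> \<phi> x \<le> 1) \<and>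
        (\<integral>x. \<phi> x \<partial>law \<mu> p \<theta>0) \<le> exp (- c * (d \<theta>0 \<theta>1)\<^sup>2) \<and>
        (\<forall>\<theta> \<in> space S. d \<theta> \<theta>1 < \<zeta> * d \<theta>0 \<theta>1 \<longrightarrow>
          (\<integral>x. 1 - \<phi> x \<partial>law \<mu> p \<theta>) \<le> exp (- c * (d \<theta>0 \<theta>1)\<^sup>2))"
    using local_test F(1) by (auto simp: U_def Bex_def)
  then obtain \<psi> where \<psi>: "\<And>\<theta>1. \<theta>1 \<in> F \<Longrightarrow> \<psi> \<theta>1 \<in> borel_measurable \<mu>"
      "\<And>\<theta>1 x. \<theta>1 \<in> F \<Longrightarrow> x \<in> space \<mu> \<Longrightarrow> 0 \<le> \<psi> \<theta>1 x \<and> \<psi> \<theta>1 x \<le> 1"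
      "\<And>\<theta>1. \<theta>1 \<in> F \<Longrightarrow> (\<integral>x. \<psi> \<theta>1 x \<partial>law \<mu> p \<theta>0) \<le> exp (- c * (d \<theta>0 \<theta>1)\<^sup>2)"
      "\<And>\<theta>1 \<theta>. \<theta>1 \<in> F \<Longrightarrow> \<theta> \<in> space S \<Longrightarrow> d \<theta> \<theta>1 < \<zeta> * d \<theta>0 \<theta>1 \<Longrightarrow>
          (\<integral>x. 1 - \<psi> \<theta>1 x \<partial>law \<mu> p \<theta>) \<le> exp (- c * (d \<theta>0 \<theta>1)\<^sup>2)"
    unfolding bchoice_iff by blast
  have far: "exp (- c * (d \<theta>0 \<theta>1)\<^sup>2) \<le> exp (- c * R\<^sup>2)" if "\<theta>1 \<in> F" for \<theta>1
  proof -
    have "R\<^sup>2 \<le> (d \<theta>0 \<theta>1)\<^sup>2" using that F(1) R by (intro power_mono) (auto simp: U_def)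
    then show ?thesis using c by (auto intro: mult_left_mono)
  qed
  define \<phi> where "\<phi> x = min 1 (\<Sum>\<theta>1\<in>F. \<psi> \<theta>1 x)" for x
  have \<phi>_meas: "\<phi> \<in> borel_measurable \<mu>"
    unfolding \<phi>_def using \<psi>(1) by measurable
  have \<phi>01: "0 \<le> \<phi> x \<and> \<phi> x \<le> 1" if "x \<in> space \<mu>" for x
    using \<psi>(2) that by (auto simp: \<phi>_def intro: sum_nonneg)
  have p_meas: "p \<theta> \<in> borel_measurable \<mu>" if "\<theta> \<in> space S" for \<theta>
    by (rule statistical_modelD(3)[OF model that])
  have "(\<integral>\<^sup>+x. ennreal (\<phi> x) * ennreal (p \<theta>0 x) \<partial>\<mu>)
      \<le> (\<integral>\<^sup>+x. (\<Sum>\<theta>1\<in>F. ennreal (\<psi> \<theta>1 x) * ennreal (p \<theta>0 x)) \<partial>\<mu>)"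
  proof (intro nn_integral_mono)
    fix x assume x: "x \<in> space \<mu>"
    have "ennreal (\<phi> x) \<le> ennreal (\<Sum>\<theta>1\<in>F. \<psi> \<theta>1 x)" by (simp add: \<phi>_def ennreal_leI)
    also have "\<dots> = (\<Sum>\<theta>1\<in>F. ennreal (\<psi> \<theta>1 x))"
      using \<psi>(2) x by (intro sum_ennreal[symmetric]) auto
    finally show "ennreal (\<phi> x) * ennreal (p \<theta>0 x) \<le> (\<Sum>\<theta>1\<in>F. ennreal (\<psi> \<theta>1 x) * ennreal (p \<theta>0 x))"
      by (simp add: sum_distrib_right[symmetric] mult_right_mono)
  qed
  also have "\<dots> = (\<Sum>\<theta>1\<in>F. \<integral>\<^sup>+x. ennreal (\<psi> \<theta>1 x) * ennreal (p \<theta>0 x) \<partial>\<mu>)"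
    using \<psi>(1) p_meas[OF \<theta>0] by (intro nn_integral_sum) auto
  also have "\<dots> \<le> (\<Sum>\<theta>1\<in>F. ennreal (exp (- c * R\<^sup>2)))"
  proof (intro sum_mono)
    fix \<theta>1 assume \<theta>1: "\<theta>1 \<in> F"
    then show "(\<integral>\<^sup>+x. ennreal (\<psi> \<theta>1 x) * ennreal (p \<theta>0 x) \<partial>\<mu>) \<le> ennreal (exp (- c * R\<^sup>2))"
      using nn_integral_law[OF model \<theta>0 \<psi>(1)[OF \<theta>1] \<psi>(2)[OF \<theta>1]]
        order_trans[OF \<psi>(3)[OF \<theta>1] far[OF \<theta>1]]
      by (simp only: ennreal_leI)
  qed
  also have "\<dots> = ennreal (real (card F) * exp (- c * R\<^sup>2))"
    by (simp add: ennreal_mult ennreal_of_nat_eq_real_of_nat)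
  also have "\<dots> \<le> ennreal ((2 * r / \<eta> + 2) ^ k * exp (- c * R\<^sup>2))"
    using F(3) by (intro ennreal_leI mult_right_mono) auto
  finally have type1: "(\<integral>\<^sup>+x. ennreal (\<phi> x) * ennreal (p \<theta>0 x) \<partial>\<mu>)
      \<le> ennreal ((2 * r / \<eta> + 2) ^ k * exp (- c * R\<^sup>2))" .
  have type2: "(\<integral>\<^sup>+x. ennreal (1 - \<phi> x) * ennreal (p \<theta> x) \<partial>\<mu>) \<le> ennreal (exp (- c * R\<^sup>2))"
    if \<theta>: "\<theta> \<in> sieve_ball k r" "R < d \<theta>0 \<theta>" for \<theta>
  proof -
    have \<theta>S: "\<theta> \<in> space S" using \<theta>(1) sieve by auto
    have "\<theta> \<in> U" using \<theta> by (simp add: U_def)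
    then obtain \<theta>1 where \<theta>1: "\<theta>1 \<in> F" "\<forall>i<k. \<bar>\<theta> i - \<theta>1 i\<bar> \<le> \<eta>" using F(4) by blast
    then have U1: "\<theta>1 \<in> sieve_ball k r" "R < d \<theta>0 \<theta>1" using F(1) by (auto simp: U_def)
    have "d \<theta> \<theta>1 < \<zeta> * R" by (rule close[OF \<theta>(1) U1(1) \<theta>1(2)])
    also have "\<dots> \<le> \<zeta> * d \<theta>0 \<theta>1" using U1 \<zeta> by (intro mult_left_mono) auto
    finally have le: "(\<integral>x. 1 - \<psi> \<theta>1 x \<partial>law \<mu> p \<theta>) \<le> exp (- c * R\<^sup>2)"
      using \<psi>(4)[OF \<theta>1(1) \<theta>S] far[OF \<theta>1(1)] by linarith
    have "(\<integral>\<^sup>+x. ennreal (1 - \<phi> x) * ennreal (p \<theta> x) \<partial>\<mu>)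
        \<le> (\<integral>\<^sup>+x. ennreal (1 - \<psi> \<theta>1 x) * ennreal (p \<theta> x) \<partial>\<mu>)"
    proof (intro nn_integral_mono mult_right_mono ennreal_leI)
      fix x assume x: "x \<in> space \<mu>"
      have "\<psi> \<theta>1 x \<le> (\<Sum>\<theta>1\<in>F. \<psi> \<theta>1 x)"
        using \<psi>(2) x by (intro member_le_sum[OF \<theta>1(1) _ F(2)]) auto
      then show "1 - \<phi> x \<le> 1 - \<psi> \<theta>1 x"
        using \<psi>(2)[OF \<theta>1(1) x] by (simp add: \<phi>_def)
    qed simp
    also have "\<dots> = ennreal (\<integral>x. 1 - \<psi> \<theta>1 x \<partial>law \<mu> p \<theta>)"
      using \<psi>(1,2)[OF \<theta>1(1)] by (intro nn_integral_law[OF model \<theta>S]) auto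
    also have "\<dots> \<le> ennreal (exp (- c * R\<^sup>2))" using le by (rule ennreal_leI)
    finally show ?thesis .
  qed
  show ?thesis
    using \<phi>_meas \<phi>01 type1 type2 by blast
qed

section \<open>The product prior: boxes and tails\<close>

text \<open>
  The coordinates are independent under \<open>coord_prior\<close>.
\<close>
lemma emeasure_coord_prior_PiE:
  assumes g: "prob_density g" and \<tau>: "\<And>i. 0 < \<tau> i" and E: "\<And>i. E i \<in> sets borel"
  shows "emeasure (coord_prior g \<tau> k) (\<Pi>\<^sub>E i\<in>{..<k}. E i)
    = (\<Prod>i<k. \<integral>\<^sup>+x. ennreal (g (x / \<tau> i) / \<tau> i) * indicator (E i) x \<partial>lborel)"
proof -
  have [measurable]: "g \<in> borel_measurable borel" and g0: "\<And>x. 0 \<le> g x"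
    using g by (auto simp: prob_density_def)
  note [measurable] = E
  interpret product_sigma_finite "\<lambda>_::nat. lborel :: real measure"
    by standard
  have box: "(\<Pi>\<^sub>E i\<in>{..<k}. E i) \<in> sets (\<Pi>\<^sub>M i\<in>{..<k}. (lborel :: real measure))"
    by (intro sets_PiM_I_finite) auto
  have "emeasure (coord_prior g \<tau> k) (\<Pi>\<^sub>E i\<in>{..<k}. E i)
      = (\<integral>\<^sup>+\<theta>. ennreal (\<Prod>i<k. g (\<theta> i / \<tau> i) / \<tau> i) * indicator (\<Pi>\<^sub>E i\<in>{..<k}. E i) \<theta>
          \<partial>(\<Pi>\<^sub>M i\<in>{..<k}. lborel))"
    unfolding coord_prior_def using box by (intro emeasure_density) measurable
  also have "\<dots> = (\<integral>\<^sup>+\<theta>. (\<Prod>i<k. ennreal (g (\<theta> i / \<tau> i) / \<tau> i) * indicator (E i) (\<theta> i)) \<partial>(\<Pi>\<^sub>M i\<in>{..<k}. lborel))"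
  proof (intro nn_integral_cong)
    fix \<theta> :: "nat \<Rightarrow> real" assume "\<theta> \<in> space (\<Pi>\<^sub>M i\<in>{..<k}. (lborel :: real measure))"
    then have "\<theta> \<in> extensional {..<k}" by (simp add: space_PiM PiE_def)
    then have "indicator (\<Pi>\<^sub>E i\<in>{..<k}. E i) \<theta> = (\<Prod>i<k. indicator (E i) (\<theta> i) :: ennreal)"
      by (cases "\<theta> \<in> (\<Pi>\<^sub>E i\<in>{..<k}. E i)")
         (auto simp: PiE_def Pi_def prod_zero_iff indicator_def intro!: prod.neutral[symmetric])
    moreover have "ennreal (\<Prod>i<k. g (\<theta> i / \<tau> i) / \<tau> i) = (\<Prod>i<k. ennreal (g (\<theta> i / \<tau> i) / \<tau> i))"
      using g0 \<tau> by (intro prod_ennreal[symmetric]) (simp add: less_imp_le)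
    ultimately show "ennreal (\<Prod>i<k. g (\<theta> i / \<tau> i) / \<tau> i) * indicator (\<Pi>\<^sub>E i\<in>{..<k}. E i) \<theta>
        = (\<Prod>i<k. ennreal (g (\<theta> i / \<tau> i) / \<tau> i) * indicator (E i) (\<theta> i))"
      by (simp add: prod.distrib)
  qed
  also have "\<dots> = (\<Prod>i<k. \<integral>\<^sup>+x. ennreal (g (x / \<tau> i) / \<tau> i) * indicator (E i) x \<partial>lborel)"
    by (rule product_nn_integral_prod) auto
  finally show ?thesis .
qed

lemma nn_integral_scaled_density:
  assumes [measurable]: "g \<in> borel_measurable borel" "E \<in> sets borel" and g0: "\<And>x. 0 \<le> g x" and t: "0 < t"
  shows "(\<integral>\<^sup>+x. ennreal (g (x / t) / t) * indicator E x \<partial>lborel)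
    = (\<integral>\<^sup>+x. ennreal (g x) * indicator E (t * x) \<partial>lborel)"
proof -
  have "(\<integral>\<^sup>+x. ennreal (g (x / t) / t) * indicator E x \<partial>lborel)
      = ennreal \<bar>t\<bar> * (\<integral>\<^sup>+x. ennreal (g ((0 + t * x) / t) / t) * indicator E (0 + t * x) \<partial>lborel)"
    using t by (intro nn_integral_real_affine) auto
  also have "\<dots> = (\<integral>\<^sup>+x. ennreal \<bar>t\<bar> * (ennreal (g ((0 + t * x) / t) / t) * indicator E (0 + t * x)) \<partial>lborel)"
    by (rule nn_integral_cmult[symmetric]) measurable
  also have "\<dots> = (\<integral>\<^sup>+x. ennreal (g x) * indicator E (t * x) \<partial>lborel)"
    using t g0 by (intro nn_integral_cong) (simp add: mult.assoc[symmetric] ennreal_mult[symmetric])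
  finally show ?thesis .
qed

text \<open>
  On the box each rescaled coordinate exceeds that of \<open>\<theta>0\<close> by at most \<open>1\<close> in absolute value, and
  \<open>(q + 1) powr \<alpha> \<le> 2 powr \<alpha> * (q powr \<alpha> + 1)\<close>. This bounds the density below, and the
  volume contributes the factors \<open>2 * \<delta>\<close>. The centre only has to be dominated by \<open>\<theta>0\<close>, which
  leaves room to move the box towards the origin.
\<close>
lemma coord_prior_box_lower:
  assumes g: "prob_density g" and \<tau>: "\<And>i. 0 < \<tau> i"
    and low: "\<And>t. G1 * exp (- G2 * \<bar>t\<bar> powr \<alpha>) \<le> g t"
    and G: "0 < G1" "0 \<le> G2" "0 < \<alpha>"
    and \<tau>0: "\<And>i. \<tau> i \<le> \<tau>0" and \<delta>: "0 < \<delta>" "\<And>i. i < k \<Longrightarrow> \<delta> \<le> \<tau> i"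
    and c: "\<And>i. i < k \<Longrightarrow> \<bar>c i\<bar> \<le> \<bar>\<theta>0 i\<bar>"
  shows "ennreal ((2 * \<delta> * G1 / \<tau>0) ^ k *
      exp (- G2 * 2 powr \<alpha> * ((\<Sum>i<k. \<bar>\<theta>0 i\<bar> powr \<alpha> / \<tau> i powr \<alpha>) + real k)))
    \<le> emeasure (coord_prior g \<tau> k) (\<Pi>\<^sub>E i\<in>{..<k}. {c i - \<delta>..c i + \<delta>})"
proof -
  have [measurable]: "g \<in> borel_measurable borel"
    using g by (auto simp: prob_density_def)
  have \<tau>0_pos: "0 < \<tau>0" using \<tau>[of 0] \<tau>0[of 0] by linarith
  let ?b = "\<lambda>i. G1 / \<tau>0 * exp (- G2 * 2 powr \<alpha> * (\<bar>\<theta>0 i\<bar> powr \<alpha> / \<tau> i powr \<alpha> + 1))"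
  have pw: "?b i \<le> g (x / \<tau> i) / \<tau> i" if i: "i < k" and x: "x \<in> {c i - \<delta>..c i + \<delta>}" for i x
  proof -
    define q where "q = \<bar>\<theta>0 i\<bar> / \<tau> i"
    have q: "0 \<le> q" using \<tau>[of i] by (simp add: q_def)
    have "\<bar>x\<bar> \<le> \<bar>\<theta>0 i\<bar> + \<tau> i"
      using x c[OF i] \<delta>(2)[OF i] by auto
    then have "\<bar>x\<bar> / \<tau> i \<le> (\<bar>\<theta>0 i\<bar> + \<tau> i) / \<tau> i"
      using \<tau>[of i] by (intro divide_right_mono) auto
    then have xq: "\<bar>x / \<tau> i\<bar> \<le> q + 1"
      using \<tau>[of i] by (simp add: q_def add_divide_distrib)
    have "\<bar>x / \<tau> i\<bar> powr \<alpha> \<le> (2 * max q 1) powr \<alpha>"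
      using xq G by (intro powr_mono2) auto
    also have "\<dots> = 2 powr \<alpha> * max q 1 powr \<alpha>"
      by (simp add: powr_mult)
    also have "max q 1 powr \<alpha> \<le> q powr \<alpha> + 1"
      by (simp add: max_def)
    finally have "\<bar>x / \<tau> i\<bar> powr \<alpha> \<le> 2 powr \<alpha> * (q powr \<alpha> + 1)"
      by simp
    then have "G2 * \<bar>x / \<tau> i\<bar> powr \<alpha> \<le> G2 * (2 powr \<alpha> * (q powr \<alpha> + 1))"
      using G(2) by (intro mult_left_mono) auto
    then have "G1 * exp (- G2 * 2 powr \<alpha> * (q powr \<alpha> + 1)) \<le> G1 * exp (- G2 * \<bar>x / \<tau> i\<bar> powr \<alpha>)"
      using G by (intro mult_left_mono) (auto simp: mult.assoc)
    also have "\<dots> \<le> g (x / \<tau> i)" by (rule low)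
    finally have "G1 * exp (- G2 * 2 powr \<alpha> * (q powr \<alpha> + 1)) / \<tau>0 \<le> g (x / \<tau> i) / \<tau> i"
      using \<tau>[of i] \<tau>0[of i] g by (intro frac_le) (auto simp: prob_density_def)
    moreover have "q powr \<alpha> = \<bar>\<theta>0 i\<bar> powr \<alpha> / \<tau> i powr \<alpha>"
      using \<tau>[of i] by (simp add: q_def powr_divide)
    ultimately show ?thesis by simp
  qed
  have b0: "0 \<le> ?b i" for i using G \<tau>0_pos by simp
  have factor: "ennreal (?b i * (2 * \<delta>))
      \<le> (\<integral>\<^sup>+x. ennreal (g (x / \<tau> i) / \<tau> i) * indicator {c i - \<delta>..c i + \<delta>} x \<partial>lborel)" if "i < k" for i
  proof -
    have "ennreal (?b i * (2 * \<delta>)) = ennreal (?b i) * emeasure lborel {c i - \<delta>..c i + \<delta>}"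
      using \<delta>(1) b0[of i] by (subst ennreal_mult) simp_all
    also have "\<dots> = (\<integral>\<^sup>+x. ennreal (?b i) * indicator {c i - \<delta>..c i + \<delta>} x \<partial>lborel)"
      by (rule nn_integral_cmult_indicator[symmetric]) simp
    also have "\<dots> \<le> (\<integral>\<^sup>+x. ennreal (g (x / \<tau> i) / \<tau> i) * indicator {c i - \<delta>..c i + \<delta>} x \<partial>lborel)"
      using pw[OF that] by (intro nn_integral_mono) (auto simp: indicator_def intro!: ennreal_leI)
    finally show ?thesis .
  qed
  have "(\<Prod>i<k. ?b i * (2 * \<delta>)) = (\<Prod>i<k. 2 * \<delta> * G1 / \<tau>0) *
      (\<Prod>i<k. exp (- G2 * 2 powr \<alpha> * (\<bar>\<theta>0 i\<bar> powr \<alpha> / \<tau> i powr \<alpha> + 1)))"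
    unfolding prod.distrib[symmetric] by (intro prod.cong) auto
  also have "(\<Prod>i<k. exp (- G2 * 2 powr \<alpha> * (\<bar>\<theta>0 i\<bar> powr \<alpha> / \<tau> i powr \<alpha> + 1)))
      = exp (\<Sum>i<k. - G2 * 2 powr \<alpha> * (\<bar>\<theta>0 i\<bar> powr \<alpha> / \<tau> i powr \<alpha> + 1))"
    by (simp add: exp_sum)
  also have "(\<Sum>i<k. - G2 * 2 powr \<alpha> * (\<bar>\<theta>0 i\<bar> powr \<alpha> / \<tau> i powr \<alpha> + 1))
      = - G2 * 2 powr \<alpha> * ((\<Sum>i<k. \<bar>\<theta>0 i\<bar> powr \<alpha> / \<tau> i powr \<alpha>) + real k)"
    by (simp only: sum_distrib_left[symmetric] sum.distrib) simp
  finally have "ennreal ((2 * \<delta> * G1 / \<tau>0) ^ k *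
      exp (- G2 * 2 powr \<alpha> * ((\<Sum>i<k. \<bar>\<theta>0 i\<bar> powr \<alpha> / \<tau> i powr \<alpha>) + real k)))
      = ennreal (\<Prod>i<k. ?b i * (2 * \<delta>))" by simp
  also have "\<dots> = (\<Prod>i<k. ennreal (?b i * (2 * \<delta>)))"
    using \<delta>(1) by (intro prod_ennreal[symmetric] mult_nonneg_nonneg[OF b0]) simp
  also have "\<dots> \<le> (\<Prod>i<k. \<integral>\<^sup>+x. ennreal (g (x / \<tau> i) / \<tau> i) * indicator {c i - \<delta>..c i + \<delta>} x \<partial>lborel)"
    using factor by (intro prod_mono_ennreal) auto
  also have "\<dots> = emeasure (coord_prior g \<tau> k) (\<Pi>\<^sub>E i\<in>{..<k}. {c i - \<delta>..c i + \<delta>})"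
    using g \<tau> by (intro emeasure_coord_prior_PiE[symmetric]) auto
  finally show ?thesis .
qed

text \<open>
  Half of the exponent yields the tail. The other half leaves the integral of
  \<open>exp (- (G4 / 2) * \<bar>t\<bar> powr \<alpha>)\<close>; after rescaling \<open>t\<close>, this function is dominated by
  \<open>g / G1\<close> through the lower bound on \<open>g\<close>, and \<open>g\<close> has integral \<open>1\<close>.
\<close>
lemma density_tail:
  assumes g: "prob_density g"
    and tails: "\<And>t. G1 * exp (- G2 * \<bar>t\<bar> powr \<alpha>) \<le> g t \<and> g t \<le> G3 * exp (- G4 * \<bar>t\<bar> powr \<alpha>)"
    and G: "0 < G1" "0 < G2" "0 < G3" "0 < G4" "0 < \<alpha>" and T: "0 \<le> T"
  shows "(\<integral>\<^sup>+t. ennreal (g t) * indicator {t. T < \<bar>t\<bar>} t \<partial>lborel)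
    \<le> ennreal (G3 / (G1 * (G4 / (2 * G2)) powr (1 / \<alpha>)) * exp (- (G4 / 2) * T powr \<alpha>))"
proof -
  (* The scale for which \<open>G2 * (lam * t) powr \<alpha> = G4 / 2 * t powr \<alpha>\<close>. *)
  define lam where "lam = (G4 / (2 * G2)) powr (1 / \<alpha>)"
  have lam: "0 < lam" using G by (simp add: lam_def)
  have lam_pow: "lam powr \<alpha> = G4 / (2 * G2)"
    using G by (simp add: lam_def powr_powr)
  have [measurable]: "g \<in> borel_measurable borel" and g0: "\<And>x. 0 \<le> g x"
    and g1: "(\<integral>\<^sup>+x. ennreal (g x) \<partial>lborel) = 1"
    using g by (auto simp: prob_density_def)
  have "ennreal (g t) * indicator {t. T < \<bar>t\<bar>} t
      \<le> ennreal (G3 / G1 * exp (- (G4 / 2) * T powr \<alpha>)) * ennreal (g (0 + lam * t))" for t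
  proof (cases "T < \<bar>t\<bar>")
    case True
    have "T powr \<alpha> \<le> \<bar>t\<bar> powr \<alpha>" using True T G by (intro powr_mono2) auto
    then have "G4 / 2 * T powr \<alpha> \<le> G4 / 2 * \<bar>t\<bar> powr \<alpha>" using G by (intro mult_left_mono) auto
    then have le: "exp (- G4 * \<bar>t\<bar> powr \<alpha>) \<le> exp (- (G4 / 2) * T powr \<alpha>) * exp (- (G4 / 2) * \<bar>t\<bar> powr \<alpha>)"
      by (simp add: exp_add[symmetric])
    have "G1 * exp (- (G4 / 2) * \<bar>t\<bar> powr \<alpha>) = G1 * exp (- G2 * \<bar>lam * t\<bar> powr \<alpha>)"
      using lam G by (simp add: abs_mult powr_mult lam_pow)
    also have "\<dots> \<le> g (lam * t)" using tails by blast
    finally have "exp (- (G4 / 2) * \<bar>t\<bar> powr \<alpha>) \<le> g (lam * t) / G1"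
      using G by (simp add: field_simps)
    then have "G3 * (exp (- (G4 / 2) * T powr \<alpha>) * exp (- (G4 / 2) * \<bar>t\<bar> powr \<alpha>))
        \<le> G3 * (exp (- (G4 / 2) * T powr \<alpha>) * (g (lam * t) / G1))"
      using G by (intro mult_left_mono) auto
    moreover have "g t \<le> G3 * (exp (- (G4 / 2) * T powr \<alpha>) * exp (- (G4 / 2) * \<bar>t\<bar> powr \<alpha>))"
      using tails[of t] le G by (meson order_trans mult_left_mono less_imp_le)
    ultimately have "g t \<le> G3 / G1 * exp (- (G4 / 2) * T powr \<alpha>) * g (lam * t)" by simp
    then have "ennreal (g t) \<le> ennreal (G3 / G1 * exp (- (G4 / 2) * T powr \<alpha>) * g (lam * t))"
      by (rule ennreal_leI)
    also have "\<dots> = ennreal (G3 / G1 * exp (- (G4 / 2) * T powr \<alpha>)) * ennreal (g (lam * t))"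
      using G g0 by (intro ennreal_mult) auto
    finally show ?thesis using True by simp
  qed simp
  then have "(\<integral>\<^sup>+t. ennreal (g t) * indicator {t. T < \<bar>t\<bar>} t \<partial>lborel)
      \<le> (\<integral>\<^sup>+t. ennreal (G3 / G1 * exp (- (G4 / 2) * T powr \<alpha>)) * ennreal (g (0 + lam * t)) \<partial>lborel)"
    by (intro nn_integral_mono)
  also have "\<dots> = ennreal (G3 / G1 * exp (- (G4 / 2) * T powr \<alpha>)) * (\<integral>\<^sup>+t. ennreal (g (0 + lam * t)) \<partial>lborel)"
    by (rule nn_integral_cmult) measurable
  also have "(\<integral>\<^sup>+t. ennreal (g (0 + lam * t)) \<partial>lborel) = ennreal (1 / lam)"
  proof -
    have "1 = ennreal \<bar>lam\<bar> * (\<integral>\<^sup>+t. ennreal (g (0 + lam * t)) \<partial>lborel)"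
      using lam by (subst g1[symmetric], intro nn_integral_real_affine) auto
    then have "ennreal (1 / lam) * 1 = ennreal (1 / lam) * (ennreal lam * (\<integral>\<^sup>+t. ennreal (g (0 + lam * t)) \<partial>lborel))"
      using lam by simp
    also have "\<dots> = (\<integral>\<^sup>+t. ennreal (g (0 + lam * t)) \<partial>lborel)"
      using lam by (simp add: mult.assoc[symmetric] ennreal_mult[symmetric])
    finally show ?thesis by simp
  qed
  also have "ennreal (G3 / G1 * exp (- (G4 / 2) * T powr \<alpha>)) * ennreal (1 / lam)
      = ennreal (G3 / (G1 * lam) * exp (- (G4 / 2) * T powr \<alpha>))"
    using G lam by (simp add: ennreal_mult[symmetric])
  finally show ?thesis by (simp add: lam_def)
qed

text \<open>
  If the norm exceeds \<open>r\<close>, some coordinate exceeds \<open>r / K\<close>.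
\<close>
lemma coord_prior_norm_tail:
  assumes g: "prob_density g" and \<tau>: "\<And>i. 0 < \<tau> i" "\<And>i. \<tau> i \<le> \<tau>0"
    and tails: "\<And>t. G1 * exp (- G2 * \<bar>t\<bar> powr \<alpha>) \<le> g t \<and> g t \<le> G3 * exp (- G4 * \<bar>t\<bar> powr \<alpha>)"
    and G: "0 < G1" "0 < G2" "0 < G3" "0 < G4" "0 < \<alpha>" and r: "0 \<le> r" and k: "k \<le> K"
  shows "emeasure (coord_prior g \<tau> k) {\<theta> \<in> space (coord_prior g \<tau> k). r < L2_set \<theta> {..<k}}
    \<le> ennreal (real K * (G3 / (G1 * (G4 / (2 * G2)) powr (1 / \<alpha>)) *
        exp (- (G4 / 2) * (r / (real K * \<tau>0)) powr \<alpha>)))"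
proof (cases "k = 0")
  case True
  then show ?thesis using r by (simp add: L2_set_def)
next
  case False
  have [measurable]: "g \<in> borel_measurable borel" and g0: "\<And>x. 0 \<le> g x"
    and g1: "(\<integral>\<^sup>+x. ennreal (g x) \<partial>lborel) = 1"
    using g by (auto simp: prob_density_def)
  have \<tau>0: "0 < \<tau>0" using \<tau>(1)[of 0] \<tau>(2)[of 0] by linarith
  let ?P = "coord_prior g \<tau> k"
  let ?t = "G3 / (G1 * (G4 / (2 * G2)) powr (1 / \<alpha>)) * exp (- (G4 / 2) * (r / (real K * \<tau>0)) powr \<alpha>)"
  have sp: "space ?P = (\<Pi>\<^sub>E i\<in>{..<k}. UNIV)"
    by (simp add: coord_prior_def space_PiM)
  define A where "A i = (\<Pi>\<^sub>E l\<in>{..<k}. if l = i then {x. r / real K < \<bar>x\<bar>} else (UNIV :: real set))" for i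
  have A_sets: "A i \<in> sets ?P" for i
  proof -
    have "A i \<in> sets (\<Pi>\<^sub>M i\<in>{..<k}. (lborel :: real measure))"
      unfolding A_def by (intro sets_PiM_I_finite) auto
    then show ?thesis by (simp add: coord_prior_def)
  qed
  have A_le: "emeasure ?P (A i) \<le> ennreal ?t" if i: "i < k" for i
  proof -
    let ?I = "\<lambda>l. \<integral>\<^sup>+x. ennreal (g (x / \<tau> l) / \<tau> l) * indicator (if l = i then {x. r / real K < \<bar>x\<bar>} else UNIV) x \<partial>lborel"
    have "emeasure ?P (A i) = (\<Prod>l<k. ?I l)"
      unfolding A_def using g \<tau>(1) by (intro emeasure_coord_prior_PiE) auto
    also have "\<dots> = ?I i * (\<Prod>l\<in>{..<k} - {i}. ?I l)"
      using i by (intro prod.remove) auto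
    also have "(\<Prod>l\<in>{..<k} - {i}. ?I l) = 1"
    proof (intro prod.neutral ballI)
      fix l assume "l \<in> {..<k} - {i}"
      then have "?I l = (\<integral>\<^sup>+x. ennreal (g (x / \<tau> l) / \<tau> l) * indicator UNIV x \<partial>lborel)" by simp
      also have "\<dots> = (\<integral>\<^sup>+x. ennreal (g x) * indicator UNIV (\<tau> l * x) \<partial>lborel)"
        using g0 \<tau>(1) by (intro nn_integral_scaled_density) auto
      finally show "?I l = 1" using g1 by simp
    qed
    also have "?I i * 1 = (\<integral>\<^sup>+x. ennreal (g x) * indicator {x. r / real K < \<bar>x\<bar>} (\<tau> i * x) \<partial>lborel)"
      using g0 \<tau>(1) by (simp add: nn_integral_scaled_density)
    also have "\<dots> \<le> (\<integral>\<^sup>+x. ennreal (g x) * indicator {x. r / (real K * \<tau>0) < \<bar>x\<bar>} x \<partial>lborel)"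
    proof (intro nn_integral_mono mult_left_mono)
      fix x
      have "r / (real K * \<tau>0) < \<bar>x\<bar>" if "r / real K < \<bar>\<tau> i * x\<bar>"
      proof -
        note that
        also have "\<bar>\<tau> i * x\<bar> \<le> \<tau>0 * \<bar>x\<bar>"
          using \<tau>(1)[of i] \<tau>(2)[of i] by (simp add: abs_mult mult_right_mono)
        finally show ?thesis using \<tau>0 False k by (simp add: field_simps)
      qed
      then show "indicator {x. r / real K < \<bar>x\<bar>} (\<tau> i * x) \<le> (indicator {x. r / (real K * \<tau>0) < \<bar>x\<bar>} x :: ennreal)"
        by (auto simp: indicator_def)
    qed simp
    also have "\<dots> \<le> ennreal ?t"
      using r \<tau>0 by (intro density_tail[OF g tails G]) auto
    finally show ?thesis .
  qed
  have cover: "{\<theta> \<in> space ?P. r < L2_set \<theta> {..<k}} \<subseteq> (\<Union>i<k. A i)"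
  proof
    fix \<theta> assume "\<theta> \<in> {\<theta> \<in> space ?P. r < L2_set \<theta> {..<k}}"
    then have \<theta>: "\<theta> \<in> (\<Pi>\<^sub>E i\<in>{..<k}. UNIV)" and big: "r < L2_set \<theta> {..<k}" using sp by auto
    have "\<exists>i<k. r / real K < \<bar>\<theta> i\<bar>"
    proof (rule ccontr)
      assume "\<not> ?thesis"
      then have "\<not> r / real K < \<bar>\<theta> i\<bar>" if "i < k" for i using that by blast
      then have "(\<Sum>i<k. \<bar>\<theta> i\<bar>) \<le> (\<Sum>i<k. r / real K)"
        by (intro sum_mono leI) simp
      also have "\<dots> = real k * (r / real K)" by simp
      also have "\<dots> \<le> real K * (r / real K)" using k r by (intro mult_right_mono) auto
      also have "\<dots> \<le> r" using r by simp
      finally have "(\<Sum>i<k. \<bar>\<theta> i\<bar>) \<le> r" .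
      with L2_set_le_sum_abs[of \<theta> "{..<k}"] big show False by simp
    qed
    then show "\<theta> \<in> (\<Union>i<k. A i)" using \<theta> by (auto simp: A_def PiE_def Pi_def)
  qed
  have "emeasure ?P {\<theta> \<in> space ?P. r < L2_set \<theta> {..<k}} \<le> emeasure ?P (\<Union>i<k. A i)"
    using A_sets by (intro emeasure_mono cover sets.finite_UN) auto
  also have "\<dots> \<le> (\<Sum>i<k. emeasure ?P (A i))"
    using A_sets by (intro emeasure_subadditive_finite) auto
  also have "\<dots> \<le> (\<Sum>i<k. ennreal ?t)"
    using A_le by (intro sum_mono) auto
  also have "\<dots> = ennreal (real k * ?t)"
    using G by (subst ennreal_mult) (simp_all add: ennreal_of_nat_eq_real_of_nat)
  also have "\<dots> \<le> ennreal (real K * ?t)"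
    using k G by (intro ennreal_leI mult_right_mono) auto
  finally show ?thesis .
qed

section \<open>Sieve components and their mixture\<close>

text \<open>
  Every point of a sieve is the image under \<open>trunc\<close> of a point of the product space.
\<close>
lemma sieve_subset_space:
  assumes "parameter_space S"
  shows "sieve k \<subseteq> space S"
proof
  fix \<theta> assume \<theta>: "\<theta> \<in> sieve k"
  have "restrict \<theta> {..<k} \<in> space (\<Pi>\<^sub>M i\<in>{..<k}. (borel :: real measure))"
    by (simp add: space_PiM)
  then have "trunc k (restrict \<theta> {..<k}) \<in> space S"
    by (rule measurable_space[OF assms[unfolded parameter_space_def, rule_format]])
  moreover have "trunc k (restrict \<theta> {..<k}) = \<theta>"
    using \<theta> by (auto simp: trunc_def sieve_def)
  ultimately show "\<theta> \<in> space S" by simp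
qed

lemma trunc_in_sieve: "trunc k \<theta> \<in> sieve k"
  by (simp add: trunc_def sieve_def)

lemma trunc_in_space: "parameter_space S \<Longrightarrow> trunc k \<theta> \<in> space S"
  using sieve_subset_space trunc_in_sieve by blast

lemma trunc_in_sieve_ball:
  assumes "k \<le> K" and "L2_set \<theta> {..<k} \<le> r"
  shows "trunc k \<theta> \<in> sieve_ball K r"
proof -
  have "L2_set (trunc k \<theta>) {..<K} = L2_set (trunc k \<theta>) {..<k}"
    unfolding L2_set_def using assms(1)
    by (intro arg_cong[where f = sqrt] sum.mono_neutral_right) (auto simp: trunc_def)
  also have "\<dots> = L2_set \<theta> {..<k}"
    by (intro L2_set_cong) (auto simp: trunc_def)
  finally show ?thesis
    using assms by (auto simp: sieve_ball_def sieve_def trunc_def)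
qed

lemma trunc_box_in_l2_nbhd:
  assumes \<theta>: "\<theta> \<in> (\<Pi>\<^sub>E i\<in>{..<k}. {c i - \<delta>..c i + \<delta>})"
    and near: "\<And>i. i < k \<Longrightarrow> \<bar>\<theta>0 i - c i\<bar> \<le> e" and r: "real k * (e + \<delta>) \<le> r"
  shows "trunc k \<theta> \<in> l2_nbhd \<theta>0 k r"
proof -
  have "L2_set (\<lambda>i. trunc k \<theta>0 i - trunc k \<theta> i) {..<k} \<le> (\<Sum>i<k. \<bar>trunc k \<theta>0 i - trunc k \<theta> i\<bar>)"
    by (rule L2_set_le_sum_abs)
  also have "\<dots> \<le> (\<Sum>i<k. e + \<delta>)"
  proof (intro sum_mono)
    fix i assume "i \<in> {..<k}"
    then have i: "i < k" by simp
    then have "\<theta> i \<in> {c i - \<delta>..c i + \<delta>}" using \<theta> by (auto simp: PiE_def Pi_def)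
    then have "\<bar>\<theta>0 i - \<theta> i\<bar> \<le> e + \<delta>" using near[OF i] by auto
    then show "\<bar>trunc k \<theta>0 i - trunc k \<theta> i\<bar> \<le> e + \<delta>" using i by (simp add: trunc_def)
  qed
  finally show ?thesis
    using r trunc_in_sieve by (simp add: l2_nbhd_def)
qed

lemma sets_coord_prior: "sets (coord_prior g \<tau> k) = sets (\<Pi>\<^sub>M i\<in>{..<k}. (lborel :: real measure))"
  by (simp add: coord_prior_def)

lemma space_coord_prior: "space (coord_prior g \<tau> k) = space (\<Pi>\<^sub>M i\<in>{..<k}. (lborel :: real measure))"
  by (simp add: coord_prior_def)

lemma emeasure_component:
  assumes "parameter_space S" "A \<in> sets S"
  shows "emeasure (component S g \<tau> k) A
    = emeasure (coord_prior g \<tau> k) (trunc k -` A \<inter> space (coord_prior g \<tau> k))"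
  using assms measurable_trunc[OF assms(1)] by (simp add: component_def emeasure_distr)

lemma emeasure_truncated_component:
  fixes g :: "real \<Rightarrow> real" and \<tau> :: "nat \<Rightarrow> real" and k :: nat and r :: real
  assumes "parameter_space S" "A \<in> sets S"
  defines "B \<equiv> {\<theta> \<in> space (coord_prior g \<tau> k). (\<Sum>i<k. \<bar>\<theta> i\<bar>) \<le> r}"
  shows "emeasure (truncated_component r S g \<tau> k) A
    = emeasure (coord_prior g \<tau> k) (B \<inter> (trunc k -` A \<inter> space (coord_prior g \<tau> k)))
      / emeasure (coord_prior g \<tau> k) B"
    and "B \<in> sets (coord_prior g \<tau> k)"
proof -
  let ?P = "coord_prior g \<tau> k"
  have "(\<lambda>\<theta>. \<Sum>i<k. \<bar>\<theta> i\<bar>) \<in> borel_measurable (\<Pi>\<^sub>M i\<in>{..<k}. (lborel :: real measure))"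
    by (intro borel_measurable_sum borel_measurable_abs) (simp add: measurable_component_singleton)
  then show B: "B \<in> sets ?P"
    by (simp add: B_def sets_coord_prior space_coord_prior)
  have t: "trunc k \<in> uniform_measure ?P B \<rightarrow>\<^sub>M S"
    using measurable_trunc[OF assms(1), of k g \<tau>] by (simp cong: measurable_cong_sets)
  have A: "trunc k -` A \<inter> space ?P \<in> sets ?P"
    using measurable_trunc[OF assms(1)] assms(2) by (rule measurable_sets)
  have "truncated_component r S g \<tau> k = distr (uniform_measure ?P B) S (trunc k)"
    by (simp add: truncated_component_def B_def space_coord_prior)
  then show "emeasure (truncated_component r S g \<tau> k) A
      = emeasure ?P (B \<inter> (trunc k -` A \<inter> space ?P)) / emeasure ?P B"
    using t assms(2) B A by (simp add: emeasure_distr emeasure_uniform_measure)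
qed

lemma component_box_le:
  assumes S: "parameter_space S" and A: "A \<in> sets S"
    and box: "\<And>\<theta>. \<theta> \<in> (\<Pi>\<^sub>E i\<in>{..<k}. E i) \<Longrightarrow> trunc k \<theta> \<in> A"
  shows "emeasure (coord_prior g \<tau> k) (\<Pi>\<^sub>E i\<in>{..<k}. E i) \<le> emeasure (component S g \<tau> k) A"
  unfolding emeasure_component[OF S A]
proof (rule emeasure_mono)
  show "(\<Pi>\<^sub>E i\<in>{..<k}. E i) \<subseteq> trunc k -` A \<inter> space (coord_prior g \<tau> k)"
    using box by (auto simp: space_coord_prior space_PiM)
qed (rule measurable_sets[OF measurable_trunc[OF S] A])

lemma le_divide_self_ennreal:
  fixes x y :: ennreal
  assumes "y \<le> 1"
  shows "x \<le> x / y"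
proof (cases "y = 0")
  case True
  then show ?thesis by (cases "x = 0") (simp_all add: ennreal_divide_zero)
next
  case False
  have "y \<noteq> top" using assms by (auto simp: top_unique)
  then have "x = x * y / y" using False by (simp add: ennreal_mult_divide_eq)
  also have "\<dots> \<le> x * 1 / y" using assms by (intro divide_right_mono_ennreal mult_left_mono) auto
  finally show ?thesis by simp
qed

text \<open>
  Conditioning on the ball can only increase the mass of a set contained in it.
\<close>
lemma truncated_component_box_le:
  assumes S: "parameter_space S" and A: "A \<in> sets S" and g: "prob_density g" and \<tau>: "\<And>i. 0 < \<tau> i"
    and box: "\<And>\<theta>. \<theta> \<in> (\<Pi>\<^sub>E i\<in>{..<k}. E i) \<Longrightarrow> trunc k \<theta> \<in> A"
    and ball: "\<And>\<theta>. \<theta> \<in> (\<Pi>\<^sub>E i\<in>{..<k}. E i) \<Longrightarrow> (\<Sum>i<k. \<bar>\<theta> i\<bar>) \<le> r"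
  shows "emeasure (coord_prior g \<tau> k) (\<Pi>\<^sub>E i\<in>{..<k}. E i) \<le> emeasure (truncated_component r S g \<tau> k) A"
proof -
  let ?P = "coord_prior g \<tau> k"
  let ?B = "{\<theta> \<in> space ?P. (\<Sum>i<k. \<bar>\<theta> i\<bar>) \<le> r}"
  interpret P: prob_space ?P by (rule prob_space_coord_prior[OF g \<tau>])
  have "emeasure ?P (\<Pi>\<^sub>E i\<in>{..<k}. E i) \<le> emeasure ?P (?B \<inter> (trunc k -` A \<inter> space ?P))"
  proof (rule emeasure_mono)
    show "(\<Pi>\<^sub>E i\<in>{..<k}. E i) \<subseteq> ?B \<inter> (trunc k -` A \<inter> space ?P)"
      using box ball by (auto simp: space_coord_prior space_PiM)
    show "?B \<inter> (trunc k -` A \<inter> space ?P) \<in> sets ?P"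
      by (intro sets.Int measurable_sets[OF measurable_trunc[OF S] A] emeasure_truncated_component(2)[OF S A])
  qed
  also have "\<dots> \<le> emeasure ?P (?B \<inter> (trunc k -` A \<inter> space ?P)) / emeasure ?P ?B"
    by (rule le_divide_self_ennreal) (rule P.emeasure_le_1)
  finally show ?thesis
    using emeasure_truncated_component(1)[OF S A] by simp
qed

lemma component_off_sieve_ball_le:
  assumes S: "parameter_space S" and A: "A \<in> sets S" "A \<inter> sieve_ball K r = {}" and k: "k \<le> K"
  shows "emeasure (component S g \<tau> k) A
    \<le> emeasure (coord_prior g \<tau> k) {\<theta> \<in> space (coord_prior g \<tau> k). r < L2_set \<theta> {..<k}}"
  unfolding emeasure_component[OF S A(1)]
proof (rule emeasure_mono)
  show "trunc k -` A \<inter> space (coord_prior g \<tau> k)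
      \<subseteq> {\<theta> \<in> space (coord_prior g \<tau> k). r < L2_set \<theta> {..<k}}"
    using trunc_in_sieve_ball[OF k] A(2) by (force simp: not_less)
  have "(\<lambda>\<theta>. L2_set \<theta> {..<k}) \<in> borel_measurable (\<Pi>\<^sub>M i\<in>{..<k}. (lborel :: real measure))"
    unfolding L2_set_def by measurable
  then show "{\<theta> \<in> space (coord_prior g \<tau> k). r < L2_set \<theta> {..<k}} \<in> sets (coord_prior g \<tau> k)"
    by (simp add: sets_coord_prior space_coord_prior)
qed

text \<open>
  The \<open>l\<^sup>1\<close> ball lies in the \<open>l\<^sup>2\<close> ball of the same radius, hence in the sieve ball.
\<close>
lemma truncated_component_off_sieve_ball:
  assumes S: "parameter_space S" and A: "A \<in> sets S" "A \<inter> sieve_ball K r = {}" and k: "k \<le> K" "r1 \<le> r"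
  shows "emeasure (truncated_component r1 S g \<tau> k) A = 0"
proof -
  have "{\<theta> \<in> space (coord_prior g \<tau> k). (\<Sum>i<k. \<bar>\<theta> i\<bar>) \<le> r1}
      \<inter> (trunc k -` A \<inter> space (coord_prior g \<tau> k)) = {}" (is "?I = {}")
  proof -
    have False if "\<theta> \<in> ?I" for \<theta>
    proof -
      have "L2_set \<theta> {..<k} \<le> r"
        using L2_set_le_sum_abs[of \<theta> "{..<k}"] that k by auto
      then show False using trunc_in_sieve_ball[OF k(1)] that A(2) by blast
    qed
    then show ?thesis by blast
  qed
  then show ?thesis
    using emeasure_truncated_component(1)[OF S A(1)] by simp
qed

lemma suminf_pmf_nat: "(\<Sum>k. ennreal (pmf w k)) = 1" for w :: "nat pmf"
proof -
  have "(\<Sum>k. ennreal (pmf w k)) = (\<integral>\<^sup>+k. ennreal (pmf w k) * 1 \<partial>count_space UNIV)"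
    by (simp add: nn_integral_count_space_nat)
  also have "\<dots> = (\<integral>\<^sup>+k. 1 \<partial>measure_pmf w)"
    by (rule nn_integral_measure_pmf[symmetric])
  finally show ?thesis by simp
qed

lemma mixture_subprob:
  assumes K: "\<And>k. K k \<in> space (subprob_algebra S)"
  shows "sets (mixture w K) = sets S" and "emeasure (mixture w K) (space (mixture w K)) \<le> 1"
proof -
  show sets: "sets (mixture w K) = sets S"
    unfolding mixture_def using K by (intro sets_bind) (auto simp: space_subprob_algebra)
  then have "space (mixture w K) = space S" by (rule sets_eq_imp_space_eq)
  then have "emeasure (mixture w K) (space (mixture w K)) = (\<Sum>k. ennreal (pmf w k) * emeasure (K k) (space S))"
    using K by (simp add: emeasure_mixture[where S = S])
  also have "\<dots> \<le> (\<Sum>k. ennreal (pmf w k) * 1)"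
    using K by (intro suminf_le mult_left_mono summableI)
      (auto simp: space_subprob_algebra subprob_space.subprob_emeasure_le_1)
  finally show "emeasure (mixture w K) (space (mixture w K)) \<le> 1"
    by (simp add: suminf_pmf_nat)
qed

lemma mixture_ge_component:
  assumes "\<And>k. K k \<in> space (subprob_algebra S)" "A \<in> sets S"
  shows "ennreal (pmf w j) * emeasure (K j) A \<le> emeasure (mixture w K) A"
proof -
  have "(\<Sum>k\<in>{j}. ennreal (pmf w k) * emeasure (K k) A) \<le> (\<Sum>k. ennreal (pmf w k) * emeasure (K k) A)"
    by (intro sum_le_suminf) auto
  then show ?thesis by (simp add: emeasure_mixture[OF assms])
qed

text \<open>
  The weights beyond \<open>k0\<close> are summed by \<open>\<Sum> 1 / k\<^sup>2 = pi\<^sup>2 / 6 \<le> 3\<close>.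
\<close>
lemma mixture_le_tail:
  assumes K: "\<And>k. K k \<in> space (subprob_algebra S)" "A \<in> sets S"
    and low: "\<And>k. k \<le> k0 \<Longrightarrow> emeasure (K k) A \<le> t"
    and high: "\<And>k. k0 < k \<Longrightarrow> pmf w k \<le> q / (real k)\<^sup>2" and q: "0 \<le> q"
  shows "emeasure (mixture w K) A \<le> t + ennreal (3 * q)"
proof -
  have basel: "summable (\<lambda>k. q / (real k)\<^sup>2)" "(\<Sum>k. q / (real k)\<^sup>2) \<le> 3 * q"
  proof -
    have "(\<lambda>k. 1 / (real (Suc k))\<^sup>2) sums (pi\<^sup>2 / 6)"
      using inverse_squares_sums by simp
    then have "(\<lambda>k. 1 / (real k)\<^sup>2) sums (pi\<^sup>2 / 6)"
      by (subst (asm) sums_Suc_iff) simp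
    then have s: "(\<lambda>k. q * (1 / (real k)\<^sup>2)) sums (q * (pi\<^sup>2 / 6))"
      by (rule sums_mult)
    then show "summable (\<lambda>k. q / (real k)\<^sup>2)" by (simp add: sums_iff)
    have "pi\<^sup>2 \<le> 4\<^sup>2" using pi_less_4 by (intro power_mono) auto
    then have "q * (pi\<^sup>2 / 6) \<le> q * 3" using q by (intro mult_left_mono) auto
    then show "(\<Sum>k. q / (real k)\<^sup>2) \<le> 3 * q" using s by (simp add: sums_iff)
  qed
  have "emeasure (mixture w K) A = (\<Sum>k. ennreal (pmf w k) * emeasure (K k) A)"
    using K by (rule emeasure_mixture)
  also have "\<dots> \<le> (\<Sum>k. ennreal (pmf w k) * t + ennreal (q / (real k)\<^sup>2))"
  proof (intro suminf_le summableI)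
    fix k
    show "ennreal (pmf w k) * emeasure (K k) A \<le> ennreal (pmf w k) * t + ennreal (q / (real k)\<^sup>2)"
    proof (cases "k \<le> k0")
      case True
      then show ?thesis using low by (intro add_increasing2 mult_left_mono) auto
    next
      case False
      have "ennreal (pmf w k) * emeasure (K k) A \<le> ennreal (q / (real k)\<^sup>2) * 1"
        using high[of k] K False
        by (intro mult_mono ennreal_leI) (auto simp: space_subprob_algebra subprob_space.subprob_emeasure_le_1)
      then show ?thesis by (simp add: add_increasing)
    qed
  qed
  also have "\<dots> = (\<Sum>k. ennreal (pmf w k)) * t + (\<Sum>k. ennreal (q / (real k)\<^sup>2))"
    by (simp add: suminf_add[symmetric])
  also have "(\<Sum>k. ennreal (q / (real k)\<^sup>2)) = ennreal (\<Sum>k. q / (real k)\<^sup>2)"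
    using basel q by (intro suminf_ennreal2) auto
  also have "\<dots> \<le> ennreal (3 * q)" using basel(2) by (rule ennreal_leI)
  finally show ?thesis by (simp add: suminf_pmf_nat add_left_mono)
qed

section \<open>The posterior risk at a fixed sample size\<close>

text \<open>
  The bounds above, put together at a fixed sample size. The loss \<open>exp (6 * s)\<close> in the evidence is
  \<open>exp (2 * s)\<close> for the passage from the truth to its truncation, and \<open>exp (4 * s)\<close> for the passage
  from the truncation to the points of the neighbourhood, where the centring is at most \<open>3 * s\<close> and the deviation \<open>s\<close>.
\<close>
lemma posterior_risk_nonasymptotic:
  assumes S: "parameter_space S" and model: "statistical_model S \<mu> p" and \<theta>0: "\<theta>0 \<in> space S"
    and prior: "sets prior = sets S" "emeasure prior (space prior) \<le> 1"
    and d_meas: "(\<lambda>\<theta>. d \<theta> \<theta>0) \<in> borel_measurable S"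
    and d: "semimetric_on (space S) d" "\<And>\<theta> \<theta>'. \<theta> \<in> space S \<Longrightarrow> \<theta>' \<in> space S \<Longrightarrow> d \<theta> \<theta>' \<le> D"
    and s: "1 \<le> s" and m: "2 \<le> m"
    and approx: "KL \<mu> (p \<theta>0) (p (trunc j \<theta>0)) \<le> ereal s"
      "V m \<mu> (p \<theta>0) (p (trunc j \<theta>0)) \<le> ennreal (s powr (m / 2))"
    and nbhd: "l2_nbhd \<theta>0 j \<rho> \<subseteq> kl_nbhd \<mu> p \<theta>0 m j s"
    and mass: "\<And>A. A \<in> sets S \<Longrightarrow> l2_nbhd \<theta>0 j \<rho> \<subseteq> A \<Longrightarrow> ennreal \<beta> \<le> emeasure prior A" and \<beta>: "0 < \<beta>"
    and rem: "\<And>A. A \<in> sets S \<Longrightarrow> A \<inter> G = {} \<Longrightarrow> emeasure prior A \<le> ennreal \<delta>" and \<delta>: "0 \<le> \<delta>"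
    and test: "\<phi> \<in> borel_measurable \<mu>" "\<And>x. x \<in> space \<mu> \<Longrightarrow> 0 \<le> \<phi> x \<and> \<phi> x \<le> 1"
      "(\<integral>\<^sup>+x. ennreal (\<phi> x) * ennreal (p \<theta>0 x) \<partial>\<mu>) \<le> ennreal e1"
      "\<And>\<theta>. \<theta> \<in> G \<Longrightarrow> R < d \<theta>0 \<theta> \<Longrightarrow> (\<integral>\<^sup>+x. ennreal (1 - \<phi> x) * ennreal (p \<theta> x) \<partial>\<mu>) \<le> ennreal e2"
    and e: "0 \<le> e1" "0 \<le> e2" and R: "0 \<le> R"
  shows "posterior_risk \<mu> p prior d \<theta>0
    \<le> R\<^sup>2 + D\<^sup>2 * (e1 + 3 * s powr (- m / 2) + 2 * exp (6 * s) / \<beta> * (e2 + \<delta>))"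
proof -
  note mod = statistical_modelD[OF model]
  let ?\<theta>1 = "trunc j \<theta>0"
  let ?\<eta> = "ennreal (s powr (- m / 2))"
  have \<theta>1: "?\<theta>1 \<in> space S" by (rule trunc_in_space[OF S])
  have near: "(\<integral>\<^sup>+x. ennreal (p \<theta>0 x) * indicator {x. exp (2 * s) * p ?\<theta>1 x < p \<theta>0 x} x \<partial>\<mu>) \<le> ?\<eta>"
  proof -
    have "(\<integral>\<^sup>+x. ennreal (p \<theta>0 x) * indicator {x. exp (s + s) * p ?\<theta>1 x < p \<theta>0 x} x \<partial>\<mu>) \<le> ?\<eta>"
    proof (rule log_ratio_deviation)
      show "(\<integral>\<^sup>+x. ennreal (p \<theta>0 x) * abs_pow m (log_ratio (p \<theta>0 x) (p ?\<theta>1 x) - KL \<mu> (p \<theta>0) (p ?\<theta>1)) \<partial>\<mu>)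
          \<le> ennreal (s powr (m / 2))"
        using approx(2) unfolding V_def .
    qed (use mod(3,4) \<theta>0 \<theta>1 s m approx(1) in simp_all)
    then show ?thesis by (simp only: mult_2)
  qed
  have U_sub: "l2_nbhd \<theta>0 j \<rho> \<subseteq> space S"
    using sieve_subset_space[OF S] by (auto simp: l2_nbhd_def)
  have far: "(\<integral>\<^sup>+x. ennreal (p \<theta>0 x) * indicator {x. exp (4 * s) * p \<theta> x < p ?\<theta>1 x} x \<partial>\<mu>) \<le> ?\<eta>"
    if \<theta>: "\<theta> \<in> l2_nbhd \<theta>0 j \<rho>" for \<theta>
  proof -
    have \<theta>S: "\<theta> \<in> space S" using \<theta> U_sub by auto
    have kl: "K_tilde \<mu> (p \<theta>0) (p ?\<theta>1) (p \<theta>) \<le> ennreal s"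
      "V_tilde m \<mu> (p \<theta>0) (p ?\<theta>1) (p \<theta>) \<le> ennreal (s powr (m / 2))"
      using \<theta> nbhd by (auto simp: kl_nbhd_def)
    have "KL \<mu> (p ?\<theta>1) (p \<theta>) \<le> ereal (3 * s)"
      by (rule centring_bound[OF _ _ _ mod(5)[OF \<theta>0] s m kl(1)[unfolded K_tilde_def] kl(2)[unfolded V_tilde_def]])
         (use mod(3) \<theta>0 \<theta>1 \<theta>S in auto)
    then have "(\<integral>\<^sup>+x. ennreal (p \<theta>0 x) * indicator {x. exp (3 * s + s) * p \<theta> x < p ?\<theta>1 x} x \<partial>\<mu>) \<le> ?\<eta>"
    proof (rule log_ratio_deviation[rotated 6])
      show "(\<integral>\<^sup>+x. ennreal (p \<theta>0 x) * abs_pow m (log_ratio (p ?\<theta>1 x) (p \<theta> x) - KL \<mu> (p ?\<theta>1) (p \<theta>)) \<partial>\<mu>)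
          \<le> ennreal (s powr (m / 2))"
        using kl(2) unfolding V_tilde_def .
    qed (use mod(3,4) \<theta>0 \<theta>1 \<theta>S s m in simp_all)
    moreover have "3 * s + s = 4 * s" by simp
    ultimately show ?thesis by (simp only:)
  qed
  have fin: "finite_measure prior"
    using prior(2) by (intro finite_measureI) (auto simp: top_unique)
  let ?\<gamma> = "exp (- (2 * s + 4 * s)) * (\<beta> / 2)"
  have ev: "(\<integral>\<^sup>+x. ennreal (p \<theta>0 x) * indicator {x. evidence prior p x < ennreal (?\<gamma> * p \<theta>0 x)} x \<partial>\<mu>) \<le> 3 * ?\<eta>"
    by (rule evidence_lower_bound[OF model prior(1) fin \<theta>0 \<theta>1 near U_sub far mass \<beta>])
  let ?B = "{\<theta> \<in> space S. R < d \<theta> \<theta>0}"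
  have B: "?B \<in> sets S" using d_meas by measurable
  have sym: "d \<theta> \<theta>0 = d \<theta>0 \<theta>" if "\<theta> \<in> space S" for \<theta>
    using d(1) that \<theta>0 by (simp add: semimetric_on_def)
  have "(\<integral>\<^sup>+x. ennreal (p \<theta>0 x) * emeasure (posterior prior p x) ?B \<partial>\<mu>)
      \<le> ennreal e1 + 3 * ?\<eta> + ennreal (1 / ?\<gamma>) * (ennreal e2 + ennreal \<delta>)"
  proof (rule posterior_mass_bound[OF model prior \<theta>0 B test(1-3) _ rem ev])
    fix \<theta> assume "\<theta> \<in> ?B" "\<theta> \<in> G"
    then show "(\<integral>\<^sup>+x. ennreal (1 - \<phi> x) * ennreal (p \<theta> x) \<partial>\<mu>) \<le> ennreal e2"
      using test(4) sym by auto
  qed (use \<beta> in auto)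
  also have "\<dots> = ennreal (e1 + 3 * s powr (- m / 2) + 1 / ?\<gamma> * (e2 + \<delta>))"
  proof -
    have "3 * ?\<eta> = ennreal (3 * s powr (- m / 2))"
      by (subst ennreal_mult) (simp_all add: ennreal_numeral)
    moreover have "ennreal (1 / ?\<gamma>) * (ennreal e2 + ennreal \<delta>) = ennreal (1 / ?\<gamma> * (e2 + \<delta>))"
    proof -
      have "0 \<le> 1 / ?\<gamma>" "0 \<le> e2 + \<delta>" using e \<delta> \<beta> by auto
      then show ?thesis
        unfolding ennreal_plus[OF e(2) \<delta>, symmetric] by (rule ennreal_mult[symmetric])
    qed
    moreover have "0 \<le> 1 / ?\<gamma> * (e2 + \<delta>)"
      using e \<delta> \<beta> by (intro mult_nonneg_nonneg) auto
    ultimately show ?thesis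
      using e by (simp only: ennreal_plus add_nonneg_nonneg mult_nonneg_nonneg powr_ge_zero zero_le_numeral)
  qed
  also have "1 / ?\<gamma> = 2 * exp (6 * s) / \<beta>"
    by (simp add: exp_minus field_simps)
  finally have "(\<integral>\<^sup>+x. ennreal (p \<theta>0 x) * emeasure (posterior prior p x) ?B \<partial>\<mu>)
      \<le> ennreal (e1 + 3 * s powr (- m / 2) + 2 * exp (6 * s) / \<beta> * (e2 + \<delta>))" .
  note post = this
  show ?thesis
  proof (rule posterior_risk_le[where S = S and d = d, OF model prior \<theta>0 d_meas _ R _ post])
    show "0 \<le> d \<theta> \<theta>0 \<and> d \<theta> \<theta>0 \<le> D" if "\<theta> \<in> space S" for \<theta>
      using d that \<theta>0 by (simp add: semimetric_on_def)
    have "0 \<le> 2 * exp (6 * s) / \<beta> * (e2 + \<delta>)"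
      using e \<delta> \<beta> by (intro mult_nonneg_nonneg) auto
    then show "0 \<le> e1 + 3 * s powr (- m / 2) + 2 * exp (6 * s) / \<beta> * (e2 + \<delta>)"
      using e by (intro add_nonneg_nonneg) auto
  qed
qed

section \<open>Growth of the sieve dimensions\<close>

text \<open>
  A form of the growth conditions on \<open>\<epsilon>\<close> that can be combined pointwise in \<open>n\<close>.
\<close>
lemma rate_eventually:
  assumes "rate \<epsilon>" "0 < (c::real)"
  shows "\<forall>\<^sub>F n in sequentially. 1 \<le> ln (real n) \<and> c * ln (real n) \<le> real n * (\<epsilon> n)\<^sup>2 \<and> (\<epsilon> n)\<^sup>2 * c \<le> 1"
proof -
  have lim: "filterlim (\<lambda>n. real n * (\<epsilon> n)\<^sup>2 / ln (real n)) at_top sequentially" and e0: "\<epsilon> \<longlonglongrightarrow> 0"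
    using assms by (auto simp: rate_def)
  have "(\<lambda>n. (\<epsilon> n)\<^sup>2 * c) \<longlonglongrightarrow> 0\<^sup>2 * c"
    by (intro tendsto_intros e0)
  then have "\<forall>\<^sub>F n in sequentially. (\<epsilon> n)\<^sup>2 * c < 1"
    by (rule order_tendstoD) simp
  moreover have "\<forall>\<^sub>F n in sequentially. c \<le> real n * (\<epsilon> n)\<^sup>2 / ln (real n)"
    using lim by (simp add: filterlim_at_top)
  moreover have "\<forall>\<^sub>F n in sequentially. 1 \<le> ln (real n)"
    using filterlim_compose[OF ln_at_top filterlim_real_sequentially] by (simp add: filterlim_at_top)
  ultimately show ?thesis
    by eventually_elim (auto simp: field_simps)
qed

lemma rate_sample_information_at_top:
  assumes "rate \<epsilon>"
  shows "filterlim (\<lambda>n. real n * (\<epsilon> n)\<^sup>2) at_top sequentially"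
proof (rule filterlim_at_top_mono)
  show "filterlim (\<lambda>n. ln (real n)) at_top sequentially"
    by (rule filterlim_compose[OF ln_at_top filterlim_real_sequentially])
  show "\<forall>\<^sub>F n in sequentially. ln (real n) \<le> real n * (\<epsilon> n)\<^sup>2"
    using rate_eventually[OF assms zero_less_one] by eventually_elim simp
qed

lemma nat_floor_ge_half: "x / 2 \<le> real (nat \<lfloor>x\<rfloor>)" if "1 \<le> x" for x :: real
proof -
  have "1 \<le> \<lfloor>x\<rfloor>" using that by (simp add: le_floor_iff)
  then have "real (nat \<lfloor>x\<rfloor>) = of_int \<lfloor>x\<rfloor>" by simp
  moreover have "1 \<le> real_of_int \<lfloor>x\<rfloor>" using \<open>1 \<le> \<lfloor>x\<rfloor>\<close> by simp
  ultimately show ?thesis using floor_correct[of x] by linarith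
qed

text \<open>
  The dimension \<open>j\<close> is chosen so that \<open>j ln n\<close> has the order of \<open>n \<epsilon>\<^sub>n\<^sup>2\<close>.
\<close>
lemma jn_bounds:
  assumes "rate \<epsilon>" "0 < j0"
  shows "\<forall>\<^sub>F n in sequentially. 1 \<le> jn j0 \<epsilon> n \<and> jn j0 \<epsilon> n \<le> n \<and>
    j0 * (real n * (\<epsilon> n)\<^sup>2) / 2 \<le> real (jn j0 \<epsilon> n) * ln (real n) \<and>
    real (jn j0 \<epsilon> n) * ln (real n) \<le> j0 * (real n * (\<epsilon> n)\<^sup>2)"
  using rate_eventually[OF assms] rate_eventually[OF assms(1) divide_pos_pos[OF zero_less_one assms(2)]]
proof eventually_elim
  case (elim n)
  have l: "1 \<le> ln (real n)" using elim by blast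
  define x where "x = j0 * real n * (\<epsilon> n)\<^sup>2 / ln (real n)"
  have "1 \<le> x"
    using elim assms(2) l by (simp add: x_def field_simps)
  have j: "jn j0 \<epsilon> n = nat \<lfloor>x\<rfloor>" by (simp add: jn_def x_def)
  have up: "real (jn j0 \<epsilon> n) \<le> x"
    using \<open>1 \<le> x\<close> unfolding j by (simp add: of_nat_nat)
  have low: "x / 2 \<le> real (jn j0 \<epsilon> n)"
    unfolding j by (rule nat_floor_ge_half[OF \<open>1 \<le> x\<close>])
  have "x * ln (real n) = j0 * (real n * (\<epsilon> n)\<^sup>2)"
    using l by (simp add: x_def)
  moreover have "x \<le> real n"
  proof -
    have "x \<le> x * ln (real n)" using \<open>1 \<le> x\<close> l by simp
    also have "\<dots> = real n * ((\<epsilon> n)\<^sup>2 * j0)" using l by (simp add: x_def)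
    also have "\<dots> \<le> real n * 1" using elim by (intro mult_left_mono) auto
    finally show ?thesis by simp
  qed
  moreover have "1 \<le> jn j0 \<epsilon> n"
    using \<open>1 \<le> x\<close> unfolding j by (simp add: le_nat_floor)
  ultimately show ?case
    using up low mult_right_mono[OF up, of "ln (real n)"] mult_right_mono[OF low, of "ln (real n)"] l
    by (auto simp: field_simps)
qed

lemma jn_at_top:
  assumes "rate \<epsilon>" "0 < j0"
  shows "filterlim (\<lambda>n. real (jn j0 \<epsilon> n)) at_top sequentially"
proof (rule filterlim_at_top_mono)
  have "filterlim (\<lambda>n. real n * (\<epsilon> n)\<^sup>2 / ln (real n)) at_top sequentially"
    using assms by (simp add: rate_def)
  then show "filterlim (\<lambda>n. j0 / 2 * (real n * (\<epsilon> n)\<^sup>2 / ln (real n))) at_top sequentially"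
    using assms(2) by (intro filterlim_tendsto_pos_mult_at_top[OF tendsto_const]) auto
  show "\<forall>\<^sub>F n in sequentially. j0 / 2 * (real n * (\<epsilon> n)\<^sup>2 / ln (real n)) \<le> real (jn j0 \<epsilon> n)"
    using jn_bounds[OF assms] rate_eventually[OF assms]
  proof eventually_elim
    case (elim n)
    then have "0 < ln (real n)" by linarith
    with elim show ?case by (simp add: field_simps)
  qed
qed

lemma kn_bounds:
  assumes "rate \<epsilon>" "0 < j0" "1 \<le> M0" "slowly_varying L" "\<forall>\<^sub>F x in at_top. L x \<le> ln x"
  shows "\<forall>\<^sub>F n in sequentially. 0 < L (real n) \<and> L (real n) \<le> ln (real n) \<and>
    jn j0 \<epsilon> n \<le> kn M0 j0 L \<epsilon> n \<and>
    M0 * real (jn j0 \<epsilon> n) * ln (real n) / 2 \<le> real (kn M0 j0 L \<epsilon> n) * L (real n) \<and>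
    real (kn M0 j0 L \<epsilon> n) * L (real n) \<le> M0 * real (jn j0 \<epsilon> n) * ln (real n)"
proof -
  have "\<forall>\<^sub>F x in at_top. 0 < L x" using assms(4) by (simp add: slowly_varying_def)
  from eventually_conj[OF this assms(5)]
  have "\<forall>\<^sub>F n in sequentially. 0 < L (real n) \<and> L (real n) \<le> ln (real n)"
    by (rule eventually_compose_filterlim[OF _ filterlim_real_sequentially])
  with jn_bounds[OF assms(1,2)] show ?thesis
  proof eventually_elim
    case (elim n)
    define x where "x = M0 * real (jn j0 \<epsilon> n) * ln (real n) / L (real n)"
    have k: "kn M0 j0 L \<epsilon> n = nat \<lfloor>x\<rfloor>" by (simp add: kn_def x_def)
    have L: "0 < L (real n)" "L (real n) \<le> ln (real n)" using elim by auto
    have xL: "x * L (real n) = M0 * real (jn j0 \<epsilon> n) * ln (real n)"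
      using L by (simp add: x_def)
    have "real (jn j0 \<epsilon> n) * 1 \<le> (M0 * real (jn j0 \<epsilon> n)) * (ln (real n) / L (real n))"
      using assms(3) L by (intro mult_mono) (auto simp: mult_le_cancel_right1)
    then have jx: "real (jn j0 \<epsilon> n) \<le> x" by (simp add: x_def)
    then have "1 \<le> x" using elim by auto
    have "real (nat \<lfloor>x\<rfloor>) \<le> x" using \<open>1 \<le> x\<close> by (simp add: of_nat_nat)
    then have "real (kn M0 j0 L \<epsilon> n) * L (real n) \<le> x * L (real n)"
      unfolding k using L by (intro mult_right_mono) auto
    moreover have "x / 2 * L (real n) \<le> real (kn M0 j0 L \<epsilon> n) * L (real n)"
      unfolding k using L nat_floor_ge_half[OF \<open>1 \<le> x\<close>] by (intro mult_right_mono) auto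
    moreover have "jn j0 \<epsilon> n \<le> kn M0 j0 L \<epsilon> n"
      unfolding k using jx by (rule le_nat_floor)
    ultimately show ?case using L xL by auto
  qed
qed

text \<open>
  The Potter bound gives \<open>L n \<ge> c / sqrt n\<close>, whence \<open>k\<^sub>n = O(n * sqrt n)\<close>.
\<close>
lemma kn_polynomial:
  assumes "rate \<epsilon>" "0 < j0" "1 \<le> M0" "slowly_varying L" "\<forall>\<^sub>F x in at_top. L x \<le> ln x"
  shows "\<forall>\<^sub>F n in sequentially. real (kn M0 j0 L \<epsilon> n) \<le> (real n)\<^sup>2"
proof -
  obtain X where X: "0 < X" "\<And>x. x \<ge> X \<Longrightarrow> 0 < L x"
    "\<And>x y. x \<ge> X \<Longrightarrow> y \<ge> x \<Longrightarrow> exp (- 1 / 2) * sqrt (x / y) * L x \<le> L y"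
    using slowly_varying_Potter_lower[OF assms(4)] by metis
  define c where "c = exp (- 1 / 2) * sqrt X * L X"
  have c: "0 < c" using X by (simp add: c_def)
  have "\<forall>\<^sub>F n in sequentially. X \<le> real n"
    using filterlim_real_sequentially by (simp add: filterlim_at_top)
  moreover have "\<forall>\<^sub>F n in sequentially. (M0 * j0 / c)\<^sup>2 \<le> real n"
    using filterlim_real_sequentially by (simp add: filterlim_at_top)
  ultimately show ?thesis
    using kn_bounds[OF assms] jn_bounds[OF assms(1,2)] rate_eventually[OF assms(1) zero_less_one]
  proof eventually_elim
    case (elim n)
    have n: "0 < real n" using elim X by linarith
    have "c / sqrt (real n) = exp (- 1 / 2) * sqrt (X / real n) * L X"
      by (simp add: c_def real_sqrt_divide)
    also have "\<dots> \<le> L (real n)" using elim by (intro X) auto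
    finally have low: "c / sqrt (real n) \<le> L (real n)" .
    have "real (kn M0 j0 L \<epsilon> n) * (c / sqrt (real n)) \<le> real (kn M0 j0 L \<epsilon> n) * L (real n)"
      using low by (intro mult_left_mono) auto
    also have "\<dots> \<le> M0 * (real (jn j0 \<epsilon> n) * ln (real n))" using elim by (simp add: mult.assoc)
    also have "\<dots> \<le> M0 * (j0 * (real n * (\<epsilon> n)\<^sup>2))"
      using elim assms(3) by (intro mult_left_mono) auto
    also have "\<dots> \<le> M0 * (j0 * (real n * 1))"
      using elim assms(2,3) by (intro mult_left_mono) auto
    finally have "real (kn M0 j0 L \<epsilon> n) \<le> (M0 * j0 / c) * (real n * sqrt (real n))"
      using c n by (simp add: field_simps)
    also have "\<dots> \<le> sqrt (real n) * (real n * sqrt (real n))"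
    proof (rule mult_right_mono)
      show "M0 * j0 / c \<le> sqrt (real n)"
        using elim by (intro real_le_rsqrt) auto
    qed simp
    also have "\<dots> = (real n)\<^sup>2" by (simp add: power2_eq_square)
    finally show ?case .
  qed
qed

text \<open>
  By the Potter bound, \<open>k L(k)\<close> is at least of the order of \<open>sqrt (k / K) K L(K)\<close> for \<open>k \<ge> K = k\<^sub>n\<close>, and
  \<open>K L(K) \<ge> K L(n) / \<Lambda>\<close> is at least a constant times \<open>M0 n \<epsilon>\<^sub>n\<^sup>2\<close>. With \<open>M0\<close> large, half of the
  exponent gives \<open>exp (- B n \<epsilon>\<^sub>n\<^sup>2)\<close>, while the other half outweighs \<open>2 ln k\<close>, because \<open>n \<epsilon>\<^sub>n\<^sup>2\<close> dominates
  \<open>ln n\<close>, and gives the summable factor.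
\<close>
lemma prior_weights_tail:
  assumes rate: "rate \<epsilon>" and j0: "0 < j0" and M0: "1 \<le> M0" and L: "slowly_varying L" "\<forall>\<^sub>F x in at_top. L x \<le> ln x"
    and Lk: "\<forall>\<^sub>F n in sequentially. L (real n) \<le> \<Lambda> * L (real (kn M0 j0 L \<epsilon> n))" and \<Lambda>: "0 < \<Lambda>"
    and w: "weight_condition w L a b" and b: "0 < b"
    and B: "1 \<le> B" "16 * \<Lambda> * B / (b * j0) \<le> M0"
  shows "\<forall>\<^sub>F n in sequentially. \<forall>k>kn M0 j0 L \<epsilon> n.
    pmf (w n) k \<le> exp (- B * (real n * (\<epsilon> n)\<^sup>2)) / (real k)\<^sup>2"
proof -
  obtain X where X: "0 < X" "\<And>x. x \<ge> X \<Longrightarrow> 0 < L x"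
    "\<And>x y. x \<ge> X \<Longrightarrow> y \<ge> x \<Longrightarrow> exp (- 1 / 2) * sqrt (x / y) * L x \<le> L y"
    using slowly_varying_Potter_lower[OF L(1)] by metis
  have "\<forall>\<^sub>F n in sequentially. X \<le> real (jn j0 \<epsilon> n)"
    using jn_at_top[OF rate j0] by (simp add: filterlim_at_top)
  then show ?thesis
    using kn_bounds[OF rate j0 M0 L] jn_bounds[OF rate j0] rate_eventually[OF rate, of 8, OF zero_less_numeral]
      kn_polynomial[OF rate j0 M0 L] Lk w[unfolded weight_condition_def]
  proof eventually_elim
    case (elim n)
    define K where "K = kn M0 j0 L \<epsilon> n"
    define s where "s = real n * (\<epsilon> n)\<^sup>2"
    have K: "X \<le> real K" "1 \<le> K" using elim by (auto simp: K_def)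
    have s: "8 * ln (real n) \<le> s" "1 \<le> ln (real n)" using elim by (auto simp: s_def)
    have y: "2 * B * s \<le> b * exp (- 1 / 2) * (real K * L (real K))"
    proof -
      have "M0 * (j0 * s / 2) / 2 \<le> M0 * (real (jn j0 \<epsilon> n) * ln (real n)) / 2"
        using elim M0 by (intro divide_right_mono mult_left_mono) (auto simp: s_def)
      also have "\<dots> \<le> real K * L (real n)" using elim by (simp add: K_def mult.assoc)
      also have "\<dots> \<le> real K * (\<Lambda> * L (real K))" using elim by (intro mult_left_mono) (auto simp: K_def)
      finally have "M0 * j0 * s / (4 * \<Lambda>) \<le> real K * L (real K)"
        using \<Lambda> by (simp add: field_simps)
      moreover have half: "1 / 2 \<le> exp (- 1 / 2 :: real)"
        using exp_ge_add_one_self[of "- 1 / 2 :: real"] by simp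
      ultimately have "b * (1 / 2) * (M0 * j0 * s / (4 * \<Lambda>)) \<le> b * exp (- 1 / 2) * (real K * L (real K))"
        using b \<Lambda> M0 j0 s by (intro mult_mono mult_nonneg_nonneg divide_nonneg_pos) auto
      moreover have "16 * \<Lambda> * B * s \<le> M0 * (b * j0) * s"
        using B(2) b j0 s by (intro mult_right_mono) (auto simp: field_simps)
      then have "2 * B * s \<le> b * (1 / 2) * (M0 * j0 * s / (4 * \<Lambda>))"
        using \<Lambda> by (simp add: field_simps)
      ultimately show ?thesis by linarith
    qed
    show ?case
    proof (intro allI impI)
      fix k assume "kn M0 j0 L \<epsilon> n < k"
      then have k: "K < k" by (simp add: K_def)
      (* The exponent gains the factor \<open>k / K = t\<^sup>2\<close> from \<open>k\<close> and loses \<open>t\<close> through \<open>L\<close>. *)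
      define t where "t = sqrt (real k / real K)"
      have t: "1 \<le> t" using k K by (simp add: t_def)
      have tt: "real k = real K * (t * t)" using K by (simp add: t_def)
      have inv: "sqrt (real K / real k) = 1 / t"
        by (simp add: t_def real_sqrt_divide)
      have "real k * (exp (- 1 / 2) * sqrt (real K / real k) * L (real K)) \<le> real k * L (real k)"
        using X(3)[OF K(1), of "real k"] k by (intro mult_left_mono) auto
      also have "real k * (exp (- 1 / 2) * sqrt (real K / real k) * L (real K))
          = exp (- 1 / 2) * (real K * L (real K)) * t"
        unfolding inv using t by (subst tt) simp
      finally have "b * (exp (- 1 / 2) * (real K * L (real K)) * t) \<le> b * (real k * L (real k))"
        using b by (intro mult_left_mono) auto
      moreover have "2 * B * s * t \<le> b * exp (- 1 / 2) * (real K * L (real K)) * t"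
        using y t by (intro mult_right_mono) auto
      ultimately have big: "2 * B * s * t \<le> b * (real k * L (real k))" by (simp add: mult.assoc)
      have "ln (real k) = ln (real K) + 2 * ln t"
        using K t by (subst tt) (simp add: ln_mult)
      also have "ln (real K) \<le> ln ((real n)\<^sup>2)"
        using elim K by (subst ln_le_cancel_iff) (auto simp: K_def)
      also have "ln ((real n)\<^sup>2) = 2 * ln (real n)"
        by (cases "n = 0") (simp_all add: ln_realpow)
      also have "ln t \<le> t" using t ln_le_minus_one[of t] by simp
      finally have "2 * ln (real k) \<le> 4 * ln (real n) + 4 * t" by simp
      also have "\<dots> \<le> 4 * ln (real n) * t + 4 * ln (real n) * t"
        using t s(2) by (intro add_mono mult_right_mono) auto
      also have "\<dots> = 8 * ln (real n) * t" by simp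
      also have "\<dots> \<le> s * t" using s(1) t by (intro mult_right_mono) auto
      also have "s * t \<le> B * (s * t)" 
      proof -
        have "0 \<le> s * t" using s t by (intro mult_nonneg_nonneg) linarith+
        from mult_right_mono[OF B(1) this] show ?thesis by simp
      qed
      finally have lnk: "2 * ln (real k) \<le> B * (s * t)" .
      have "B * s * 1 \<le> B * s * t" using B(1) s t by (intro mult_left_mono) auto
      then have "B * s + 2 * ln (real k) \<le> b * (real k * L (real k))"
        using big lnk by (simp add: algebra_simps)
      then have "exp (- b * real k * L (real k)) \<le> exp (- B * s - 2 * ln (real k))"
        by (simp add: mult.assoc)
      also have "\<dots> = exp (- B * s) / (real k)\<^sup>2"
        using k by (simp add: exp_diff exp_double)
      finally show "pmf (w n) k \<le> exp (- B * (real n * (\<epsilon> n)\<^sup>2)) / (real k)\<^sup>2"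
        using elim(7)[rule_format, of k] k unfolding s_def by linarith
    qed
  qed
qed

text \<open>
  Each of the \<open>j\<close> factors of the box mass is a power of \<open>n\<close>, and the exponent controlled by
  \<open>scale_condition\<close> is also of the order of \<open>j ln n\<close>.
\<close>
lemma box_mass_lower_bound:
  fixes j n :: nat
  assumes n: "1 \<le> ln (real n)" and G1: "1 / real n \<le> 2 * G1 / \<tau>0" and G2: "0 \<le> G2"
    and sum: "\<Sigma> \<le> C * real j * ln (real n)"
  shows "exp (- (h + 1 + G2 * 2 powr \<alpha> * (\<bar>C\<bar> + 1)) * (real j * ln (real n)))
    \<le> (2 * real n powr (- h) * G1 / \<tau>0) ^ j * exp (- G2 * 2 powr \<alpha> * (\<Sigma> + real j))"
proof -
  define l where "l = ln (real n)"
  have n0: "0 < real n" using n by (cases n) auto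
  have "exp (- (h + 1) * l) = real n powr (- h) * (1 / real n)"
    using n0 by (simp add: powr_def l_def exp_minus algebra_simps exp_diff divide_inverse)
  also have "\<dots> \<le> real n powr (- h) * (2 * G1 / \<tau>0)"
    using G1 by (intro mult_left_mono) auto
  finally have "exp (- (h + 1) * l) ^ j \<le> (2 * real n powr (- h) * G1 / \<tau>0) ^ j"
    by (intro power_mono) (simp_all add: ac_simps)
  then have 1: "exp (- (h + 1) * (real j * l)) \<le> (2 * real n powr (- h) * G1 / \<tau>0) ^ j"
    by (simp add: exp_of_nat_mult[symmetric] algebra_simps)
  have "\<Sigma> \<le> \<bar>C\<bar> * (real j * l)"
  proof -
    have "C * (real j * l) \<le> \<bar>C\<bar> * (real j * l)"
      using n by (intro mult_right_mono) (auto simp: l_def)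
    then show ?thesis using sum by (simp add: l_def mult.assoc)
  qed
  moreover have "real j * 1 \<le> real j * l" using n by (intro mult_left_mono) (auto simp: l_def)
  ultimately have "\<Sigma> + real j \<le> (\<bar>C\<bar> + 1) * (real j * l)" by (simp add: algebra_simps)
  then have "G2 * 2 powr \<alpha> * (\<Sigma> + real j) \<le> G2 * 2 powr \<alpha> * ((\<bar>C\<bar> + 1) * (real j * l))"
    using G2 by (intro mult_left_mono) auto
  then have 2: "exp (- G2 * 2 powr \<alpha> * ((\<bar>C\<bar> + 1) * (real j * l))) \<le> exp (- G2 * 2 powr \<alpha> * (\<Sigma> + real j))"
    by simp
  have "exp (- (h + 1 + G2 * 2 powr \<alpha> * (\<bar>C\<bar> + 1)) * (real j * l))
      = exp (- (h + 1) * (real j * l)) * exp (- G2 * 2 powr \<alpha> * ((\<bar>C\<bar> + 1) * (real j * l)))"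
    by (simp add: exp_add[symmetric] algebra_simps)
  also have "\<dots> \<le> (2 * real n powr (- h) * G1 / \<tau>0) ^ j * exp (- G2 * 2 powr \<alpha> * (\<Sigma> + real j))"
    using order_trans[OF exp_ge_zero 1] by (intro mult_mono 1 2) auto
  finally show ?thesis by (simp add: l_def)
qed

section \<open>Prior masses and tests for large samples\<close>

text \<open>
  The box has half side \<open>n powr (- (H1 + H2 + 4))\<close>: small enough to be below the scales of its
  coordinates and to stay in the neighbourhood. For the truncated prior the truth may lie on the boundary
  of the \<open>l\<^sup>1\<close> ball, so that a box centred at it would leave the support. Its centre is therefore shrunk by
  the factor \<open>1 - n powr (- (H1 + 2))\<close>, which frees more room than the box takes
  and moves the centre by less than the radius of the neighbourhood.
\<close>
lemma eventually_component_nbhd_mass: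
  fixes g :: "nat \<Rightarrow> real \<Rightarrow> real" and \<tau> :: "nat \<Rightarrow> nat \<Rightarrow> real"
  assumes S: "parameter_space S"
    and components: "\<forall>n\<ge>1. prob_density (g n) \<and> (\<forall>i. 0 < \<tau> n i)"
    and K: "(\<forall>n\<ge>1. K n = component S (g n) (\<tau> n)) \<or>
      (\<exists>r1>0. (\<forall>k. (\<Sum>i<k. \<bar>\<theta>0 i\<bar>) \<le> r1) \<and> (\<forall>n\<ge>1. K n = truncated_component r1 S (g n) (\<tau> n)))"
    and j: "\<forall>\<^sub>F n in sequentially. j n \<le> n \<and> j n \<le> k n"
    and tail: "tail_condition g G1 G2 G3 G4 \<alpha>" and scale: "scale_condition \<tau> \<theta>0 j k \<alpha> \<tau>0 H2 C"
    and pos: "0 < H1" "0 < H2" "0 < G1" "0 < G2" "0 < \<alpha>" "0 < \<tau>0"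
  shows "\<forall>\<^sub>F n in sequentially. \<forall>A\<in>sets S. l2_nbhd \<theta>0 (j n) (real n powr (- H1)) \<subseteq> A \<longrightarrow>
    ennreal (exp (- (H1 + H2 + 4 + 1 + G2 * 2 powr \<alpha> * (\<bar>C\<bar> + 1)) * (real (j n) * ln (real n))))
      \<le> emeasure (K n (j n)) A"
proof -
  have comp: "\<And>n. n \<ge> 1 \<Longrightarrow> prob_density (g n)" "\<And>n i. n \<ge> 1 \<Longrightarrow> 0 < \<tau> n i"
    using components by auto
  have large: "\<forall>\<^sub>F n in sequentially. x \<le> real n" for x
    using filterlim_real_sequentially by (simp add: filterlim_at_top)
  obtain r where r: "0 < r"
    and K': "(\<forall>n\<ge>1. K n = component S (g n) (\<tau> n)) \<or>
      ((\<forall>k. (\<Sum>i<k. \<bar>\<theta>0 i\<bar>) \<le> r) \<and> (\<forall>n\<ge>1. K n = truncated_component r S (g n) (\<tau> n)))"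
    using K by (metis zero_less_one)
  show ?thesis
    using j large[of 1] large[of "exp 1"] large[of "\<tau>0 / (2 * G1)"] large[of "1 + r"] large[of "1 / r"]
      tail[unfolded tail_condition_def] scale[unfolded scale_condition_def]
  proof eventually_elim
    case (elim n)
    define N where "N = real n"
    define h where "h = H1 + H2 + 4"
    define \<delta> where "\<delta> = N powr (- h)"
    have n1: "1 \<le> n" and N1: "1 \<le> N" using elim(2) by (auto simp: N_def)
    have ln1: "1 \<le> ln N" using elim(3) N1 by (simp add: N_def ln_ge_iff)
    have \<delta>0: "0 < \<delta>" using N1 by (simp add: \<delta>_def)
    have G1: "1 / real n \<le> 2 * G1 / \<tau>0"
      using elim(4) pos N1 by (simp add: N_def field_simps)
    have powr_le: "N powr x \<le> N powr y" if "x \<le> y" for x y using that N1 by (intro powr_mono) auto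
    have times_N: "N * N powr x = N powr (x + 1)" for x using N1 by (simp add: powr_add)
    have \<delta>_le: "\<delta> \<le> \<tau> n i" if "i < j n" for i
    proof -
      have "\<delta> \<le> N powr (- H2)" unfolding \<delta>_def using pos by (intro powr_le) (simp add: h_def)
      also have "\<dots> \<le> \<tau> n i" using elim that by (auto simp: N_def)
      finally show ?thesis .
    qed
    have j\<delta>: "real (j n) * \<delta> \<le> N powr (1 - h)"
    proof -
      have "real (j n) * \<delta> \<le> N * \<delta>" using elim \<delta>0 by (intro mult_right_mono) (auto simp: N_def)
      then show ?thesis by (simp add: \<delta>_def times_N)
    qed
    define target where "target = ennreal (exp (- (H1 + H2 + 4 + 1 + G2 * 2 powr \<alpha> * (\<bar>C\<bar> + 1))
      * (real (j n) * ln (real n))))"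
    have box: "target \<le> emeasure (coord_prior (g n) (\<tau> n) (j n)) (\<Pi>\<^sub>E i\<in>{..<j n}. {c i - \<delta>..c i + \<delta>})"
      if c: "\<And>i. i < j n \<Longrightarrow> \<bar>c i\<bar> \<le> \<bar>\<theta>0 i\<bar>" for c
    proof -
      let ?sum = "\<Sum>i<j n. \<bar>\<theta>0 i\<bar> powr \<alpha> / \<tau> n i powr \<alpha>"
      have "target \<le> ennreal ((2 * \<delta> * G1 / \<tau>0) ^ j n * exp (- G2 * 2 powr \<alpha> * (?sum + real (j n))))"
        unfolding target_def \<delta>_def h_def N_def
        using ln1 G1 pos elim by (intro ennreal_leI box_mass_lower_bound) (auto simp: N_def)
      also have "\<dots> \<le> emeasure (coord_prior (g n) (\<tau> n) (j n)) (\<Pi>\<^sub>E i\<in>{..<j n}. {c i - \<delta>..c i + \<delta>})"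
        using comp n1 elim pos \<delta>0 \<delta>_le c by (intro coord_prior_box_lower) auto
      finally show ?thesis .
    qed
    show ?case
    proof (intro ballI impI)
      fix A assume A: "A \<in> sets S" and sub: "l2_nbhd \<theta>0 (j n) (real n powr (- H1)) \<subseteq> A"
      have "target \<le> emeasure (K n (j n)) A"
        using K'
      proof (elim disjE conjE)
        assume Kn: "\<forall>n\<ge>1. K n = component S (g n) (\<tau> n)"
        have "real (j n) * (0 + \<delta>) \<le> real n powr (- H1)"
          using order_trans[OF j\<delta> powr_le[of "1 - h" "- H1"]] pos by (simp add: h_def N_def)
        then have "trunc (j n) \<theta> \<in> A" if "\<theta> \<in> (\<Pi>\<^sub>E i\<in>{..<j n}. {\<theta>0 i - \<delta>..\<theta>0 i + \<delta>})" for \<theta>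
          using trunc_box_in_l2_nbhd[OF that, of \<theta>0 0] sub by auto
        then have "emeasure (coord_prior (g n) (\<tau> n) (j n)) (\<Pi>\<^sub>E i\<in>{..<j n}. {\<theta>0 i - \<delta>..\<theta>0 i + \<delta>})
            \<le> emeasure (component S (g n) (\<tau> n) (j n)) A"
          by (rule component_box_le[OF S A])
        then show ?thesis using box[of \<theta>0] Kn n1 by (auto intro: order_trans)
      next
        assume Kn: "\<forall>n\<ge>1. K n = truncated_component r S (g n) (\<tau> n)"
          and l1: "\<forall>k. (\<Sum>i<k. \<bar>\<theta>0 i\<bar>) \<le> r"
        (* Shrinking by \<open>q\<close> frees \<open>q * r\<close> of the \<open>l\<^sup>1\<close> norm, more than the \<open>j n * \<delta>\<close> that the box adds. *)
        define q where "q = N powr (- (H1 + 2))"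
        have q: "0 < q" "q \<le> 1" using N1 pos powr_le[of "- (H1 + 2)" 0] by (auto simp: q_def)
        define c where "c i = (1 - q) * \<theta>0 i" for i
        have \<theta>0_r: "\<bar>\<theta>0 i\<bar> \<le> r" for i
          using order_trans[OF member_le_sum[of i "{..<Suc i}" "\<lambda>i. \<bar>\<theta>0 i\<bar>"] l1[rule_format, of "Suc i"]] by simp
        have c_abs: "\<bar>c i\<bar> = (1 - q) * \<bar>\<theta>0 i\<bar>" for i using q by (simp add: c_def abs_mult)
        have c_le: "\<bar>c i\<bar> \<le> \<bar>\<theta>0 i\<bar>" for i
          unfolding c_abs using q by (simp add: mult_left_le_one_le)
        have near: "\<bar>\<theta>0 i - c i\<bar> \<le> q * r" for i
        proof -
          have "\<theta>0 i - c i = q * \<theta>0 i" by (simp add: c_def algebra_simps)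
          then show ?thesis using q \<theta>0_r[of i] by (simp add: abs_mult)
        qed
        have rad: "real (j n) * (q * r + \<delta>) \<le> real n powr (- H1)"
        proof -
          have "real (j n) * (q * r) \<le> N * (q * r)"
            using elim q r by (intro mult_right_mono) (auto simp: N_def)
          also have "\<dots> = N powr (- H1 - 1) * r"
          proof -
            have "- (H1 + 2) + 1 = - H1 - 1" by simp
            then show ?thesis by (simp only: q_def mult.assoc[symmetric] times_N)
          qed
          finally have "real (j n) * (q * r + \<delta>) \<le> N powr (- H1 - 1) * r + N powr (1 - h)"
            using j\<delta> by (simp add: distrib_left)
          also have "\<dots> \<le> N powr (- H1 - 1) * r + N powr (- H1 - 1) * 1"
            using powr_le[of "1 - h" "- H1 - 1"] pos by (simp add: h_def)
          also have "\<dots> = N powr (- H1 - 1) * (1 + r)" by (simp add: algebra_simps)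
          also have "\<dots> \<le> N powr (- H1 - 1) * N" using elim by (intro mult_left_mono) (auto simp: N_def)
          also have "\<dots> = N powr (- H1)" using times_N[of "- H1 - 1"] by (simp add: mult.commute)
          finally show ?thesis by (simp add: N_def)
        qed
        have "trunc (j n) \<theta> \<in> A" if "\<theta> \<in> (\<Pi>\<^sub>E i\<in>{..<j n}. {c i - \<delta>..c i + \<delta>})" for \<theta>
          using trunc_box_in_l2_nbhd[OF that near rad] sub by auto
        moreover have "(\<Sum>i<j n. \<bar>\<theta> i\<bar>) \<le> r" if \<theta>: "\<theta> \<in> (\<Pi>\<^sub>E i\<in>{..<j n}. {c i - \<delta>..c i + \<delta>})" for \<theta>
        proof -
          have "(\<Sum>i<j n. \<bar>\<theta> i\<bar>) \<le> (\<Sum>i<j n. (1 - q) * \<bar>\<theta>0 i\<bar> + \<delta>)"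
          proof (intro sum_mono)
            fix i assume "i \<in> {..<j n}"
            then have "\<theta> i \<in> {c i - \<delta>..c i + \<delta>}" using \<theta> by (auto simp: PiE_def Pi_def)
            then have "\<bar>\<theta> i\<bar> \<le> \<bar>c i\<bar> + \<delta>" by auto
            then show "\<bar>\<theta> i\<bar> \<le> (1 - q) * \<bar>\<theta>0 i\<bar> + \<delta>" by (simp add: c_abs)
          qed
          also have "\<dots> = (1 - q) * (\<Sum>i<j n. \<bar>\<theta>0 i\<bar>) + real (j n) * \<delta>"
            by (simp add: sum.distrib sum_distrib_left)
          also have "\<dots> \<le> (1 - q) * r + q * r"
          proof (rule add_mono)
            show "(1 - q) * (\<Sum>i<j n. \<bar>\<theta>0 i\<bar>) \<le> (1 - q) * r" using q l1 by (intro mult_left_mono) auto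
            have "N powr (1 - h) \<le> N powr (- (H1 + 2) - 1)" using pos by (intro powr_le) (simp add: h_def)
            also have "\<dots> = q * (1 / N)" unfolding q_def powr_diff using N1 by simp
            also have "\<dots> \<le> q * r"
              using elim(6) q r N1 by (intro mult_left_mono) (auto simp: N_def field_simps)
            finally show "real (j n) * \<delta> \<le> q * r" using j\<delta> by simp
          qed
          also have "\<dots> = r" by (simp add: algebra_simps)
          finally show ?thesis .
        qed
        ultimately have "emeasure (coord_prior (g n) (\<tau> n) (j n)) (\<Pi>\<^sub>E i\<in>{..<j n}. {c i - \<delta>..c i + \<delta>})
            \<le> emeasure (truncated_component r S (g n) (\<tau> n) (j n)) A"
          using comp n1 by (intro truncated_component_box_le[OF S A]) auto
        then show ?thesis using box[OF c_le] Kn n1 by (auto intro: order_trans)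
      qed
      then show "ennreal (exp (- (H1 + H2 + 4 + 1 + G2 * 2 powr \<alpha> * (\<bar>C\<bar> + 1)) * (real (j n) * ln (real n))))
          \<le> emeasure (K n (j n)) A" by (simp add: target_def)
    qed
  qed
qed

text \<open>
  With \<open>k\<^sub>n \<le> n\<^sup>2\<close> and \<open>Q \<ge> 2 + 2 / \<alpha>\<close> the tail exponent is at least of the order of \<open>n\<^sup>2\<close>, which
  beats every \<open>exp (- B n)\<close>. The truncated components are eventually supported in the sieve ball.
\<close>
lemma eventually_component_tail:
  fixes g :: "nat \<Rightarrow> real \<Rightarrow> real" and \<tau> :: "nat \<Rightarrow> nat \<Rightarrow> real"
  assumes S: "parameter_space S"
    and components: "\<forall>n\<ge>1. prob_density (g n) \<and> (\<forall>i. 0 < \<tau> n i)"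
    and K: "(\<forall>n\<ge>1. K n = component S (g n) (\<tau> n)) \<or>
      (\<exists>r1>0. (\<forall>k. (\<Sum>i<k. \<bar>\<theta>0 i\<bar>) \<le> r1) \<and> (\<forall>n\<ge>1. K n = truncated_component r1 S (g n) (\<tau> n)))"
    and k: "\<forall>\<^sub>F n in sequentially. real (k n) \<le> (real n)\<^sup>2"
    and tail: "tail_condition g G1 G2 G3 G4 \<alpha>" and scale: "scale_condition \<tau> \<theta>0 j k \<alpha> \<tau>0 H2 C"
    and pos: "0 < G1" "0 < G2" "0 < G3" "0 < G4" "0 < \<alpha>" "0 < \<tau>0" and Q: "2 + 2 / \<alpha> \<le> Q"
  shows "\<forall>\<^sub>F n in sequentially. \<forall>A\<in>sets S. A \<inter> sieve_ball (k n) (real n powr Q) = {} \<longrightarrow>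
    (\<forall>l\<le>k n. emeasure (K n l) A \<le> ennreal (exp (- B * real n)))"
proof -
  have comp: "\<And>n. n \<ge> 1 \<Longrightarrow> prob_density (g n)" "\<And>n i. n \<ge> 1 \<Longrightarrow> 0 < \<tau> n i"
    using components by auto
  have large: "\<forall>\<^sub>F n in sequentially. x \<le> real n" for x
    using filterlim_real_sequentially by (simp add: filterlim_at_top)
  obtain r where r: "0 < r"
    and K': "(\<forall>n\<ge>1. K n = component S (g n) (\<tau> n)) \<or> (\<forall>n\<ge>1. K n = truncated_component r S (g n) (\<tau> n))"
    using K by (metis zero_less_one)
  define c3 where "c3 = G3 / (G1 * (G4 / (2 * G2)) powr (1 / \<alpha>))"
  define c4 where "c4 = G4 / 2 / \<tau>0 powr \<alpha>"
  have c34: "0 < c3" "0 < c4" using pos by (simp_all add: c3_def c4_def)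
  have "((\<lambda>x::real. x ^ 2 / exp x) \<longlongrightarrow> 0) at_top" by (rule tendsto_power_div_exp_0)
  from filterlim_compose[OF this filterlim_real_sequentially]
  have "\<forall>\<^sub>F n in sequentially. (real n)\<^sup>2 / exp (real n) < 1 / c3"
    by (rule order_tendstoD) (use c34 in simp)
  then show ?thesis
    using k large[of 1] large[of r] large[of "(B + 1) / c4"]
      tail[unfolded tail_condition_def] scale[unfolded scale_condition_def]
  proof eventually_elim
    case (elim n)
    define N where "N = real n"
    have n1: "1 \<le> n" and N1: "1 \<le> N" using elim(3) by (auto simp: N_def)
    have Q0: "2 \<le> Q" using Q pos by (smt (verit) divide_nonneg_nonneg)
    have kn: "k n \<le> n\<^sup>2" using elim(2) by (metis of_nat_le_iff of_nat_power)
    have arith: "real (n\<^sup>2) * (c3 * exp (- (G4 / 2) * (N powr Q / (real (n\<^sup>2) * \<tau>0)) powr \<alpha>)) \<le> exp (- B * N)"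
    proof -
      have "N powr 2 = (N powr (2 / \<alpha>)) powr \<alpha>" using pos by (simp add: powr_powr)
      also have "\<dots> \<le> (N powr (Q - 2)) powr \<alpha>" using Q N1 pos by (intro powr_mono2 powr_mono) auto
      finally have "N\<^sup>2 / \<tau>0 powr \<alpha> \<le> (N powr (Q - 2)) powr \<alpha> / \<tau>0 powr \<alpha>"
        using N1 by (intro divide_right_mono) (auto simp: powr_numeral)
      also have "\<dots> = (N powr (Q - 2) / \<tau>0) powr \<alpha>" using pos by (simp add: powr_divide)
      also have "N powr (Q - 2) / \<tau>0 = N powr Q / (real (n\<^sup>2) * \<tau>0)"
        using N1 by (simp add: powr_diff powr_numeral N_def)
      finally have "G4 / 2 * (N\<^sup>2 / \<tau>0 powr \<alpha>) \<le> G4 / 2 * (N powr Q / (real (n\<^sup>2) * \<tau>0)) powr \<alpha>"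
        using pos by (intro mult_left_mono) auto
      then have 1: "c4 * N\<^sup>2 \<le> G4 / 2 * (N powr Q / (real (n\<^sup>2) * \<tau>0)) powr \<alpha>" by (simp add: c4_def)
      have "(B + 1) * N \<le> (c4 * N) * N"
        using elim(5) c34 N1 by (intro mult_right_mono) (auto simp: N_def field_simps)
      with 1 have "exp (- (G4 / 2) * (N powr Q / (real (n\<^sup>2) * \<tau>0)) powr \<alpha>) \<le> exp (- (B + 1) * N)"
        by (simp add: power2_eq_square algebra_simps)
      then have "real (n\<^sup>2) * (c3 * exp (- (G4 / 2) * (N powr Q / (real (n\<^sup>2) * \<tau>0)) powr \<alpha>))
          \<le> real (n\<^sup>2) * (c3 * exp (- (B + 1) * N))"
        using c34 by (intro mult_left_mono) auto
      also have "\<dots> = (N\<^sup>2 / exp N) * c3 * exp (- B * N)"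
        by (simp add: N_def exp_diff exp_minus exp_add field_simps)
      also have "\<dots> \<le> (1 / c3) * c3 * exp (- B * N)"
        using elim(1) c34 by (intro mult_right_mono) (auto simp: N_def)
      finally show ?thesis using c34 by simp
    qed
    show ?case
    proof (intro ballI impI allI)
      fix A l assume A: "A \<in> sets S" "A \<inter> sieve_ball (k n) (real n powr Q) = {}" and l: "l \<le> k n"
      show "emeasure (K n l) A \<le> ennreal (exp (- B * real n))"
        using K'
      proof
        assume Kn: "\<forall>n\<ge>1. K n = component S (g n) (\<tau> n)"
        have "emeasure (K n l) A \<le> emeasure (coord_prior (g n) (\<tau> n) l)
            {\<theta> \<in> space (coord_prior (g n) (\<tau> n) l). N powr Q < L2_set \<theta> {..<l}}"
          using component_off_sieve_ball_le[OF S A l] Kn n1 by (simp add: N_def)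
        also have "\<dots> \<le> ennreal (real (n\<^sup>2) * (c3 * exp (- (G4 / 2) * (N powr Q / (real (n\<^sup>2) * \<tau>0)) powr \<alpha>)))"
          unfolding c3_def
          using comp n1 elim pos l kn by (intro coord_prior_norm_tail) auto
        also have "\<dots> \<le> ennreal (exp (- B * N))" using arith by (rule ennreal_leI)
        finally show ?thesis by (simp add: N_def)
      next
        assume Kn: "\<forall>n\<ge>1. K n = truncated_component r S (g n) (\<tau> n)"
        have "r \<le> N powr 1" using elim(4) N1 by (simp add: N_def)
        also have "\<dots> \<le> N powr Q" using N1 Q0 by (intro powr_mono) auto
        finally have "emeasure (K n l) A = 0"
          using truncated_component_off_sieve_ball[OF S A l, of r] Kn n1 by (simp add: N_def)
        then show ?thesis by simp
      qed
    qed
  qed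
qed

text \<open>
  Distances of order \<open>n powr (- H)\<close> on the sieve are turned by \<open>metric_condition\<close> into
  \<open>d\<close>-distances below \<open>\<zeta> / sqrt n\<close>, so that a net of polynomially small mesh suffices. Its
  cardinality is \<open>exp (O(k\<^sub>n ln n))\<close>, where \<open>k\<^sub>n ln n \<le> M0 j0 T\<close> for \<open>T = n \<epsilon>\<^sub>n\<^sup>2 ln n / L n\<close>, and the
  error exponent of the local tests is \<open>c1 M T\<close>.
\<close>
lemma eventually_global_test:
  assumes rate: "rate \<epsilon>" and j0: "0 < j0" and M0: "1 \<le> M0" and L: "slowly_varying L" "\<forall>\<^sub>F x in at_top. L x \<le> ln x"
    and S: "parameter_space S" and \<theta>0: "\<theta>0 \<in> space S"
    and model: "\<forall>n\<ge>1. statistical_model S (\<mu> n) (p n)"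
    and metric: "metric_condition d (kn M0 j0 L \<epsilon>) Q"
    and test: "test_condition S \<mu> p \<theta>0 d (kn M0 j0 L \<epsilon>) Q"
    and Q: "0 \<le> Q" and B: "0 \<le> B"
  shows "\<exists>M>0. \<forall>\<^sub>F n in sequentially. \<exists>\<phi> \<in> borel_measurable (\<mu> n).
    (\<forall>x\<in>space (\<mu> n). 0 \<le> \<phi> x \<and> \<phi> x \<le> 1) \<and>
    (\<integral>\<^sup>+x. ennreal (\<phi> x) * ennreal (p n \<theta>0 x) \<partial>\<mu> n) \<le> ennreal (exp (- B * (real n * (\<epsilon> n)\<^sup>2))) \<and>
    (\<forall>\<theta>\<in>sieve_ball (kn M0 j0 L \<epsilon> n) (real n powr Q). sqrt (M * (ln (real n) / L (real n) * (\<epsilon> n)\<^sup>2)) < d n \<theta>0 \<theta> \<longrightarrow>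
      (\<integral>\<^sup>+x. ennreal (1 - \<phi> x) * ennreal (p n \<theta> x) \<partial>\<mu> n) \<le> ennreal (exp (- B * (real n * (\<epsilon> n)\<^sup>2))))"
proof -
  have large: "\<forall>\<^sub>F n in sequentially. x \<le> real n" for x
    using filterlim_real_sequentially by (simp add: filterlim_at_top)
  obtain D0 D1 D2 where D: "0 \<le> D0" "0 \<le> D1" "0 < D2"
    and metric': "\<forall>\<^sub>F n in sequentially.
      \<forall>\<theta> \<in> sieve_ball (kn M0 j0 L \<epsilon> n) (real n powr Q). \<forall>\<theta>' \<in> sieve_ball (kn M0 j0 L \<epsilon> n) (real n powr Q).
        d n \<theta> \<theta>' \<le> D0 * real (kn M0 j0 L \<epsilon> n) powr D1 * L2_set (\<lambda>i. \<theta> i - \<theta>' i) {..<kn M0 j0 L \<epsilon> n} powr D2"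
    using metric unfolding metric_condition_def by blast
  obtain c1 \<zeta> where c1: "0 < c1" and \<zeta>: "0 < \<zeta>"
    and test': "\<forall>\<^sub>F n in sequentially.
          \<forall>\<theta>1 \<in> sieve_ball (kn M0 j0 L \<epsilon> n) (real n powr Q).
            \<exists>\<phi> \<in> borel_measurable (\<mu> n). (\<forall>x\<in>space (\<mu> n). 0 \<le> \<phi> x \<and> \<phi> x \<le> 1) \<and>
              (\<integral>x. \<phi> x \<partial>law (\<mu> n) (p n) \<theta>0) \<le> exp (- c1 * real n * (d n \<theta>0 \<theta>1)\<^sup>2) \<and>
              (\<forall>\<theta> \<in> space S. d n \<theta> \<theta>1 < \<zeta> * d n \<theta>0 \<theta>1 \<longrightarrow>
                 (\<integral>x. 1 - \<phi> x \<partial>law (\<mu> n) (p n) \<theta>) \<le> exp (- c1 * real n * (d n \<theta>0 \<theta>1)\<^sup>2))"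
    using test unfolding test_condition_def by blast
  (* This exponent makes \<open>k\<^sub>n powr D1 * (n powr (- H)) powr D2\<close> at most \<open>1 / n\<close>, as \<open>k\<^sub>n \<le> n\<^sup>2\<close>. *)
  define H where "H = (2 * D1 + 1) / D2"
  have H: "0 < H" "H * D2 = 2 * D1 + 1" using D by (simp_all add: H_def)
  (* The error exponent \<open>c1 * M\<close> has to pay for the entropy of the net and leave \<open>B\<close>. *)
  define M where "M = max 1 (((Q + H + 3) * (M0 * j0) + B) / c1)"
  have M1: "1 \<le> M" by (simp add: M_def)
  have Mc: "(Q + H + 3) * (M0 * j0) + B \<le> c1 * M"
  proof -
    have "((Q + H + 3) * (M0 * j0) + B) / c1 \<le> M" by (simp add: M_def)
    then show ?thesis using c1 by (simp add: field_simps)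
  qed
  have ev: "\<forall>\<^sub>F n in sequentially. \<exists>\<phi> \<in> borel_measurable (\<mu> n).
    (\<forall>x\<in>space (\<mu> n). 0 \<le> \<phi> x \<and> \<phi> x \<le> 1) \<and>
    (\<integral>\<^sup>+x. ennreal (\<phi> x) * ennreal (p n \<theta>0 x) \<partial>\<mu> n) \<le> ennreal (exp (- B * (real n * (\<epsilon> n)\<^sup>2))) \<and>
    (\<forall>\<theta>\<in>sieve_ball (kn M0 j0 L \<epsilon> n) (real n powr Q). sqrt (M * (ln (real n) / L (real n) * (\<epsilon> n)\<^sup>2)) < d n \<theta>0 \<theta> \<longrightarrow>
      (\<integral>\<^sup>+x. ennreal (1 - \<phi> x) * ennreal (p n \<theta> x) \<partial>\<mu> n) \<le> ennreal (exp (- B * (real n * (\<epsilon> n)\<^sup>2))))"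
    using metric' test' kn_bounds[OF rate j0 M0 L] kn_polynomial[OF rate j0 M0 L] jn_bounds[OF rate j0]
      rate_eventually[OF rate zero_less_one] large[of 4] large[of "(D0 / \<zeta>)\<^sup>2 + 1"]
  proof eventually_elim
    case (elim n)
    define N where "N = real n"
    define k where "k = kn M0 j0 L \<epsilon> n"
    define s where "s = real n * (\<epsilon> n)\<^sup>2"
    define T where "T = s * ln N / L N"
    define R where "R = sqrt (M * (ln (real n) / L (real n) * (\<epsilon> n)\<^sup>2))"
    have N4: "4 \<le> N" and n1: "1 \<le> n" using elim(7) by (auto simp: N_def)
    have LN: "0 < L N" "L N \<le> ln N" using elim(3) by (auto simp: N_def)
    have lnN: "1 \<le> ln N" and s1: "1 \<le> s" using elim(6) by (auto simp: N_def s_def)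
    have Ts: "s \<le> T"
      using LN s1 by (simp add: T_def field_simps)
    have inner: "ln (real n) / L (real n) * (\<epsilon> n)\<^sup>2 = T / N"
      using N4 by (simp add: T_def s_def N_def)
    have R2: "R\<^sup>2 = M * (T / N)"
      unfolding R_def inner using M1 Ts s1 N4 by (intro real_sqrt_pow2) auto
    have R0: "0 \<le> R" unfolding R_def inner using M1 Ts s1 N4 by auto
    have NR: "N * R\<^sup>2 = M * T" using N4 by (simp add: R2)
    have Rlow: "1 / sqrt N \<le> R"
    proof (rule power2_le_imp_le[OF _ R0])
      have "1 / N \<le> M * (T / N)"
        using M1 Ts s1 N4 mult_mono[of 1 M 1 T] by (simp add: divide_right_mono)
      then show "(1 / sqrt N)\<^sup>2 \<le> R\<^sup>2" using N4 by (simp add: R2 power_divide)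
    qed
    (* A cell of this side has diameter at most \<open>k\<^sub>n * \<eta> \<le> n powr (- H)\<close>. *)
    define \<eta> where "\<eta> = N powr (- (H + 2))"
    have \<eta>: "0 < \<eta>" using N4 by (simp add: \<eta>_def)
    have k2: "real k \<le> N\<^sup>2" using elim(4) by (simp add: k_def N_def)
    have close: "d n \<theta> \<theta>1 < \<zeta> * R"
      if \<theta>: "\<theta> \<in> sieve_ball k (real n powr Q)" "\<theta>1 \<in> sieve_ball k (real n powr Q)"
        and cell: "\<forall>i<k. \<bar>\<theta> i - \<theta>1 i\<bar> \<le> \<eta>" for \<theta> \<theta>1
    proof -
      have "L2_set (\<lambda>i. \<theta> i - \<theta>1 i) {..<k} \<le> (\<Sum>i<k. \<bar>\<theta> i - \<theta>1 i\<bar>)" by (rule L2_set_le_sum_abs)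
      also have "\<dots> \<le> (\<Sum>i<k. \<eta>)" using cell by (intro sum_mono) auto
      also have "\<dots> = real k * \<eta>" by simp
      also have "\<dots> \<le> N\<^sup>2 * \<eta>" using k2 \<eta> by (intro mult_right_mono) auto
      also have "N\<^sup>2 = N powr 2" using N4 by (simp add: powr_numeral)
      also have "N powr 2 * \<eta> = N powr (- H)" unfolding \<eta>_def powr_add[symmetric] by simp
      finally have "L2_set (\<lambda>i. \<theta> i - \<theta>1 i) {..<k} powr D2 \<le> (N powr (- H)) powr D2"
        using D by (intro powr_mono2) auto
      also have "\<dots> = N powr (- (2 * D1 + 1))" using H(2) by (simp add: powr_powr)
      finally have l2: "L2_set (\<lambda>i. \<theta> i - \<theta>1 i) {..<k} powr D2 \<le> N powr (- (2 * D1 + 1))" .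
      have "real k powr D1 \<le> (N\<^sup>2) powr D1" using k2 D by (intro powr_mono2) auto
      also have "(N\<^sup>2) powr D1 = N powr (2 * D1)" 
      proof -
        have "N\<^sup>2 = N powr 2" using N4 by (simp add: powr_numeral)
        then show ?thesis by (simp only: powr_powr)
      qed
      finally have kD: "real k powr D1 \<le> N powr (2 * D1)" .
      have "d n \<theta> \<theta>1 \<le> D0 * real k powr D1 * L2_set (\<lambda>i. \<theta> i - \<theta>1 i) {..<k} powr D2"
        using elim(1) \<theta> by (auto simp: k_def)
      also have "\<dots> \<le> D0 * N powr (2 * D1) * N powr (- (2 * D1 + 1))"
        using D l2 kD by (intro mult_mono mult_left_mono) auto
      also have "\<dots> = D0 / N"
        using N4 by (simp add: mult.assoc powr_add[symmetric] powr_minus divide_inverse)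
      also have "\<dots> < \<zeta> * (1 / sqrt N)"
      proof -
        have "(D0 / \<zeta>)\<^sup>2 < N" using elim(8) by (simp add: N_def)
        then have "D0 / \<zeta> < sqrt N" by (rule real_less_rsqrt)
        then have "D0 < \<zeta> * sqrt N" using \<zeta> by (simp add: field_simps)
        then have "D0 / N < \<zeta> * sqrt N / N" using N4 by (intro divide_strict_right_mono) auto
        also have "\<zeta> * sqrt N / N = \<zeta> * (1 / sqrt N)"
          using N4 by (simp add: field_simps)
        finally show ?thesis .
      qed
      also have "\<dots> \<le> \<zeta> * R" using Rlow \<zeta> by (intro mult_left_mono) auto
      finally show ?thesis .
    qed
    have sieve: "sieve_ball k (real n powr Q) \<subseteq> space S"
      using sieve_subset_space[OF S] by (auto simp: sieve_ball_def)
    have tests: "\<exists>\<phi> \<in> borel_measurable (\<mu> n). (\<forall>x\<in>space (\<mu> n). 0 \<le> \<phi> x \<and> \<phi> x \<le> 1) \<and>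
        (\<integral>x. \<phi> x \<partial>law (\<mu> n) (p n) \<theta>0) \<le> exp (- (c1 * real n) * (d n \<theta>0 \<theta>1)\<^sup>2) \<and>
        (\<forall>\<theta> \<in> space S. d n \<theta> \<theta>1 < \<zeta> * d n \<theta>0 \<theta>1 \<longrightarrow>
          (\<integral>x. 1 - \<phi> x \<partial>law (\<mu> n) (p n) \<theta>) \<le> exp (- (c1 * real n) * (d n \<theta>0 \<theta>1)\<^sup>2))"
      if "\<theta>1 \<in> sieve_ball k (real n powr Q)" for \<theta>1
      using elim(2) that by (simp add: k_def)
    have "\<exists>\<phi> \<in> borel_measurable (\<mu> n). (\<forall>x\<in>space (\<mu> n). 0 \<le> \<phi> x \<and> \<phi> x \<le> 1) \<and>
      (\<integral>\<^sup>+x. ennreal (\<phi> x) * ennreal (p n \<theta>0 x) \<partial>\<mu> n)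
        \<le> ennreal ((2 * (real n powr Q) / \<eta> + 2) ^ k * exp (- (c1 * real n) * R\<^sup>2)) \<and>
      (\<forall>\<theta>\<in>sieve_ball k (real n powr Q). R < d n \<theta>0 \<theta> \<longrightarrow>
        (\<integral>\<^sup>+x. ennreal (1 - \<phi> x) * ennreal (p n \<theta> x) \<partial>\<mu> n) \<le> ennreal (exp (- (c1 * real n) * R\<^sup>2)))"
      by (rule global_test[OF model[rule_format, OF n1] \<theta>0 sieve _ \<eta> _ R0 tests close]) (use c1 \<zeta> in auto)
    moreover have "exp (- (c1 * real n) * R\<^sup>2) \<le> exp (- B * s)"
    proof -
      have "B * s \<le> (c1 * M) * T"
        using Mc Ts s1 B Q H M0 j0 by (intro mult_mono) (auto intro: order_trans[rotated])
      also have "\<dots> = c1 * real n * R\<^sup>2" using NR by (simp add: N_def ac_simps)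
      finally show ?thesis by simp
    qed
    moreover have "(2 * (real n powr Q) / \<eta> + 2) ^ k * exp (- (c1 * real n) * R\<^sup>2) \<le> exp (- B * s)"
    proof -
      have "2 * (real n powr Q) / \<eta> + 2 = 2 * N powr (Q + H + 2) + 2"
      proof -
        have "N powr Q / \<eta> = N powr (Q - (- (H + 2)))" unfolding \<eta>_def powr_diff ..
        also have "Q - (- (H + 2)) = Q + H + 2" by simp
        finally show ?thesis by (simp add: N_def)
      qed
      also have "\<dots> \<le> 4 * N powr (Q + H + 2)"
        using ge_one_powr_ge_zero[of N "Q + H + 2"] N4 Q H by simp
      also have "\<dots> \<le> N * N powr (Q + H + 2)" using N4 by (intro mult_right_mono) auto
      also have "\<dots> = N powr (Q + H + 3)" using N4 powr_add[of N 1 "Q + H + 2"] by (simp add: ac_simps)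
      also have "\<dots> = exp ((Q + H + 3) * ln N)" using N4 by (simp add: powr_def)
      finally have "(2 * (real n powr Q) / \<eta> + 2) ^ k \<le> exp ((Q + H + 3) * ln N) ^ k"
        using \<eta> by (intro power_mono) auto
      also have "\<dots> = exp ((Q + H + 3) * (real k * ln N))"
        by (simp add: exp_of_nat_mult[symmetric] ac_simps)
      also have "\<dots> \<le> exp ((Q + H + 3) * (M0 * j0 * T))"
      proof -
        have "real k * L N \<le> M0 * (real (jn j0 \<epsilon> n) * ln N)"
          using elim(3) by (simp add: k_def N_def mult.assoc)
        also have "\<dots> \<le> M0 * (j0 * s)"
          using elim(5) M0 by (intro mult_left_mono) (auto simp: s_def N_def)
        finally have "real k \<le> M0 * j0 * s / L N" using LN by (simp add: field_simps)
        then have "real k * ln N \<le> M0 * j0 * s / L N * ln N" using lnN by (intro mult_right_mono) auto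
        also have "\<dots> = M0 * j0 * T" by (simp add: T_def)
        finally show ?thesis using Q H by simp
      qed
      finally have "(2 * (real n powr Q) / \<eta> + 2) ^ k * exp (- (c1 * real n) * R\<^sup>2)
          \<le> exp ((Q + H + 3) * (M0 * j0 * T)) * exp (- (c1 * real n) * R\<^sup>2)"
        by (rule mult_right_mono) simp
      also have "exp ((Q + H + 3) * (M0 * j0 * T)) * exp (- (c1 * real n) * R\<^sup>2) \<le> exp (- B * s)"
      proof -
        have "- (c1 * real n) * R\<^sup>2 = - (c1 * M * T)" using NR by (simp add: N_def ac_simps)
        moreover
        have "((Q + H + 3) * (M0 * j0) + B) * T \<le> c1 * M * T"
          using Mc Ts s1 by (intro mult_right_mono) auto
        moreover have "B * s \<le> B * T" using B Ts by (intro mult_left_mono)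
        ultimately show ?thesis by (simp only: exp_add[symmetric] exp_le_cancel_iff) (simp add: algebra_simps)
      qed
      finally show ?thesis .
    qed
    ultimately show ?case
      unfolding k_def[symmetric] R_def[symmetric] s_def[symmetric]
      by (meson ennreal_leI order_trans)
  qed
  show ?thesis
    by (rule exI[of _ M], rule conjI[OF _ ev]) (use M1 in simp)
qed

section \<open>The rate of the posterior risk\<close>

lemma eventually_exp_le_powr:
  fixes s :: "'a \<Rightarrow> real" and m :: real
  assumes "filterlim s at_top F"
  shows "\<forall>\<^sub>F n in F. exp (- s n) \<le> s n powr (- m)"
proof -
  define k where "k = nat \<lceil>m\<rceil>"
  have "((\<lambda>x::real. x ^ k / exp x) \<longlongrightarrow> 0) at_top" by (rule tendsto_power_div_exp_0)
  then have "\<forall>\<^sub>F x::real in at_top. x ^ k / exp x < 1" by (rule order_tendstoD) simp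
  then have "\<forall>\<^sub>F x::real in at_top. exp (- x) \<le> x powr (- m)"
    using eventually_ge_at_top[of 1]
  proof eventually_elim
    case (elim x)
    have "m \<le> real k" by (simp add: k_def) linarith
    then have "x powr m \<le> x powr (real k)" using elim by (intro powr_mono) auto
    also have "\<dots> = x ^ k" using elim by (simp add: powr_realpow)
    also have "\<dots> \<le> exp x" using elim by simp
    finally have "1 / exp x \<le> 1 / x powr m" using elim by (intro divide_left_mono) auto
    then show ?case by (simp add: exp_minus powr_minus divide_inverse)
  qed
  then show ?thesis by (rule eventually_compose_filterlim[OF _ assms])
qed

text \<open>
  The constant \<open>B\<close> exceeds the exponent \<open>c\<close> of the prior mass of the neighbourhood by \<open>8\<close>: of this, \<open>6\<close>
  compensates the loss in the evidence, and \<open>2\<close> is left to make the exponential terms negligible.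
\<close>
lemma posterior_risk_rate:
  fixes \<mu> :: "nat \<Rightarrow> 'x measure" and g :: "nat \<Rightarrow> real \<Rightarrow> real" and \<tau> :: "nat \<Rightarrow> nat \<Rightarrow> real"
  assumes pos: "0 < j0" "2 \<le> m" "0 < H1" "0 < a" "0 < b" "0 < G1" "0 < G2" "0 < G3" "0 < G4"
      "0 < H2" "0 < \<alpha>" "0 < \<tau>0" "0 < \<Lambda>"
    and B: "B = j0 * (a + (H1 + H2 + 4 + 1 + G2 * 2 powr \<alpha> * (\<bar>C\<bar> + 1))) + 8"
    and M0: "1 \<le> M0" "16 * \<Lambda> * B / (b * j0) \<le> M0" and Q: "2 + 2 / \<alpha> \<le> Q"
    and S: "parameter_space S" and \<theta>0: "\<theta>0 \<in> space S"
    and model: "\<forall>n\<ge>1. statistical_model S (\<mu> n) (p n)"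
    and semi: "\<forall>n\<ge>1. semimetric_on (space S) (d n) \<and> (\<lambda>\<theta>. d n \<theta> \<theta>0) \<in> borel_measurable S"
    and rate: "rate \<epsilon>" and L: "slowly_varying L" "\<forall>\<^sub>F x in at_top. L x \<le> ln x"
    and Lk: "\<forall>\<^sub>F n in sequentially. L (real n) \<le> \<Lambda> * L (real (kn M0 j0 L \<epsilon> n))"
    and components: "\<forall>n\<ge>1. prob_density (g n) \<and> (\<forall>i. 0 < \<tau> n i)"
    and K: "(\<forall>n\<ge>1. K n = component S (g n) (\<tau> n)) \<or>
      (\<exists>r1>0. (\<forall>k. (\<Sum>i<k. \<bar>\<theta>0 i\<bar>) \<le> r1) \<and> (\<forall>n\<ge>1. K n = truncated_component r1 S (g n) (\<tau> n)))"
    and priors: "\<forall>n\<ge>1. prior n = mixture (w n) (K n)"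
    and rem: "(\<lambda>n. (real n * (\<epsilon> n)\<^sup>2) powr (- m / 2)) \<in> O(\<lambda>n. (\<epsilon> n)\<^sup>2)"
    and approx: "approximation_condition \<mu> p \<theta>0 \<epsilon> j0 m"
    and nbhd: "neighbourhood_condition \<mu> p \<theta>0 \<epsilon> j0 m H1"
    and metric: "metric_condition d (kn M0 j0 L \<epsilon>) Q"
    and test: "test_condition S \<mu> p \<theta>0 d (kn M0 j0 L \<epsilon>) Q"
    and weight: "weight_condition w L a b"
    and tail: "tail_condition g G1 G2 G3 G4 \<alpha>"
    and scale: "scale_condition \<tau> \<theta>0 (jn j0 \<epsilon>) (kn M0 j0 L \<epsilon>) \<alpha> \<tau>0 H2 C"
    and D: "\<forall>n\<ge>1. \<forall>\<theta>\<in>space S. \<forall>\<theta>'\<in>space S. d n \<theta> \<theta>' \<le> D"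
  shows "(\<lambda>n. posterior_risk (\<mu> n) (p n) (prior n) (d n) \<theta>0)
        \<in> O(\<lambda>n. ln (real n) / L (real n) * (\<epsilon> n)\<^sup>2)"
proof -
  have comp: "prob_density (g n)" "\<And>i. 0 < \<tau> n i" if "n \<ge> 1" for n
    using components that by auto
  have d: "semimetric_on (space S) (d n)" "(\<lambda>\<theta>. d n \<theta> \<theta>0) \<in> borel_measurable S" if "n \<ge> 1" for n
    using semi that by auto
  have prior: "prior n = mixture (w n) (K n)" if "n \<ge> 1" for n
    using priors that by auto
  let ?s = "\<lambda>n. real n * (\<epsilon> n)\<^sup>2"
  let ?k = "kn M0 j0 L \<epsilon>" and ?j = "jn j0 \<epsilon>"
  define c5 where "c5 = H1 + H2 + 4 + 1 + G2 * 2 powr \<alpha> * (\<bar>C\<bar> + 1)"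
  define c where "c = j0 * (a + c5)"
  have c5: "0 < c5" unfolding c5_def using pos by (intro add_pos_nonneg) auto
  then have c: "0 < c" using pos by (simp add: c_def)
  have Bc: "B = c + 8" by (simp add: B c_def c5_def)
  then have B1: "1 \<le> B" using c by simp
  have Q0: "0 \<le> Q" using Q pos by (smt (verit) divide_nonneg_nonneg)
  have K_sub: "K n l \<in> space (subprob_algebra S)" if "n \<ge> 1" for n l
    using K that component_in_subprob_algebra[OF S comp(1)[OF that], of "\<tau> n"]
      truncated_component_in_subprob_algebra[OF S comp(1)[OF that], of "\<tau> n"] comp(2)[OF that] by metis
  obtain M where M: "0 < M" and tests: "\<forall>\<^sub>F n in sequentially. \<exists>\<phi> \<in> borel_measurable (\<mu> n).
    (\<forall>x\<in>space (\<mu> n). 0 \<le> \<phi> x \<and> \<phi> x \<le> 1) \<and>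
    (\<integral>\<^sup>+x. ennreal (\<phi> x) * ennreal (p n \<theta>0 x) \<partial>\<mu> n) \<le> ennreal (exp (- B * ?s n)) \<and>
    (\<forall>\<theta>\<in>sieve_ball (?k n) (real n powr Q). sqrt (M * (ln (real n) / L (real n) * (\<epsilon> n)\<^sup>2)) < d n \<theta>0 \<theta> \<longrightarrow>
      (\<integral>\<^sup>+x. ennreal (1 - \<phi> x) * ennreal (p n \<theta> x) \<partial>\<mu> n) \<le> ennreal (exp (- B * ?s n)))"
    using eventually_global_test[OF rate pos(1) M0(1) L S \<theta>0 model metric test Q0, of B] c Bc by auto
  obtain c6 where c6: "0 < c6" and small: "\<forall>\<^sub>F n in sequentially.
      norm (?s n powr (- m / 2)) \<le> c6 * norm ((\<epsilon> n)\<^sup>2)"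
    using landau_o.bigE[OF rem] by blast
  have jk: "\<forall>\<^sub>F n in sequentially. ?j n \<le> n \<and> ?j n \<le> ?k n"
    using jn_bounds[OF rate pos(1)] kn_bounds[OF rate pos(1) M0(1) L] by eventually_elim auto
  have Lj: "\<forall>\<^sub>F n in sequentially. L (real (?j n)) \<le> ln (real (?j n))"
    by (rule eventually_compose_filterlim[OF L(2) jn_at_top[OF rate pos(1)]])
  have mass: "\<forall>\<^sub>F n in sequentially. \<forall>A\<in>sets S. l2_nbhd \<theta>0 (?j n) (real n powr (- H1)) \<subseteq> A \<longrightarrow>
      ennreal (exp (- c * ?s n)) \<le> emeasure (prior n) A"
    using eventually_component_nbhd_mass[OF S components K jk tail scale pos(3,10,6,7,11,12)] Lj
      weight[unfolded weight_condition_def] jn_bounds[OF rate pos(1)] eventually_ge_at_top[of 1]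
  proof eventually_elim
    case (elim n)
    show ?case
    proof (intro ballI impI)
      fix A assume A: "A \<in> sets S" "l2_nbhd \<theta>0 (?j n) (real n powr (- H1)) \<subseteq> A"
      have j1: "1 \<le> ?j n" and jn: "?j n \<le> n" and js: "real (?j n) * ln (real n) \<le> j0 * ?s n"
        using elim(4) by auto
      have "ln (real (?j n)) \<le> ln (real n)" using j1 jn by (subst ln_le_cancel_iff) auto
      then have "L (real (?j n)) \<le> ln (real n)" using elim(2) by simp
      then have "a * (real (?j n) * L (real (?j n))) \<le> a * (real (?j n) * ln (real n))"
        using pos by (intro mult_left_mono) auto
      also have "\<dots> \<le> a * (j0 * ?s n)" using js pos by (intro mult_left_mono) auto
      finally have w1: "exp (- (a * (j0 * ?s n))) \<le> exp (- a * real (?j n) * L (real (?j n)))"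
        by (simp add: mult.assoc)
      also have "\<dots> \<le> pmf (w n) (?j n)" using elim(3) j1 by auto
      finally have w2: "exp (- (a * (j0 * ?s n))) \<le> pmf (w n) (?j n)" .
      have k1: "exp (- (c5 * (j0 * ?s n))) \<le> exp (- c5 * (real (?j n) * ln (real n)))"
        using js c5 by simp
      have "exp (- c * ?s n) = exp (- (a * (j0 * ?s n))) * exp (- (c5 * (j0 * ?s n)))"
        by (simp add: c_def exp_add[symmetric] algebra_simps)
      also have "\<dots> \<le> pmf (w n) (?j n) * exp (- c5 * (real (?j n) * ln (real n)))"
        by (intro mult_mono w2 k1) auto
      finally have "ennreal (exp (- c * ?s n))
          \<le> ennreal (pmf (w n) (?j n)) * ennreal (exp (- c5 * (real (?j n) * ln (real n))))"
        by (simp add: ennreal_mult[symmetric] ennreal_leI)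
      also have "\<dots> \<le> ennreal (pmf (w n) (?j n)) * emeasure (K n (?j n)) A"
        using elim(1) A by (intro mult_left_mono) (auto simp: c5_def)
      also have "\<dots> \<le> emeasure (prior n) A"
        unfolding prior[OF elim(5)] by (rule mixture_ge_component[OF K_sub[OF elim(5)] A(1)])
      finally show "ennreal (exp (- c * ?s n)) \<le> emeasure (prior n) A" .
    qed
  qed
  have off: "\<forall>\<^sub>F n in sequentially. \<forall>A\<in>sets S. A \<inter> sieve_ball (?k n) (real n powr Q) = {} \<longrightarrow>
      emeasure (prior n) A \<le> ennreal (4 * exp (- B * ?s n))"
    using eventually_component_tail[OF S components K kn_polynomial[OF rate pos(1) M0(1) L] tail scale pos(6-9,11,12) Q, of B]
      prior_weights_tail[OF rate pos(1) M0(1) L Lk pos(13) weight pos(5) B1 M0(2)]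
      rate_eventually[OF rate zero_less_one] eventually_ge_at_top[of 1]
  proof eventually_elim
    case (elim n)
    show ?case
    proof (intro ballI impI)
      fix A assume A: "A \<in> sets S" "A \<inter> sieve_ball (?k n) (real n powr Q) = {}"
      have "?s n \<le> real n * 1" using elim(3) by (intro mult_left_mono) auto
      then have "exp (- B * real n) \<le> exp (- B * ?s n)" using c Bc by simp
      then have "emeasure (K n l) A \<le> ennreal (exp (- B * ?s n))" if "l \<le> ?k n" for l
        using elim(1) A that by (blast intro: order_trans ennreal_leI)
      then have "emeasure (prior n) A \<le> ennreal (exp (- B * ?s n)) + ennreal (3 * exp (- B * ?s n))"
        unfolding prior[OF elim(4)] using elim(2)
        by (intro mixture_le_tail[where ?k0.0 = "?k n", OF K_sub[OF elim(4)] A(1)]) auto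
      also have "\<dots> = ennreal (4 * exp (- B * ?s n))" by (subst ennreal_plus[symmetric]) auto
      finally show "emeasure (prior n) A \<le> ennreal (4 * exp (- B * ?s n))" .
    qed
  qed
  show ?thesis
  proof (rule landau_o.bigI)
    show "0 < M + D\<^sup>2 * (14 * c6) + 1" using M c6 by (intro add_nonneg_pos) auto
    show "\<forall>\<^sub>F n in sequentially. norm (posterior_risk (\<mu> n) (p n) (prior n) (d n) \<theta>0)
        \<le> (M + D\<^sup>2 * (14 * c6) + 1) * norm (ln (real n) / L (real n) * (\<epsilon> n)\<^sup>2)"
      using tests mass off small approx[unfolded approximation_condition_def]
        nbhd[unfolded neighbourhood_condition_def] rate_eventually[OF rate zero_less_one]
        kn_bounds[OF rate pos(1) M0(1) L] eventually_ge_at_top[of 1]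
        eventually_exp_le_powr[OF rate_sample_information_at_top[OF rate], of "m / 2"]
    proof eventually_elim
      case (elim n)
      define s where "s = ?s n"
      define R where "R = sqrt (M * (ln (real n) / L (real n) * (\<epsilon> n)\<^sup>2))"
      have n: "n \<ge> 1" by (rule elim(9))
      have s1: "1 \<le> s" using elim(7) by (auto simp: s_def)
      have LN: "0 < L (real n)" "L (real n) \<le> ln (real n)" using elim(8) by auto
      have ratio: "1 \<le> ln (real n) / L (real n)" using LN by simp
      have R2: "R\<^sup>2 = M * (ln (real n) / L (real n) * (\<epsilon> n)\<^sup>2)"
        unfolding R_def using M ratio by (intro real_sqrt_pow2 mult_nonneg_nonneg) auto
      have R0: "0 \<le> R" unfolding R_def using M ratio by (intro real_sqrt_ge_zero mult_nonneg_nonneg) auto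
      obtain \<phi> where \<phi>: "\<phi> \<in> borel_measurable (\<mu> n)" "\<And>x. x \<in> space (\<mu> n) \<Longrightarrow> 0 \<le> \<phi> x \<and> \<phi> x \<le> 1"
        "(\<integral>\<^sup>+x. ennreal (\<phi> x) * ennreal (p n \<theta>0 x) \<partial>\<mu> n) \<le> ennreal (exp (- B * s))"
        "\<And>\<theta>. \<theta> \<in> sieve_ball (?k n) (real n powr Q) \<Longrightarrow> R < d n \<theta>0 \<theta> \<Longrightarrow>
          (\<integral>\<^sup>+x. ennreal (1 - \<phi> x) * ennreal (p n \<theta> x) \<partial>\<mu> n) \<le> ennreal (exp (- B * s))"
        using elim(1) unfolding R_def s_def by blast
      have "posterior_risk (\<mu> n) (p n) (prior n) (d n) \<theta>0
        \<le> R\<^sup>2 + D\<^sup>2 * (exp (- B * s) + 3 * s powr (- m / 2)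
          + 2 * exp (6 * s) / exp (- c * s) * (exp (- B * s) + 4 * exp (- B * s)))"
      proof (rule posterior_risk_nonasymptotic[OF S model[rule_format, OF n] \<theta>0])
        show "sets (prior n) = sets S" "emeasure (prior n) (space (prior n)) \<le> 1"
          unfolding prior[OF n] using mixture_subprob[OF K_sub[OF n]] by auto
        show "KL (\<mu> n) (p n \<theta>0) (p n (trunc (?j n) \<theta>0)) \<le> ereal s"
          "V m (\<mu> n) (p n \<theta>0) (p n (trunc (?j n) \<theta>0)) \<le> ennreal (s powr (m / 2))"
          using elim(5) by (auto simp: s_def)
        show "l2_nbhd \<theta>0 (?j n) (real n powr (- H1)) \<subseteq> kl_nbhd (\<mu> n) (p n) \<theta>0 m (?j n) s"
          using elim(6) by (simp add: s_def)
        show "ennreal (exp (- c * s)) \<le> emeasure (prior n) A"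
          if "A \<in> sets S" "l2_nbhd \<theta>0 (?j n) (real n powr (- H1)) \<subseteq> A" for A
          using elim(2) that unfolding s_def by blast
        show "emeasure (prior n) A \<le> ennreal (4 * exp (- B * s))"
          if "A \<in> sets S" "A \<inter> sieve_ball (?k n) (real n powr Q) = {}" for A
          using elim(3) that unfolding s_def by blast
      qed (use d[OF n] D n s1 pos(2) R0 \<phi> in auto)
      also have "2 * exp (6 * s) / exp (- c * s) * (exp (- B * s) + 4 * exp (- B * s)) = 10 * exp (- (2 * s))"
      proof -
        have "exp (6 * s) / exp (- c * s) * exp (- B * s) = exp (- (2 * s))"
          unfolding exp_diff[symmetric] exp_add[symmetric] Bc by (simp add: algebra_simps)
        then show ?thesis by simp
      qed
      also have "R\<^sup>2 + D\<^sup>2 * (exp (- B * s) + 3 * s powr (- m / 2) + 10 * exp (- (2 * s)))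
        \<le> R\<^sup>2 + D\<^sup>2 * (14 * s powr (- m / 2))"
      proof (intro add_left_mono mult_left_mono)
        have "1 * s \<le> B * s" using c Bc s1 by (intro mult_right_mono) auto
        then have "exp (- B * s) \<le> exp (- s)" by simp
        moreover have "exp (- (2 * s)) \<le> exp (- s)" using s1 by simp
        moreover have "exp (- s) \<le> s powr (- m / 2)" using elim(10) by (simp add: s_def)
        ultimately show "exp (- B * s) + 3 * s powr (- m / 2) + 10 * exp (- (2 * s)) \<le> 14 * s powr (- m / 2)"
          by linarith
      qed simp
      also have "\<dots> \<le> R\<^sup>2 + D\<^sup>2 * (14 * (c6 * (ln (real n) / L (real n) * (\<epsilon> n)\<^sup>2)))"
      proof (intro add_left_mono mult_left_mono)
        have "s powr (- m / 2) \<le> c6 * (\<epsilon> n)\<^sup>2" using elim(4) by (simp add: s_def)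
        also have "\<dots> \<le> c6 * (ln (real n) / L (real n) * (\<epsilon> n)\<^sup>2)"
          using mult_right_mono[OF ratio, of "(\<epsilon> n)\<^sup>2"] c6 by (intro mult_left_mono) auto
        finally show "s powr (- m / 2) \<le> c6 * (ln (real n) / L (real n) * (\<epsilon> n)\<^sup>2)" .
      qed auto
      also have "\<dots> = (M + D\<^sup>2 * (14 * c6)) * (ln (real n) / L (real n) * (\<epsilon> n)\<^sup>2)"
        unfolding R2 by (simp add: algebra_simps)
      also have "\<dots> \<le> (M + D\<^sup>2 * (14 * c6) + 1) * (ln (real n) / L (real n) * (\<epsilon> n)\<^sup>2)"
        using ratio by (intro mult_right_mono mult_nonneg_nonneg) auto
      finally have le: "posterior_risk (\<mu> n) (p n) (prior n) (d n) \<theta>0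
          \<le> (M + D\<^sup>2 * (14 * c6) + 1) * (ln (real n) / L (real n) * (\<epsilon> n)\<^sup>2)" .
      have "0 \<le> posterior_risk (\<mu> n) (p n) (prior n) (d n) \<theta>0"
        unfolding posterior_risk_def by (intro Bochner_Integration.integral_nonneg) simp
      moreover have "0 \<le> ln (real n) / L (real n) * (\<epsilon> n)\<^sup>2"
        using ratio by (intro mult_nonneg_nonneg) auto
      ultimately show ?case using le by (simp only: real_norm_def abs_of_nonneg)
    qed
  qed
qed

theorem corollary1:
  fixes j0 m H1 a b G1 G2 G3 G4 H2 \<alpha> \<tau>0 C \<Lambda> :: real
  assumes "0 < j0" and "2 \<le> m" and "0 < H1" and "0 < a" and "0 < b"
    and "0 < G1" and "0 < G2" and "0 < G3" and "0 < G4"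
    and "0 < H2" and "0 < \<alpha>" and "0 < \<tau>0" and "0 < \<Lambda>"
  shows "\<exists>M1>1. \<exists>Q1>0. \<forall>M0\<ge>M1. \<forall>Q\<ge>Q1.
    \<forall>(S :: (nat \<Rightarrow> real) measure) (\<mu> :: nat \<Rightarrow> 'x measure)
     (p :: nat \<Rightarrow> (nat \<Rightarrow> real) \<Rightarrow> 'x \<Rightarrow> real) (\<theta>0 :: nat \<Rightarrow> real)
     (d :: nat \<Rightarrow> (nat \<Rightarrow> real) \<Rightarrow> (nat \<Rightarrow> real) \<Rightarrow> real)
     (\<epsilon> :: nat \<Rightarrow> real) (L :: real \<Rightarrow> real)
     (w :: nat \<Rightarrow> nat pmf) (g :: nat \<Rightarrow> real \<Rightarrow> real) (\<tau> :: nat \<Rightarrow> nat \<Rightarrow> real)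
     (prior :: nat \<Rightarrow> (nat \<Rightarrow> real) measure).
      parameter_space S \<longrightarrow> \<theta>0 \<in> space S \<longrightarrow>
      (\<forall>n\<ge>1. statistical_model S (\<mu> n) (p n)) \<longrightarrow>
      (\<forall>n\<ge>1. semimetric_on (space S) (d n) \<and> (\<lambda>\<theta>. d n \<theta> \<theta>0) \<in> borel_measurable S) \<longrightarrow>
      rate \<epsilon> \<longrightarrow> slowly_varying L \<longrightarrow> (\<forall>\<^sub>F x in at_top. L x \<le> ln x) \<longrightarrow>
      (\<forall>\<^sub>F n in sequentially. L (real n) \<le> \<Lambda> * L (real (kn M0 j0 L \<epsilon> n))) \<longrightarrow>
      (\<forall>n\<ge>1. pmf (w n) 0 = 0 \<and> prob_density (g n) \<and> (\<forall>i. 0 < \<tau> n i)) \<longrightarrow>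
      (\<forall>n\<ge>1. prior n = mixture (w n) (component S (g n) (\<tau> n))) \<or>
      (\<exists>r1>0. (\<forall>k. (\<Sum>i<k. \<bar>\<theta>0 i\<bar>) \<le> r1) \<and>
         (\<forall>n\<ge>1. prior n = mixture (w n) (truncated_component r1 S (g n) (\<tau> n)))) \<longrightarrow>
      (\<lambda>n. (real n * (\<epsilon> n)\<^sup>2) powr (- m / 2)) \<in> O(\<lambda>n. (\<epsilon> n)\<^sup>2) \<longrightarrow>
      approximation_condition \<mu> p \<theta>0 \<epsilon> j0 m \<longrightarrow>
      neighbourhood_condition \<mu> p \<theta>0 \<epsilon> j0 m H1 \<longrightarrow>
      metric_condition d (kn M0 j0 L \<epsilon>) Q \<longrightarrow>
      test_condition S \<mu> p \<theta>0 d (kn M0 j0 L \<epsilon>) Q \<longrightarrow>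
      weight_condition w L a b \<longrightarrow>
      tail_condition g G1 G2 G3 G4 \<alpha> \<longrightarrow>
      scale_condition \<tau> \<theta>0 (jn j0 \<epsilon>) (kn M0 j0 L \<epsilon>) \<alpha> \<tau>0 H2 C \<longrightarrow>
      (\<exists>D. \<forall>n\<ge>1. \<forall>\<theta>\<in>space S. \<forall>\<theta>'\<in>space S. d n \<theta> \<theta>' \<le> D) \<longrightarrow>
      (\<lambda>n. posterior_risk (\<mu> n) (p n) (prior n) (d n) \<theta>0)
        \<in> O(\<lambda>n. ln (real n) / L (real n) * (\<epsilon> n)\<^sup>2)"
proof -
  define B where "B = j0 * (a + (H1 + H2 + 4 + 1 + G2 * 2 powr \<alpha> * (\<bar>C\<bar> + 1))) + 8"
  note main = posterior_risk_rate[OF assms B_def]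
  show ?thesis
  proof (rule exI[of _ "max 2 (16 * \<Lambda> * B / (b * j0))"], intro conjI exI[of _ "2 + 2 / \<alpha>"] allI impI, goal_cases)
    case (3 M0 Q S \<mu> p \<theta>0 d \<epsilon> L w g \<tau> prior)
    obtain D where D: "\<forall>n\<ge>1. \<forall>\<theta>\<in>space S. \<forall>\<theta>'\<in>space S. d n \<theta> \<theta>' \<le> D"
      using 3(21) by blast
    have components: "\<forall>n\<ge>1. prob_density (g n) \<and> (\<forall>i. 0 < \<tau> n i)"
      using 3(11) by blast
    have M0: "1 \<le> M0" "16 * \<Lambda> * B / (b * j0) \<le> M0" using 3(1) by auto
    obtain K where K: "(\<forall>n\<ge>1. K n = component S (g n) (\<tau> n)) \<or>
        (\<exists>r1>0. (\<forall>k. (\<Sum>i<k. \<bar>\<theta>0 i\<bar>) \<le> r1) \<and> (\<forall>n\<ge>1. K n = truncated_component r1 S (g n) (\<tau> n)))"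
      and prior: "\<forall>n\<ge>1. prior n = mixture (w n) (K n)"
      using 3(12)
    proof (elim disjE exE conjE)
      assume "\<forall>n\<ge>1. prior n = mixture (w n) (component S (g n) (\<tau> n))"
      then show ?thesis by (intro that[of "\<lambda>n. component S (g n) (\<tau> n)"]) auto
    next
      fix r1 assume "0 < r1" "\<forall>k. (\<Sum>i<k. \<bar>\<theta>0 i\<bar>) \<le> r1"
        "\<forall>n\<ge>1. prior n = mixture (w n) (truncated_component r1 S (g n) (\<tau> n))"
      then show ?thesis by (intro that[of "\<lambda>n. truncated_component r1 S (g n) (\<tau> n)"]) auto
    qed
    show ?case
      by (rule main[OF M0 3(2-10) components K prior 3(13-20) D])
  qed (use assms in \<open>simp_all add: add_pos_pos\<close>)
qed

end
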